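(* Let $1\le k\le n$, let $\Omega\subset\mathbb{R}^k$ be an open neighborhood of the origin, let $\Phi_1,\dots,\Phi_n:\Omega\to\mathbb{R}$ be smooth, let $\eta:\mathbb{R}^k\to\mathbb{R}$ be smooth and supported in a sufficiently small neighborhood $U\subseteq\Omega$ of the origin, and let $\delta_t(x)=(t^{b_1}x_1,\dots,t^{b_n}x_n)$ with $b_j\ge 1$ for all $1\le j\le n$. Put $$A^{\vec\Phi}_t f(y)=\int_{\mathbb{R}^k} f\big(y-\delta_t(\Phi_1(x),\dots,\Phi_n(x))\big)\eta(x)\,dx,\qquad \mathcal{M}_{\vec\Phi}f(y)=\sup_{t>0}|A^{\vec\Phi}_tf(y)| .$$ Suppose that the local operator $\tilde{\mathcal M}_{\vec\Phi}f=\sup_{1\le t\le 2}A_t^{\vec\Phi}f$ satisfies the local continuity property in the range $\mathcal{L}_n$ (see context). Let $\mathcal{L}_n'=\{(\frac1p,\frac1{q'}):(\frac1p,1-\frac1{q'})\in\mathcal{L}_n\}$. Then for all bounded compactly supported functions $f,g$ and for any $(\frac1p,\frac1{q'})\in\mathcal{L}_n'$, there exists a constant $C<\infty$ such that $$|\langle \mathcal{M}_{\vec\Phi}f,g\rangle|\le C\sup_{\mathcal S}\Lambda_{\mathcal S,p,q'}(f,g),$$ where the supremum is taken over all possible sparse collections $\mathcal S$ of $\delta$-cubes.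
   Context: Local continuity property in the range $\mathcal{L}_n$: $\mathcal{L}_n$ is a convex polygon with non-empty interior such that for all $(\frac1p,\frac1q)$ in the interior of $\mathcal{L}_n$ there is some $\epsilon=\epsilon(n,p,q)>0$ such that for all $z\in\mathbb{R}^n$ with $|z|\le1$, $$\Big\|\sup_{1\le t\le2}|A_t^{\vec\Phi}f-\tau_zA_t^{\vec\Phi}f|\Big\|_{q}\lesssim|z|^{\epsilon}\|f\|_p ,\qquad \tau_zF(y)=F(y-z).$$ A $\delta$-cube is an axes-parallel hyperrectangle $Q\subset\mathbb{R}^n$ whose side lengths are $l_1(Q)=2^{\lceil mb_1\rceil},\dots,l_n(Q)=2^{\lceil mb_n\rceil}$ for some $m\in\mathbb{Z}$. A collection $\mathcal S$ of $\delta$-cubes is sparse if there are pairwise disjoint sets $E_S\subseteq S$, $S\in\mathcal S$, with $|E_S|>\frac14|S|$ for all $S\in\mathcal{S}$. Notation: $\langle f\rangle_{Q,p}=\big(|Q|^{-1}\int_Q|f|^p\big)^{1/p}$, $\Lambda_{\mathcal S,p,q'}(f,g)=\sum_{S\in\mathcal S}|S|\,\langle f\rangle_{S,p}\langle g\rangle_{S,q'}$, and $\langle F,g\rangle=\int_{\mathbb{R}^n} Fg$. *)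

theory Defs
  imports "HOL-Analysis.Analysis" "HOL-Probability.Essential_Supremum"
begin

primrec C_diff_on :: "nat \<Rightarrow> ('a::real_normed_vector \<Rightarrow> 'b::real_normed_vector) \<Rightarrow> 'a set \<Rightarrow> bool" where
  "C_diff_on 0 f S \<longleftrightarrow> continuous_on S f"
| "C_diff_on (Suc m) f S \<longleftrightarrow> (\<forall>x\<in>S. f differentiable (at x)) \<and>
     (\<forall>v. C_diff_on m (\<lambda>x. frechet_derivative f (at x) v) S)"

(* Intended for open S, since derivatives are taken in the whole space. *)
definition smooth_on :: "'a set \<Rightarrow> ('a::real_normed_vector \<Rightarrow> 'b::real_normed_vector) \<Rightarrow> bool" where
  "smooth_on S f \<longleftrightarrow> (\<forall>m. C_diff_on m f S)"

definition dilate :: "('n::finite \<Rightarrow> real) \<Rightarrow> real \<Rightarrow> real^'n \<Rightarrow> real^'n" where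
  "dilate b t x = (\<chi> j. t powr b j * x $ j)"

(* Phi is a total function, but only its values on the support of eta (where it will be smooth)
   contribute to the integral. *)
definition avg_op ::
  "('n::finite \<Rightarrow> real) \<Rightarrow> ('n \<Rightarrow> real^'k::finite \<Rightarrow> real) \<Rightarrow> (real^'k \<Rightarrow> real) \<Rightarrow>
   real \<Rightarrow> (real^'n \<Rightarrow> complex) \<Rightarrow> real^'n \<Rightarrow> complex" where
  "avg_op b \<Phi> \<eta> t f y =
     (LINT x|lebesgue. f (y - dilate b t (\<chi> j. \<Phi> j x)) * complex_of_real (\<eta> x))"

definition max_op ::
  "('n::finite \<Rightarrow> real) \<Rightarrow> ('n \<Rightarrow> real^'k::finite \<Rightarrow> real) \<Rightarrow> (real^'k \<Rightarrow> real) \<Rightarrow>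
   (real^'n \<Rightarrow> complex) \<Rightarrow> real^'n \<Rightarrow> real" where
  "max_op b \<Phi> \<eta> f y = (SUP t\<in>{0<..}. norm (avg_op b \<Phi> \<eta> t f y))"

(* Borel rather than Lebesgue measurability: the averages run over lower-dimensional sets,
   so they have to be defined for every t and y, not only almost everywhere. *)
definition bdd_cpt_fun :: "('a::euclidean_space \<Rightarrow> complex) \<Rightarrow> bool" where
  "bdd_cpt_fun f \<longleftrightarrow> f \<in> borel_measurable borel \<and> bounded (range f) \<and> compact (closure {x. f x \<noteq> 0})"

definition Lp_norm :: "real \<Rightarrow> ('a::euclidean_space \<Rightarrow> 'b::real_normed_vector) \<Rightarrow> real" where
  "Lp_norm p F = (LINT y|lebesgue. norm (F y) powr p) powr (1 / p)"

definition translate :: "'a::real_vector \<Rightarrow> ('a \<Rightarrow> 'b) \<Rightarrow> 'a \<Rightarrow> 'b" where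
  "translate z F y = F (y - z)"

definition local_diff_sup ::
  "('n::finite \<Rightarrow> real) \<Rightarrow> ('n \<Rightarrow> real^'k::finite \<Rightarrow> real) \<Rightarrow> (real^'k \<Rightarrow> real) \<Rightarrow>
   real^'n \<Rightarrow> (real^'n \<Rightarrow> complex) \<Rightarrow> real^'n \<Rightarrow> real" where
  "local_diff_sup b \<Phi> \<eta> z f y =
     (SUP t\<in>{1..2}. norm (avg_op b \<Phi> \<eta> t f y - translate z (avg_op b \<Phi> \<eta> t f) y))"

(* L lives in the (1/p, 1/q)-plane, hence in the unit square.  The integrability clause says that
   the left-hand side is an honest L^q norm, because a Lebesgue integral that does not exist is 0. *)
definition local_continuity ::
  "(real \<times> real) set \<Rightarrow> ('n::finite \<Rightarrow> real) \<Rightarrow> ('n \<Rightarrow> real^'k::finite \<Rightarrow> real) \<Rightarrow>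
   (real^'k \<Rightarrow> real) \<Rightarrow> bool" where
  "local_continuity L b \<Phi> \<eta> \<longleftrightarrow>
     polytope L \<and> interior L \<noteq> {} \<and> L \<subseteq> {0..1} \<times> {0..1} \<and>
     (\<forall>p q. 1 \<le> p \<and> 1 \<le> q \<and> (1 / p, 1 / q) \<in> interior L \<longrightarrow>
       (\<exists>\<epsilon>>0. \<exists>C. \<forall>z. norm z \<le> 1 \<longrightarrow> (\<forall>f. bdd_cpt_fun f \<longrightarrow>
          integrable lebesgue (\<lambda>y. local_diff_sup b \<Phi> \<eta> z f y powr q) \<and>
          Lp_norm q (local_diff_sup b \<Phi> \<eta> z f) \<le> C * norm z powr \<epsilon> * Lp_norm p f)))"

definition delta_cube :: "('n::finite \<Rightarrow> real) \<Rightarrow> (real^'n) set \<Rightarrow> bool" where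
  "delta_cube b Q \<longleftrightarrow> (\<exists>(m::int) a. Q = cbox a (a + (\<chi> j. 2 powi \<lceil>real_of_int m * b j\<rceil>)))"

definition sparse :: "('a::euclidean_space) set set \<Rightarrow> bool" where
  "sparse \<S> \<longleftrightarrow> (\<exists>E. disjoint_family_on E \<S> \<and>
     (\<forall>S\<in>\<S>. E S \<in> sets lebesgue \<and> E S \<subseteq> S \<and> measure lebesgue (E S) > measure lebesgue S / 4))"

(* For p = \<infinity> the average is read, as usual, as the essential supremum over Q. *)
definition cube_avg :: "'a::euclidean_space set \<Rightarrow> ennreal \<Rightarrow> ('a \<Rightarrow> complex) \<Rightarrow> ennreal" where
  "cube_avg Q p f =
     (if p = \<infinity> then esssup (restrict_space lebesgue Q) (\<lambda>y. ennreal (norm (f y)))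
      else ennreal (((LINT y:Q|lebesgue. norm (f y) powr enn2real p) / measure lebesgue Q)
                      powr (1 / enn2real p)))"

definition sparse_form ::
  "'a::euclidean_space set set \<Rightarrow> ennreal \<Rightarrow> ennreal \<Rightarrow> ('a \<Rightarrow> complex) \<Rightarrow> ('a \<Rightarrow> complex) \<Rightarrow> ennreal" where
  "sparse_form \<S> p r f g =
     (\<Sum>\<^sub>\<infinity>S\<in>\<S>. ennreal (measure lebesgue S) * cube_avg S p f * cube_avg S r g)"

definition sparse_sup ::
  "('n::finite \<Rightarrow> real) \<Rightarrow> ennreal \<Rightarrow> ennreal \<Rightarrow> (real^'n \<Rightarrow> complex) \<Rightarrow> (real^'n \<Rightarrow> complex) \<Rightarrow> ennreal" where
  "sparse_sup b p r f g = (SUP \<S>\<in>{\<S>. sparse \<S> \<and> (\<forall>S\<in>\<S>. delta_cube b S)}. sparse_form \<S> p r f g)"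

definition pairing :: "('a::euclidean_space \<Rightarrow> real) \<Rightarrow> ('a \<Rightarrow> complex) \<Rightarrow> complex" where
  "pairing F g = (LINT y|lebesgue. complex_of_real (F y) * g y)"

definition dual_range :: "(real \<times> real) set \<Rightarrow> (real \<times> real) set" where
  "dual_range L = {(u, w). (u, 1 - w) \<in> L}"

end

theory Submission
  imports Defs
begin

text \<open>
  If \<open>p > q\<close>, the local continuity property forces the operator to vanish, so let \<open>p \<le> q\<close>. For almost every \<open>y\<close> the average is continuous in the dilation parameter, because the
  function is a limit of continuous functions and the local maximal operator is bounded; this replaces
  the supremum by a measurable choice \<open>\<tau>(y)\<close> of the parameter, and the operator becomes linear.
  By the one-third trick the average of \<open>f\<close> at \<open>y\<close> at scale \<open>k\<close> only sees \<open>f\<close> on the cube of level \<open>k\<close>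
  around \<open>y\<close> in one of finitely many dyadic grids.

  In a fixed grid and on a cube \<open>S\<close>, stop at the maximal cubes \<open>P\<close> on which the \<open>L\<^sup>p\<close>-average of \<open>f\<close> is
  large compared with \<open>S\<close>. Above the stopping cubes, \<open>f\<close> is its conditional expectation, which is
  bounded, plus pieces of mean zero on the stopping cubes. A piece living \<open>s\<close> levels below the scale of
  the operator is an average of differences of translates, so local continuity gains a factor
  \<open>2\<^sup>-\<^sup>\<epsilon>\<^sup>s\<close>. Young's inequality with weights depending on \<open>s\<close> sums all contributions to a multiple of
  \<open>|S| \<langle>f\<rangle>\<^sub>S \<langle>g\<rangle>\<^sub>S\<close>, and the averages below the stopping cubes are handled by induction on the level.
  The union of the stopping cubes has at most half the measure of \<open>S\<close>, which makes the family sparse.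
\<close>

section \<open>Averaging operators\<close>

text \<open>The hypothesis bounds differences of translates, not the operator itself, and only for
  parameters in the octave [1, 2]. Averages of compactly supported functions have bounded support,
  so telescoping along unit translates recovers a bound for the local maximal operator, and dilation
  gives the other octaves. Averages may run over null sets, so statements valid for almost every
  point have to come from that bound. A right-hand side (N f)^(q/p), with N f the integral of |f|^p,
  cannot be summed over disjoint cubes efficiently. For p \<le> q it is weakened to Z^(q/p - 1) N f,
  where Z bounds N f: this is linear in the energy, and the stopping rule supplies Z on every cube
  of the scale at hand. Young's inequality serves the same aim: it turns products of f and g into
  sums of energies, and dividing by the averages \<alpha> and \<beta> beforehand restores the
  product. The right-hand side is a supremum over sparse families, so the family may depend on f, g,
  the grid and the choice of parameter; only the constant may not. It is also independent of the
  number of levels, so passing from finitely many parameters to all is a monotone limit.\<close>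

lemma young_simple:
  fixes u w :: real
  assumes "1 < q" "1 < r" "1/q + 1/r = 1" "0 \<le> u" "0 \<le> w"
  shows "u * w \<le> u powr q + w powr r"
proof -
  have "u * w \<le> u powr q / q + w powr r / r"
    using assms by (intro Youngs_inequality) auto
  also have "\<dots> \<le> u powr q + w powr r"
    using assms by (intro add_mono) (auto simp: divide_le_eq mult_le_cancel_left1)
  finally show ?thesis .
qed

text \<open>Above the threshold \<open>c\<close> the factor \<open>x powr (1 - p)\<close> is at most
  \<open>c powr (1 - p)\<close>, the exponent being at most 0. Linear in \<open>x powr p\<close>,
  the bound can be integrated directly and stands in for Hoelder's inequality.\<close>

lemma le_add_powr:
  fixes x c p :: real
  assumes "0 \<le> x" "0 < c" "1 \<le> p"
  shows "x \<le> c + c powr (1 - p) * x powr p"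
proof (cases "x \<le> c")
  case True
  then show ?thesis by (simp add: add_increasing2)
next
  case False
  then have "x = x powr (1 - p) * x powr p"
    using assms by (simp add: powr_add[symmetric])
  also have "\<dots> \<le> c powr (1 - p) * x powr p"
    using assms False by (intro mult_right_mono powr_mono2') auto
  finally show ?thesis using assms by linarith
qed

lemma powr_sum_le:
  fixes a :: "'i \<Rightarrow> real"
  assumes "finite I" "\<And>i. i \<in> I \<Longrightarrow> 0 \<le> a i" "0 \<le> q"
  shows "(\<Sum>i\<in>I. a i) powr q \<le> real (card I) powr q * (\<Sum>i\<in>I. a i powr q)"
proof (cases "I = {}")
  case False
  define M where "M = Max (a ` I)"
  have fin: "finite (a ` I)" "a ` I \<noteq> {}" using assms False by auto
  obtain j where j: "j \<in> I" "M = a j"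
    using Max_in[OF fin] unfolding M_def by auto
  have "(\<Sum>i\<in>I. a i) \<le> real (card I) * M"
    using fin by (intro sum_bounded_above) (auto simp: M_def)
  then have "(\<Sum>i\<in>I. a i) powr q \<le> (real (card I) * M) powr q"
    using assms by (intro powr_mono2) (auto intro!: sum_nonneg)
  also have "\<dots> = real (card I) powr q * a j powr q"
    using assms j by (simp add: powr_mult)
  also have "\<dots> \<le> real (card I) powr q * (\<Sum>i\<in>I. a i powr q)"
    using assms j by (intro mult_left_mono member_le_sum) auto
  finally show ?thesis .
qed simp

lemma powr_add_le:
  fixes x y q :: real
  assumes "0 \<le> x" "0 \<le> y" "0 \<le> q"
  shows "(x + y) powr q \<le> 2 powr q * (x powr q + y powr q)"
  using powr_sum_le[of "{True, False}" "\<lambda>i. if i then x else y" q] assms by simp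

lemma geometric_powr_sum_le:
  fixes d :: real
  assumes "0 < d" "finite I" "inj_on h I" "\<And>i. i \<in> I \<Longrightarrow> (1::int) \<le> h i"
  shows "(\<Sum>i\<in>I. 2 powr (- d * of_int (h i))) \<le> 1 / (1 - 2 powr (- d))"
proof -
  have lt: "2 powr (- d) < 1" using assms by (simp add: powr_less_one)
  have "(\<Sum>i\<in>I. 2 powr (- d * of_int (h i))) = (\<Sum>k\<in>(nat \<circ> h) ` I. (2 powr (- d)) ^ k)"
  proof (subst sum.reindex)
    show "inj_on (nat \<circ> h) I"
      using assms(3,4) unfolding inj_on_def by (metis comp_apply nat_0_le order_trans zero_le_one)
    show "(\<Sum>i\<in>I. 2 powr (- d * of_int (h i))) = sum ((\<lambda>k. (2 powr (- d)) ^ k) \<circ> (nat \<circ> h)) I"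
      using assms(4) by (intro sum.cong refl) (fastforce simp: powr_realpow[symmetric] powr_powr)
  qed
  also have "\<dots> \<le> (\<Sum>k. (2 powr (- d)) ^ k)"
    using lt assms by (intro sum_le_suminf) (auto intro: summable_geometric)
  also have "\<dots> = 1 / (1 - 2 powr (- d))"
    using lt by (subst suminf_geometric) auto
  finally show ?thesis .
qed

text \<open>Integrating \<open>le_add_powr\<close> over \<open>K\<close> with threshold
  \<open>c\<close>: both summands contribute \<open>c * \<mu>\<close>, hence the factor 2 in this
  form of Hoelder's inequality.\<close>

lemma nn_integral_mean_le:
  fixes h :: "'a \<Rightarrow> real"
  assumes [measurable]: "h \<in> borel_measurable M" "K \<in> sets M"
    and "\<And>x. x \<in> K \<Longrightarrow> 0 \<le> h x" "1 \<le> p" "0 < c" "0 \<le> \<mu>"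
    and \<mu>: "emeasure M K = ennreal \<mu>"
    and le: "(\<integral>\<^sup>+x\<in>K. ennreal (h x powr p) \<partial>M) \<le> ennreal (c powr p * \<mu>)"
  shows "(\<integral>\<^sup>+x\<in>K. ennreal (h x) \<partial>M) \<le> ennreal (2 * c * \<mu>)"
proof -
  have "(\<integral>\<^sup>+x\<in>K. ennreal (h x) \<partial>M) \<le>
      (\<integral>\<^sup>+x. ennreal c * indicator K x + ennreal (c powr (1 - p)) * (ennreal (h x powr p) * indicator K x) \<partial>M)"
  proof (intro nn_integral_mono)
    fix x
    show "ennreal (h x) * indicator K x \<le>
      ennreal c * indicator K x + ennreal (c powr (1 - p)) * (ennreal (h x powr p) * indicator K x)"
    proof (cases "x \<in> K")
      case True
      have "h x \<le> c + c powr (1 - p) * h x powr p"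
        using assms True by (intro le_add_powr) auto
      then have "ennreal (h x) \<le> ennreal (c + c powr (1 - p) * h x powr p)" by (rule ennreal_leI)
      then show ?thesis using True assms by (simp add: ennreal_mult ennreal_plus)
    qed simp
  qed
  also have "\<dots> = ennreal c * emeasure M K + ennreal (c powr (1 - p)) * (\<integral>\<^sup>+x\<in>K. ennreal (h x powr p) \<partial>M)"
    by (simp add: nn_integral_add nn_integral_cmult nn_integral_cmult_indicator)
  also have "\<dots> \<le> ennreal c * ennreal \<mu> + ennreal (c powr (1 - p)) * ennreal (c powr p * \<mu>)"
    unfolding \<mu> by (intro add_mono mult_left_mono le) auto
  also have "\<dots> = ennreal (c * \<mu> + c powr (1 - p) * (c powr p * \<mu>))"
    using assms by (subst ennreal_plus) (auto simp: ennreal_mult)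
  also have "c * \<mu> + c powr (1 - p) * (c powr p * \<mu>) = 2 * c * \<mu>"
    using assms by (simp add: mult.assoc[symmetric] powr_add[symmetric])
  finally show ?thesis .
qed

section \<open>Anisotropic dilations and changes of variables\<close>

lemma dilate_nth [simp]: "dilate b t x $ j = t powr b j * x $ j"
  by (simp add: dilate_def)

lemma dilate_dilate: "dilate b s (dilate b t x) = dilate b (s * t) x"
  by (simp add: vec_eq_iff powr_mult)

lemma dilate_one [simp]: "dilate b 1 x = x"
  by (simp add: vec_eq_iff)

lemma dilate_diff: "dilate b t (x - y) = dilate b t x - dilate b t y"
  by (simp add: vec_eq_iff algebra_simps)

lemma dilate_inverse [simp]: "0 < t \<Longrightarrow> dilate b t (dilate b (1 / t) x) = x"
  "0 < t \<Longrightarrow> dilate b (1 / t) (dilate b t x) = x"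
  by (simp_all add: dilate_dilate)

lemma dilate_eq_sum: "dilate b t x = (\<Sum>i\<in>UNIV. (t powr b i * x $ i) *\<^sub>R axis i 1)"
  by (simp add: vec_eq_iff axis_def if_distrib cong: if_cong)

lemma measurable_vec_nth [measurable (raw)]:
  assumes "x \<in> borel_measurable M"
  shows "(\<lambda>w. x w $ i) \<in> borel_measurable M"
  by (rule measurable_compose[OF assms borel_measurable_continuous_onI]) (intro continuous_intros)

lemma measurable_dilate [measurable (raw)]:
  assumes [measurable]: "t \<in> borel_measurable M" "x \<in> borel_measurable M"
  shows "(\<lambda>w. dilate b (t w) (x w :: real^'n::finite)) \<in> borel_measurable M"
  unfolding dilate_eq_sum
  by (intro borel_measurable_sum borel_measurable_scaleR borel_measurable_times powr_real_measurable
      measurable_vec_nth) auto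

lemma continuous_dilate: "continuous_on S (\<lambda>x. dilate b t (x :: real^'n::finite))"
  unfolding dilate_def by (intro continuous_intros)

lemma nn_integral_translate:
  fixes a :: "'a::euclidean_space"
  assumes [measurable]: "h \<in> borel_measurable borel"
  shows "(\<integral>\<^sup>+x. h (x + a) \<partial>lborel) = (\<integral>\<^sup>+x. h x \<partial>lborel)"
proof -
  have "(\<integral>\<^sup>+x. h x \<partial>lborel) = (\<integral>\<^sup>+x. h x \<partial>distr lborel borel ((+) a))"
    by (simp add: lborel_distr_plus)
  also have "\<dots> = (\<integral>\<^sup>+x. h (a + x) \<partial>lborel)"
    by (subst nn_integral_distr) auto
  finally show ?thesis by (simp add: add.commute)
qed

lemma nn_integral_dilate:
  fixes b :: "'n::finite \<Rightarrow> real"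
  assumes [measurable]: "h \<in> borel_measurable borel" and D: "0 < D"
  shows "(\<integral>\<^sup>+x. h x \<partial>lborel) = ennreal (D powr (\<Sum>j\<in>UNIV. b j)) * (\<integral>\<^sup>+x. h (dilate b D x) \<partial>lborel)"
proof -
  define c where "c j = dilate b D j \<bullet> j" for j :: "real^'n"
  have c_axis: "c (axis i 1) = D powr b i" for i
    by (simp add: c_def inner_axis)
  have T: "dilate b D = (\<lambda>x. 0 + (\<Sum>j\<in>Basis. (c j * (x \<bullet> j)) *\<^sub>R j))"
  proof
    fix x :: "real^'n"
    have "dilate b D x \<bullet> j = c j * (x \<bullet> j)" if "j \<in> Basis" for j
    proof -
      obtain i where "j = axis i 1" using \<open>j \<in> Basis\<close> by (auto simp: Basis_vec_def)
      then show ?thesis by (simp add: c_axis inner_axis)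
    qed
    then show "dilate b D x = 0 + (\<Sum>j\<in>Basis. (c j * (x \<bullet> j)) *\<^sub>R j)"
      by (metis (no_types, lifting) add_0 euclidean_representation sum.cong)
  qed
  have c0: "c j \<noteq> 0" if "j \<in> Basis" for j
    using that D by (auto simp: Basis_vec_def c_axis)
  have "(\<Prod>j\<in>Basis. \<bar>c j\<bar>) = (\<Prod>i\<in>UNIV. \<bar>D powr b i\<bar>)"
    by (simp add: Basis_vec_def axis_eq_axis prod.UNION_disjoint c_axis)
  also have "\<dots> = D powr (\<Sum>j\<in>UNIV. b j)"
    using D by (simp add: powr_sum)
  finally have jac: "(\<Prod>j\<in>Basis. \<bar>c j\<bar>) = D powr (\<Sum>j\<in>UNIV. b j)" .
  have "(\<integral>\<^sup>+x. h x \<partial>lborel) =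
      (\<integral>\<^sup>+x. h x \<partial>density (distr lborel borel (dilate b D)) (\<lambda>_. (\<Prod>j\<in>Basis. \<bar>c j\<bar>)))"
    unfolding T by (subst lborel_affine_euclidean[where t = 0 and c = c, OF c0]) auto
  also have "\<dots> = ennreal (D powr (\<Sum>j\<in>UNIV. b j)) * (\<integral>\<^sup>+x. h (dilate b D x) \<partial>lborel)"
    unfolding jac by (simp add: nn_integral_density nn_integral_distr nn_integral_cmult)
  finally show ?thesis .
qed

lemma AE_dilate:
  fixes b :: "'n::finite \<Rightarrow> real"
  assumes "AE x in lborel. P (x :: real^'n)" and D: "0 < D"
  shows "AE x in lborel. P (dilate b D x)"
proof -
  obtain N where N: "{x. \<not> P x} \<subseteq> N" "N \<in> null_sets lborel"
    using assms(1) by (auto elim!: AE_E simp: null_sets_def)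
  then have [measurable]: "N \<in> sets borel" by auto
  have "0 = (\<integral>\<^sup>+x. indicator N x \<partial>(lborel :: (real^'n) measure))"
    using N by auto
  also have "\<dots> = ennreal (D powr (\<Sum>j\<in>UNIV. b j)) * (\<integral>\<^sup>+x. indicator N (dilate b D x) \<partial>lborel)"
    by (rule nn_integral_dilate) (use D in auto)
  finally have "(\<integral>\<^sup>+x. indicator N (dilate b D x) \<partial>lborel) = 0"
    using D by (auto simp: ennreal_zero_less_mult_iff)
  then have "AE x in lborel. indicator N (dilate b D x) = (0::ennreal)"
    by (subst (asm) nn_integral_0_iff_AE) auto
  then show ?thesis
    by eventually_elim (use N in \<open>auto simp: indicator_def split: if_splits\<close>)
qed

section \<open>Bounded Borel functions\<close>

definition bdd_borel :: "('a::topological_space \<Rightarrow> complex) \<Rightarrow> bool" where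
  "bdd_borel f \<longleftrightarrow> f \<in> borel_measurable borel \<and> bounded (range f)"

lemma bdd_borelD: "bdd_borel f \<Longrightarrow> f \<in> borel_measurable borel"
  by (simp add: bdd_borel_def)

lemma bdd_borel_bound: "bdd_borel f \<Longrightarrow> \<exists>c>0. \<forall>x. norm (f x) \<le> c"
  by (auto simp: bdd_borel_def bounded_pos)

lemma bdd_borelI: "f \<in> borel_measurable borel \<Longrightarrow> (\<And>x. norm (f x) \<le> c) \<Longrightarrow> bdd_borel f"
  by (auto simp: bdd_borel_def bounded_iff)

lemma bdd_cpt_fun_iff:
  "bdd_cpt_fun f \<longleftrightarrow> bdd_borel f \<and> bounded {x. f x \<noteq> 0}"
  by (auto simp: bdd_cpt_fun_def bdd_borel_def compact_closure)

lemma bdd_borel_add: "bdd_borel f \<Longrightarrow> bdd_borel g \<Longrightarrow> bdd_borel (\<lambda>x. f x + g x)"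
  unfolding bdd_borel_def by (auto intro: bounded_plus_comp)

lemma bdd_borel_diff: "bdd_borel f \<Longrightarrow> bdd_borel g \<Longrightarrow> bdd_borel (\<lambda>x. f x - g x)"
  unfolding bdd_borel_def by (auto intro: bounded_minus_comp)

lemma bdd_borel_sum: "(\<And>i. i \<in> I \<Longrightarrow> bdd_borel (f i)) \<Longrightarrow> bdd_borel (\<lambda>x. \<Sum>i\<in>I. f i x)"
proof (induction I rule: infinite_finite_induct)
  case (insert i I)
  then show ?case by (auto intro!: bdd_borel_add)
qed (auto simp: bdd_borel_def)

lemma bdd_borel_mult_indicator:
  assumes "bdd_borel f" "S \<in> sets borel"
  shows "bdd_borel (\<lambda>x. f x * indicator S x)"
proof -
  obtain c where c: "\<forall>x. norm (f x) \<le> c" "c > 0" using bdd_borel_bound assms by blast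
  have [measurable]: "f \<in> borel_measurable borel" "S \<in> sets borel" using assms bdd_borelD by auto
  show ?thesis
    using c by (intro bdd_borelI[where c = c]) (auto simp: indicator_def)
qed

lemma bdd_borel_compose:
  assumes "bdd_borel f" "g \<in> borel_measurable borel"
  shows "bdd_borel (\<lambda>x. f (g x))"
  using assms bdd_borel_bound[OF assms(1)] bdd_borelD[OF assms(1)]
  by (auto intro!: bdd_borelI measurable_compose[OF assms(2)])

lemma bdd_cpt_fun_dilate:
  fixes f :: "real^'n::finite \<Rightarrow> complex"
  assumes f: "bdd_cpt_fun f" and D: "0 < D"
  shows "bdd_cpt_fun (\<lambda>x. f (dilate b D x))"
  unfolding bdd_cpt_fun_iff
proof
  show "bdd_borel (\<lambda>x. f (dilate b D x))"
    using f by (rule_tac bdd_borel_compose[of f "dilate b D"]) (simp add: bdd_cpt_fun_iff, measurable)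
  have "{x. f (dilate b D x) \<noteq> 0} \<subseteq> dilate b (1 / D) ` {x. f x \<noteq> 0}"
    using D by (auto simp: image_iff) (metis dilate_inverse(2))
  moreover have "bounded (dilate b (1 / D) ` {x. f x \<noteq> 0})"
  proof (rule bounded_subset[OF compact_imp_bounded])
    show "compact (dilate b (1 / D) ` closure {x. f x \<noteq> 0})"
      using f by (intro compact_continuous_image continuous_dilate) (auto simp: bdd_cpt_fun_def)
  qed (auto intro: closure_subset[THEN subsetD])
  ultimately show "bounded {x. f (dilate b D x) \<noteq> 0}" by (metis bounded_subset)
qed

text \<open>Abstract form of the averages: the amplitude is split into the finite measure \<nu>,
  which carries |\<eta>|, and a factor \<open>sg\<close> of modulus at most 1, and the map \<Psi> is
  globally bounded. Bounded Borel functions then have averages at every point and for every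
  \<open>t\<close>, and \<open>R\<close> measures how far the operator looks.\<close>

locale averaging = finite_measure \<nu> for \<nu> :: "'x measure" +
  fixes \<Psi> :: "'x \<Rightarrow> real^'n::finite" and sg :: "'x \<Rightarrow> real" and b :: "'n \<Rightarrow> real" and R :: real
  assumes Psi_meas [measurable]: "\<Psi> \<in> borel_measurable \<nu>"
    and sg_meas [measurable]: "sg \<in> borel_measurable \<nu>"
    and sg_bound: "\<And>x. \<bar>sg x\<bar> \<le> 1"
    and Psi_bound: "\<And>x j. \<bar>\<Psi> x $ j\<bar> \<le> R"
    and b_ge: "\<And>j. 1 \<le> b j"
begin

definition A :: "real \<Rightarrow> (real^'n \<Rightarrow> complex) \<Rightarrow> real^'n \<Rightarrow> complex" where
  "A t f y = (LINT x|\<nu>. f (y - dilate b t (\<Psi> x)) * complex_of_real (sg x))"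

definition mass :: real where "mass = measure \<nu> (space \<nu>)"

lemma mass_nonneg [simp]: "0 \<le> mass" by (simp add: mass_def)

lemma A_integrable:
  assumes "bdd_borel f"
  shows "integrable \<nu> (\<lambda>x. f (y - dilate b t (\<Psi> x)) * complex_of_real (sg x))"
proof -
  obtain c where c: "\<forall>x. norm (f x) \<le> c" "c > 0" using bdd_borel_bound assms by blast
  have [measurable]: "f \<in> borel_measurable borel" using assms by (rule bdd_borelD)
  show ?thesis
  proof (rule integrable_const_bound[where B = c])
    show "AE x in \<nu>. norm (f (y - dilate b t (\<Psi> x)) * complex_of_real (sg x)) \<le> c"
      using c sg_bound by (intro AE_I2) (simp add: norm_mult mult_le_one mult_left_le order_trans[OF mult_mono[of _ c _ 1]])
  qed measurable
qed

lemma A_norm_le: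
  assumes "\<And>x. norm (f x) \<le> c"
  shows "norm (A t f y) \<le> c * mass"
proof -
  have c: "0 \<le> c" using assms order_trans norm_ge_zero by blast
  have "norm (A t f y) \<le> (LINT x|\<nu>. norm (f (y - dilate b t (\<Psi> x)) * complex_of_real (sg x)))"
    unfolding A_def by (rule integral_norm_bound)
  also have "\<dots> \<le> (LINT x|\<nu>. c)"
  proof (rule integral_mono')
    fix x
    show "norm (f (y - dilate b t (\<Psi> x)) * complex_of_real (sg x)) \<le> c"
      using mult_mono[OF assms[of "y - dilate b t (\<Psi> x)"] sg_bound[of x]] c by (simp add: norm_mult)
  qed (use c in auto)
  finally show ?thesis by (simp add: mass_def mult.commute)
qed

lemma A_add: "bdd_borel f \<Longrightarrow> bdd_borel g \<Longrightarrow> A t (\<lambda>x. f x + g x) y = A t f y + A t g y"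
  unfolding A_def by (simp add: distrib_right A_integrable)

lemma A_diff: "bdd_borel f \<Longrightarrow> bdd_borel g \<Longrightarrow> A t (\<lambda>x. f x - g x) y = A t f y - A t g y"
  unfolding A_def by (simp add: left_diff_distrib A_integrable)

lemma A_zero [simp]: "A t (\<lambda>x. 0) y = 0"
  by (simp add: A_def)

lemma A_sum:
  "finite I \<Longrightarrow> (\<And>i. i \<in> I \<Longrightarrow> bdd_borel (f i)) \<Longrightarrow> A t (\<lambda>x. \<Sum>i\<in>I. f i x) y = (\<Sum>i\<in>I. A t (f i) y)"
  by (induction I rule: finite_induct) (auto simp: A_add bdd_borel_sum)

lemma A_translate: "A t (\<lambda>x. f (x - z)) y = A t f (y - z)"
  unfolding A_def by (simp add: algebra_simps)

lemma A_dilate: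
  assumes "0 < D"
  shows "A (D * t) f y = A t (\<lambda>x. f (dilate b D x)) (dilate b (1 / D) y)"
  using assms unfolding A_def by (simp add: dilate_diff dilate_dilate)

lemma A_local:
  assumes "\<And>u. (\<And>j. \<bar>y $ j - u $ j\<bar> \<le> R * t powr b j) \<Longrightarrow> f u = f' u"
  shows "A t f y = A t f' y"
  unfolding A_def
proof (rule Bochner_Integration.integral_cong[OF refl])
  fix x
  have "\<bar>y $ j - (y - dilate b t (\<Psi> x)) $ j\<bar> \<le> R * t powr b j" for j
    using mult_right_mono[OF Psi_bound[of x j], of "t powr b j"] by (simp add: abs_mult mult.commute)
  then show "f (y - dilate b t (\<Psi> x)) * complex_of_real (sg x) =
      f' (y - dilate b t (\<Psi> x)) * complex_of_real (sg x)"
    using assms by metis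
qed

text \<open>The function argument may depend on the point as well, since later the operator is
  applied at \<open>y\<close> to a function cut off to the cell around \<open>y\<close>.\<close>

lemma measurable_A:
  assumes [measurable]: "(\<lambda>(w, x). F w x) \<in> borel_measurable (N \<Otimes>\<^sub>M borel)"
    "t \<in> borel_measurable N" "Y \<in> borel_measurable N"
  shows "(\<lambda>w. A (t w) (F w) (Y w)) \<in> borel_measurable N"
  unfolding A_def by measurable

lemma measurable_A_const [measurable (raw)]:
  assumes [measurable]: "f \<in> borel_measurable borel" "t \<in> borel_measurable M" "Y \<in> borel_measurable M"
  shows "(\<lambda>w. A (t w) f (Y w)) \<in> borel_measurable M"
  by (rule measurable_A[where F = "\<lambda>_. f"]) auto

end

section \<open>Dyadic grids of anisotropic cubes\<close>

text \<open>Jensen's inequality up to the factor \<open>2 powr q\<close>. With \<open>c\<close>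
  chosen so that \<open>c powr q * \<mu>\<close> is the integral \<open>I\<close> of
  \<open>h powr q\<close>, the bound \<open>nn_integral_mean_le\<close> gives
  \<open>X \<le> 2 * c\<close>; for \<open>I = 0\<close> every positive \<open>c\<close> is
  admissible, so \<open>X = 0\<close>.\<close>

lemma nn_integral_power_mean:
  fixes h :: "'a \<Rightarrow> real"
  assumes [measurable]: "h \<in> borel_measurable M" "K \<in> sets M"
    and h0: "\<And>x. x \<in> K \<Longrightarrow> 0 \<le> h x" and q: "1 \<le> q" and X: "0 \<le> X" and \<mu>0: "0 < \<mu>"
    and \<mu>: "emeasure M K = ennreal \<mu>"
    and le: "ennreal (X * \<mu>) \<le> (\<integral>\<^sup>+x\<in>K. ennreal (h x) \<partial>M)"
  shows "ennreal (X powr q) \<le> ennreal (2 powr q / \<mu>) * (\<integral>\<^sup>+x\<in>K. ennreal (h x powr q) \<partial>M)"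
proof (cases "(\<integral>\<^sup>+x\<in>K. ennreal (h x powr q) \<partial>M)")
  case (real I)
  have Xle: "X \<le> 2 * c" if c: "0 < c" "I \<le> c powr q * \<mu>" for c
  proof -
    have "ennreal (X * \<mu>) \<le> ennreal (2 * c * \<mu>)"
      using le by (rule order_trans, intro nn_integral_mean_le[where p = q])
        (use assms real c in \<open>auto intro: ennreal_leI\<close>)
    then have "X * \<mu> \<le> 2 * c * \<mu>"
      using c \<mu>0 by (subst (asm) ennreal_le_iff) auto
    then show ?thesis using \<mu>0 by simp
  qed
  have "X powr q \<le> 2 powr q / \<mu> * I"
  proof (cases "I = 0")
    case True
    have "X \<le> 0"
    proof (rule field_le_epsilon)
      fix e :: real assume "0 < e"
      then show "X \<le> 0 + e" using Xle[of "e / 2"] True \<mu>0 by simp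
    qed
    then show ?thesis using X True by simp
  next
    case False
    define c where "c = (I / \<mu>) powr (1 / q)"
    have c: "0 < c" "c powr q = I / \<mu>"
      using False real \<mu>0 q by (auto simp: c_def powr_powr)
    have "X powr q \<le> (2 * c) powr q"
      using Xle[of c] c \<mu>0 X q by (intro powr_mono2) auto
    also have "\<dots> = 2 powr q / \<mu> * I"
      using c by (simp add: powr_mult)
    finally show ?thesis .
  qed
  then show ?thesis
    using real \<mu>0 by (simp add: ennreal_mult[symmetric] ennreal_leI)
next
  case top
  then show ?thesis using \<mu>0 by (simp add: ennreal_mult_top)
qed

context averaging
begin

definition side :: "int \<Rightarrow> 'n \<Rightarrow> real" where
  "side l j = 2 powr of_int \<lceil>of_int l * b j\<rceil>"

definition vol :: "int \<Rightarrow> real" where "vol l = (\<Prod>j\<in>UNIV. side l j)"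

text \<open>Homogeneous dimension: the dilation by \<open>t\<close> multiplies volumes by
  \<open>t powr hom\<close>.\<close>

definition hom :: real where "hom = (\<Sum>j\<in>UNIV. b j)"

definition corner :: "real^'n \<Rightarrow> int \<Rightarrow> real^'n \<Rightarrow> real^'n" where
  "corner v l x = (\<chi> j. v $ j + of_int \<lfloor>(x $ j - v $ j) / side l j\<rfloor> * side l j)"

text \<open>Membership in a common half-open cell, phrased through integer parts: an equivalence
  relation that is measurable in both points, so averages and energies of cells become measurable
  functions of a moving point.\<close>

definition same :: "real^'n \<Rightarrow> int \<Rightarrow> real^'n \<Rightarrow> real^'n \<Rightarrow> bool" where
  "same v l x y \<longleftrightarrow> (\<forall>j. \<lfloor>(x $ j - v $ j) / side l j\<rfloor> = \<lfloor>(y $ j - v $ j) / side l j\<rfloor>)"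

definition cell :: "real^'n \<Rightarrow> int \<Rightarrow> real^'n \<Rightarrow> (real^'n) set" where
  "cell v l x = {y. same v l x y}"

text \<open>Sparse collections consist of closed cubes, whereas the half-open \<open>cell\<close> is
  what partitions space. The two differ by a null set.\<close>

definition cube :: "real^'n \<Rightarrow> int \<Rightarrow> real^'n \<Rightarrow> (real^'n) set" where
  "cube v l x = cbox (corner v l x) (corner v l x + (\<chi> j. side l j))"

lemma side_pos [simp]: "0 < side l j" by (simp add: side_def)
lemma side_nonneg [simp]: "0 \<le> side l j" by (simp add: side_def)
lemma side_nz [simp]: "side l j \<noteq> 0" by (simp add: side_def)
lemma vol_pos [simp]: "0 < vol l" by (simp add: vol_def prod_pos)
lemma vol_nonneg [simp]: "0 \<le> vol l" using vol_pos less_imp_le by blast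

lemma side_ge: "2 powr (of_int l * b j) \<le> side l j"
  unfolding side_def by (intro powr_mono) (auto simp: le_of_int_ceiling)

lemma side_le: "side l j \<le> 2 * 2 powr (of_int l * b j)"
proof -
  have "side l j \<le> 2 powr (1 + of_int l * b j)"
    unfolding side_def by (intro powr_mono) linarith+
  then show ?thesis by (simp add: powr_add)
qed

text \<open>The exponents are integers and increase with the level, so the sides of two levels
  differ by a power of 2. Rounding the exponents therefore does not destroy the nesting of the
  grids.\<close>

lemma side_mono_int:
  assumes "l \<le> l'"
  obtains d :: nat where "side l' j = side l j * 2 ^ d"
proof -
  have "\<lceil>of_int l * b j\<rceil> \<le> \<lceil>of_int l' * b j\<rceil>"
    using assms b_ge[of j] by (intro ceiling_mono mult_right_mono) auto
  then obtain d :: nat where d: "\<lceil>of_int l' * b j\<rceil> = \<lceil>of_int l * b j\<rceil> + int d"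
    using zle_iff_zadd by blast
  show ?thesis
    by (rule that[of d]) (simp add: side_def d powr_add powr_realpow)
qed

lemma side_mono: "l \<le> l' \<Longrightarrow> side l j \<le> side l' j"
proof -
  assume "l \<le> l'"
  then obtain d :: nat where d: "side l' j = side l j * 2 ^ d" by (rule side_mono_int)
  have "side l j * 1 \<le> side l j * 2 ^ d" by (intro mult_left_mono) auto
  then show ?thesis by (simp add: d)
qed

lemma vol_mono: "l \<le> l' \<Longrightarrow> vol l \<le> vol l'"
  unfolding vol_def by (intro prod_mono) (auto intro: side_mono)

text \<open>\<open>b j \<ge> 1\<close> makes the rounded exponent grow by at least one per level.
  Volumes are therefore strictly increasing, which later keeps the top cube apart from the cubes
  selected inside it.\<close>

lemma side_less_Suc: "side l j < side (l + 1) j"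
proof -
  have "of_int l * b j + 1 \<le> of_int (l + 1) * b j"
    using b_ge[of j] by (simp add: algebra_simps)
  then have "\<lceil>of_int l * b j\<rceil> + 1 \<le> \<lceil>of_int (l + 1) * b j\<rceil>"
    by (metis ceiling_add_one ceiling_mono)
  then show ?thesis unfolding side_def by (simp add: powr_less_mono)
qed

lemma vol_less: "l < l' \<Longrightarrow> vol l < vol l'"
proof -
  assume "l < l'"
  have "vol l < vol (l + 1)"
    unfolding vol_def by (intro prod_mono_strict) (auto intro: side_less_Suc less_imp_le)
  also have "\<dots> \<le> vol l'" using \<open>l < l'\<close> by (intro vol_mono) auto
  finally show ?thesis .
qed

lemma prod_powr_hom: "(\<Prod>j\<in>UNIV. 2 powr (c * b j)) = 2 powr (c * hom)"
  by (simp add: hom_def powr_sum[symmetric] sum_distrib_left)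

lemma vol_ge: "2 powr (of_int l * hom) \<le> vol l"
  unfolding vol_def prod_powr_hom[symmetric] by (intro prod_mono) (auto intro: side_ge)

lemma vol_le: "vol l \<le> 2 ^ CARD('n) * 2 powr (of_int l * hom)"
proof -
  have "vol l \<le> (\<Prod>j\<in>(UNIV::'n set). 2 * 2 powr (of_int l * b j))"
    unfolding vol_def by (intro prod_mono) (auto intro: side_le)
  also have "\<dots> = 2 ^ CARD('n) * 2 powr (of_int l * hom)"
    by (simp add: prod.distrib prod_powr_hom)
  finally show ?thesis .
qed

text \<open>Bound for the volume ratio of consecutive levels; the factor \<open>2 ^ CARD('n)\<close>
  absorbs the rounding of the side lengths.\<close>

definition growth :: real where "growth = 2 ^ CARD('n) * 2 powr hom"

lemma growth_pos [simp]: "0 < growth" by (simp add: growth_def)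

lemma vol_Suc_le: "vol (l + 1) \<le> growth * vol l"
proof -
  have "vol (l + 1) \<le> 2 ^ CARD('n) * 2 powr (of_int (l + 1) * hom)" by (rule vol_le)
  also have "\<dots> = growth * 2 powr (of_int l * hom)"
    by (simp add: growth_def algebra_simps powr_add)
  also have "\<dots> \<le> growth * vol l" by (intro mult_left_mono vol_ge) (simp add: less_imp_le)
  finally show ?thesis .
qed

lemma same_refl [simp]: "same v l x x" by (simp add: same_def)
lemma same_sym: "same v l x y \<longleftrightarrow> same v l y x" by (auto simp: same_def)
lemma same_trans: "same v l x y \<Longrightarrow> same v l y z \<Longrightarrow> same v l x z" by (simp add: same_def)

text \<open>The coarse index of a coordinate is the integer quotient of the fine index by
  \<open>2 ^ d\<close>, so it is determined by the fine one.\<close>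

lemma same_mono:
  assumes "same v l x y" "l \<le> l'"
  shows "same v l' x y"
  unfolding same_def
proof
  fix j
  obtain d :: nat where d: "side l' j = side l j * 2 ^ d"
    using side_mono_int[OF assms(2)] by blast
  have "\<lfloor>(u - v $ j) / side l' j\<rfloor> = \<lfloor>(u - v $ j) / side l j\<rfloor> div 2 ^ d" for u
    using floor_divide_real_eq_div[of "2 ^ d" "(u - v $ j) / side l j"] by (simp add: d)
  then show "\<lfloor>(x $ j - v $ j) / side l' j\<rfloor> = \<lfloor>(y $ j - v $ j) / side l' j\<rfloor>"
    using assms(1) by (simp add: same_def)
qed

lemma cell_self [simp]: "x \<in> cell v l x" by (simp add: cell_def)

lemma cell_iff: "y \<in> cell v l x \<longleftrightarrow> same v l x y" by (simp add: cell_def)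

lemma cell_eq_iff: "cell v l x = cell v l y \<longleftrightarrow> same v l x y"
proof
  assume "cell v l x = cell v l y"
  then show "same v l x y" using cell_self[of y v l] by (auto simp: cell_def)
next
  assume *: "same v l x y"
  show "cell v l x = cell v l y"
    using * by (auto simp: cell_def same_def)
qed

lemma cell_eq: "y \<in> cell v l x \<Longrightarrow> cell v l y = cell v l x"
  by (simp add: cell_eq_iff cell_iff same_sym)

lemma cell_mono: "l \<le> l' \<Longrightarrow> cell v l x \<subseteq> cell v l' x"
  unfolding cell_def using same_mono by blast

lemma cell_mem_iff:
  "y \<in> cell v l x \<longleftrightarrow> (\<forall>j. corner v l x $ j \<le> y $ j \<and> y $ j < corner v l x $ j + side l j)"
proof -
  have "\<lfloor>(x $ j - v $ j) / side l j\<rfloor> = \<lfloor>(y $ j - v $ j) / side l j\<rfloor> \<longleftrightarrow>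
     corner v l x $ j \<le> y $ j \<and> y $ j < corner v l x $ j + side l j" for j
  proof -
    define m where "m = \<lfloor>(x $ j - v $ j) / side l j\<rfloor>"
    have "m = \<lfloor>(y $ j - v $ j) / side l j\<rfloor> \<longleftrightarrow>
        of_int m \<le> (y $ j - v $ j) / side l j \<and> (y $ j - v $ j) / side l j < of_int m + 1"
      by (metis floor_eq_iff)
    also have "\<dots> \<longleftrightarrow> corner v l x $ j \<le> y $ j \<and> y $ j < corner v l x $ j + side l j"
      by (simp add: corner_def m_def[symmetric] pos_le_divide_eq pos_divide_less_eq algebra_simps)
    finally show ?thesis by (simp add: m_def)
  qed
  then show ?thesis by (simp add: cell_iff same_def)
qed

lemma same_dist: "same v l x y \<Longrightarrow> \<bar>x $ j - y $ j\<bar> < side l j"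
proof -
  assume "same v l x y"
  then have "corner v l x $ j \<le> y $ j" "y $ j < corner v l x $ j + side l j"
      "corner v l x $ j \<le> x $ j" "x $ j < corner v l x $ j + side l j"
    using cell_mem_iff[of x v l x] cell_mem_iff[of y v l x] by (simp_all add: cell_iff)
  then show ?thesis by linarith
qed

lemma box_subset_cell: "box (corner v l x) (corner v l x + (\<chi> j. side l j)) \<subseteq> cell v l x"
  by (auto simp: mem_box_cart cell_mem_iff less_imp_le)

lemma cell_subset_cube: "cell v l x \<subseteq> cube v l x"
  by (auto simp: cube_def mem_box_cart cell_mem_iff less_imp_le)

lemma interior_cube: "interior (cube v l x) = box (corner v l x) (corner v l x + (\<chi> j. side l j))"
  by (simp add: cube_def)

lemma delta_cube_cube: "delta_cube b (cube v l x)"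
proof -
  have "(\<chi> j. side l j) = (\<chi> j. 2 powi \<lceil>of_int l * b j\<rceil>)"
    by (simp add: side_def powr_real_of_int' vec_eq_iff)
  then show ?thesis unfolding delta_cube_def cube_def by metis
qed

lemma measure_cube: "measure lborel (cube v l x) = vol l"
proof -
  have "cube v l x \<noteq> {}" using cell_subset_cube cell_self by blast
  then show ?thesis unfolding cube_def vol_def by (subst content_cbox_cart) auto
qed

lemma emeasure_cube: "emeasure lborel (cube v l x) = ennreal (vol l)"
  using emeasure_eq_ennreal_measure[of lborel "cube v l x"] measure_cube[of v l x]
    emeasure_lborel_cbox_finite[of "corner v l x" "corner v l x + (\<chi> j. side l j)"]
  by (simp add: cube_def)

lemma emeasure_cube_interior: "emeasure lborel (interior (cube v l x)) = ennreal (vol l)"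
proof -
  have "\<forall>i\<in>Basis. corner v l x \<bullet> i \<le> (corner v l x + (\<chi> j. side l j)) \<bullet> i"
    by (auto simp: Basis_vec_def inner_axis inner_add_left)
  then have "emeasure lborel (interior (cube v l x)) = emeasure lborel (cube v l x)"
    unfolding interior_cube cube_def by (simp add: emeasure_lborel_box_eq emeasure_lborel_cbox_eq)
  then show ?thesis by (simp add: emeasure_cube)
qed

lemma pred_same [measurable]: 
  assumes [measurable]: "x \<in> borel_measurable M" "y \<in> borel_measurable M"
  shows "Measurable.pred M (\<lambda>w. same v l (x w) (y w))"
  unfolding same_def by measurable

lemma cell_borel [measurable]: "cell v l x \<in> sets borel"
proof -
  have "{y\<in>space borel. same v l x y} \<in> sets borel" by measurable
  then show ?thesis by (simp add: cell_def)
qed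

lemma emeasure_cell: "emeasure lborel (cell v l x) = ennreal (vol l)"
proof (rule antisym)
  show "emeasure lborel (cell v l x) \<le> ennreal (vol l)"
    unfolding emeasure_cube[symmetric, of l v x]
    by (rule emeasure_mono[OF cell_subset_cube]) (simp add: cube_def)
  show "ennreal (vol l) \<le> emeasure lborel (cell v l x)"
    unfolding emeasure_cube_interior[symmetric, of l v x] interior_cube
    by (rule emeasure_mono[OF box_subset_cell]) simp
qed

lemma bounded_cell: "bounded (cell v l x)"
  by (rule bounded_subset[OF _ cell_subset_cube]) (simp add: cube_def)

end

section \<open>Decay on functions of mean zero\<close>

text \<open>Local continuity with the supremum over [1, 2] replaced by a measurable choice \<tau>.
  The natural right-hand side is the power \<open>q / p\<close> of the energy; as this exponent is
  at least 1, splitting off \<open>Z powr (q / p - 1)\<close> leaves a bound that is linear in the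
  energy, hence additive over disjoint cubes. Here \<epsilon> and \<open>C\<close> belong to q-th
  powers of norms.\<close>

locale improving = averaging \<nu> \<Psi> sg b R
  for \<nu> :: "'x measure" and \<Psi> :: "'x \<Rightarrow> real^'n::finite" and sg b R +
  fixes p q \<epsilon> C :: real
  assumes p: "1 < p" and pq: "p \<le> q" and eps: "0 < \<epsilon>" and C: "0 \<le> C"
    and improve: "\<And>z f \<tau> Z. norm z \<le> 1 \<Longrightarrow> bdd_cpt_fun f \<Longrightarrow> \<tau> \<in> borel_measurable borel \<Longrightarrow>
      (\<And>y. 1 \<le> \<tau> y \<and> \<tau> y \<le> 2) \<Longrightarrow> 0 < Z \<Longrightarrow> (\<integral>\<^sup>+y. ennreal (norm (f y) powr p) \<partial>lborel) \<le> ennreal Z \<Longrightarrow>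
      (\<integral>\<^sup>+y. ennreal (norm (A (\<tau> y) f y - A (\<tau> y) f (y - z)) powr q) \<partial>lborel) \<le>
        ennreal (C * norm z powr \<epsilon> * Z powr (q / p - 1)) * (\<integral>\<^sup>+y. ennreal (norm (f y) powr p) \<partial>lborel)"
begin

lemma q: "1 < q" using p pq by simp

text \<open>A long translate is cut into \<open>K\<close> translates by a vector \<open>w\<close> of
  length at most 1. Each increment starts at a shifted point; undoing the shift in the integral
  shifts \<tau> too, which is harmless because every measurable choice is allowed.\<close>

lemma improve_steps:
  assumes K: "0 < K" "norm z \<le> real K" and f: "bdd_cpt_fun f"
    and \<tau> [measurable]: "\<tau> \<in> borel_measurable borel" and \<tau>_range: "\<And>y. 1 \<le> \<tau> y \<and> \<tau> y \<le> 2"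
    and Z: "0 < Z" "(\<integral>\<^sup>+y. ennreal (norm (f y) powr p) \<partial>lborel) \<le> ennreal Z"
  shows "(\<integral>\<^sup>+y. ennreal (norm (A (\<tau> y) f y - A (\<tau> y) f (y - z)) powr q) \<partial>lborel) \<le>
    ennreal (real K powr q * real K * C * norm z powr \<epsilon> * Z powr (q / p - 1)) * (\<integral>\<^sup>+y. ennreal (norm (f y) powr p) \<partial>lborel)"
proof -
  let ?N = "\<integral>\<^sup>+y. ennreal (norm (f y) powr p) \<partial>lborel"
  have [measurable]: "f \<in> borel_measurable borel" using f by (simp add: bdd_cpt_fun_def)
  define w where "w = (1 / real K) *\<^sub>R z"
  have zw: "z = real K *\<^sub>R w" using K by (simp add: w_def)
  have nw: "norm w \<le> 1" "norm w \<le> norm z" using K by (simp_all add: w_def divide_le_eq mult_le_cancel_left1)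
  define G where "G i y = norm (A (\<tau> y) f (y - real i *\<^sub>R w) - A (\<tau> y) f (y - real i *\<^sub>R w - w))" for i y
  have G_meas [measurable]: "G i \<in> borel_measurable borel" for i
    unfolding G_def by measurable
  have ptw: "norm (A (\<tau> y) f y - A (\<tau> y) f (y - z)) powr q \<le> real K powr q * (\<Sum>i<K. G i y powr q)" for y
  proof -
    have "A (\<tau> y) f y - A (\<tau> y) f (y - real m *\<^sub>R w) =
        (\<Sum>i<m. A (\<tau> y) f (y - real i *\<^sub>R w) - A (\<tau> y) f (y - real i *\<^sub>R w - w))" for m
    proof (induction m)
      case (Suc m)
      have eq: "y - real (Suc m) *\<^sub>R w = y - real m *\<^sub>R w - w" by (simp add: scaleR_left_distrib)
      show ?case unfolding eq using Suc by (simp add: diff_eq_eq)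
    qed simp
    then have "norm (A (\<tau> y) f y - A (\<tau> y) f (y - z)) \<le> (\<Sum>i<K. G i y)"
      unfolding zw G_def by (simp only: norm_sum)
    then have "norm (A (\<tau> y) f y - A (\<tau> y) f (y - z)) powr q \<le> (\<Sum>i<K. G i y) powr q"
      using q by (intro powr_mono2) auto
    also have "\<dots> \<le> real (card {..<K}) powr q * (\<Sum>i<K. G i y powr q)"
      using q by (intro powr_sum_le) (auto simp: G_def)
    finally show ?thesis by simp
  qed
  have piece: "(\<integral>\<^sup>+y. ennreal (G i y powr q) \<partial>lborel) \<le> ennreal (C * norm z powr \<epsilon> * Z powr (q / p - 1)) * ?N" for i
  proof -
    have "(\<integral>\<^sup>+y. ennreal (G i y powr q) \<partial>lborel) = (\<integral>\<^sup>+y. ennreal (G i (y + real i *\<^sub>R w) powr q) \<partial>lborel)"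
      by (subst nn_integral_translate[of "\<lambda>y. ennreal (G i y powr q)"]) auto
    also have "\<dots> \<le> ennreal (C * norm w powr \<epsilon> * Z powr (q / p - 1)) * ?N"
      unfolding G_def using improve[OF nw(1) f, of "\<lambda>y. \<tau> (y + real i *\<^sub>R w)" Z] \<tau>_range Z by simp
    also have "\<dots> \<le> ennreal (C * norm z powr \<epsilon> * Z powr (q / p - 1)) * ?N"
      using nw C eps by (intro mult_right_mono ennreal_leI mult_left_mono powr_mono2) auto
    finally show ?thesis .
  qed
  have "(\<integral>\<^sup>+y. ennreal (norm (A (\<tau> y) f y - A (\<tau> y) f (y - z)) powr q) \<partial>lborel) \<le>
      (\<integral>\<^sup>+y. ennreal (real K powr q) * (\<Sum>i<K. ennreal (G i y powr q)) \<partial>lborel)"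
    by (intro nn_integral_mono) (use ptw in \<open>simp add: ennreal_mult[symmetric] sum_ennreal ennreal_leI sum_nonneg\<close>)
  also have "\<dots> = ennreal (real K powr q) * (\<Sum>i<K. \<integral>\<^sup>+y. ennreal (G i y powr q) \<partial>lborel)"
    by (simp add: nn_integral_cmult nn_integral_sum del: sum_ennreal)
  also have "\<dots> \<le> ennreal (real K powr q) * (\<Sum>i<K. ennreal (C * norm z powr \<epsilon> * Z powr (q / p - 1)) * ?N)"
    by (intro mult_left_mono sum_mono piece) auto
  also have "\<dots> = ennreal (real K powr q * real K * C * norm z powr \<epsilon> * Z powr (q / p - 1)) * ?N"
    using C by (simp add: ennreal_mult ennreal_of_nat_eq_real_of_nat mult.assoc)
  finally show ?thesis .
qed

text \<open>Conjugating with the dilation by \<open>D\<close> carries parameters in [D, 2D] to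
  [1, 2]. Both sides pick up the same Jacobian \<open>D powr hom\<close>, and \<open>Z\<close>
  becomes energy per volume \<open>D powr hom\<close>, so the constant sees the scale only through
  the rescaled length of \<open>z\<close>.\<close>

lemma improve_scaled:
  assumes K: "0 < K" "norm (dilate b (1 / D) z) \<le> real K" and f: "bdd_cpt_fun f" and D: "0 < D"
    and \<tau> [measurable]: "\<tau> \<in> borel_measurable borel" and \<tau>_range: "\<And>y. D \<le> \<tau> y \<and> \<tau> y \<le> 2 * D"
    and Z: "0 < Z" "(\<integral>\<^sup>+y. ennreal (norm (f y) powr p) \<partial>lborel) \<le> ennreal (D powr hom * Z)"
  shows "(\<integral>\<^sup>+y. ennreal (norm (A (\<tau> y) f y - A (\<tau> y) f (y - z)) powr q) \<partial>lborel) \<le>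
    ennreal (real K powr q * real K * C * norm (dilate b (1 / D) z) powr \<epsilon> * Z powr (q / p - 1)) *
      (\<integral>\<^sup>+y. ennreal (norm (f y) powr p) \<partial>lborel)"
proof -
  let ?N = "\<integral>\<^sup>+y. ennreal (norm (f y) powr p) \<partial>lborel"
  let ?c = "ennreal (real K powr q * real K * C * norm (dilate b (1 / D) z) powr \<epsilon> * Z powr (q / p - 1))"
  have [measurable]: "f \<in> borel_measurable borel" using f by (simp add: bdd_cpt_fun_def)
  define f' where "f' x = f (dilate b D x)" for x
  define \<tau>' where "\<tau>' y = \<tau> (dilate b D y) / D" for y
  have [measurable]: "\<tau>' \<in> borel_measurable borel" unfolding \<tau>'_def by measurable
  have f': "bdd_cpt_fun f'"
    unfolding f'_def by (rule bdd_cpt_fun_dilate[OF f D])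
  have N: "?N = ennreal (D powr hom) * (\<integral>\<^sup>+y. ennreal (norm (f' y) powr p) \<partial>lborel)"
    unfolding f'_def hom_def by (rule nn_integral_dilate[OF _ D]) measurable
  have N': "(\<integral>\<^sup>+y. ennreal (norm (f' y) powr p) \<partial>lborel) \<le> ennreal Z"
  proof -
    have "ennreal (D powr hom) * (\<integral>\<^sup>+y. ennreal (norm (f' y) powr p) \<partial>lborel) \<le> ennreal (D powr hom) * ennreal Z"
      using Z D N by (simp add: ennreal_mult)
    then show ?thesis using D by (subst (asm) ennreal_mult_le_mult_iff) auto
  qed
  have "(\<integral>\<^sup>+y. ennreal (norm (A (\<tau> y) f y - A (\<tau> y) f (y - z)) powr q) \<partial>lborel) =
     ennreal (D powr hom) * (\<integral>\<^sup>+y. ennreal (norm (A (\<tau> (dilate b D y)) f (dilate b D y) - A (\<tau> (dilate b D y)) f (dilate b D y - z)) powr q) \<partial>lborel)"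
    unfolding hom_def by (rule nn_integral_dilate[OF _ D]) measurable
  also have "(\<integral>\<^sup>+y. ennreal (norm (A (\<tau> (dilate b D y)) f (dilate b D y) - A (\<tau> (dilate b D y)) f (dilate b D y - z)) powr q) \<partial>lborel) =
     (\<integral>\<^sup>+y. ennreal (norm (A (\<tau>' y) f' y - A (\<tau>' y) f' (y - dilate b (1 / D) z)) powr q) \<partial>lborel)"
  proof (intro nn_integral_cong)
    fix y
    have \<tau>: "\<tau> (dilate b D y) = D * \<tau>' y" using D by (simp add: \<tau>'_def)
    show "ennreal (norm (A (\<tau> (dilate b D y)) f (dilate b D y) - A (\<tau> (dilate b D y)) f (dilate b D y - z)) powr q) =
      ennreal (norm (A (\<tau>' y) f' y - A (\<tau>' y) f' (y - dilate b (1 / D) z)) powr q)"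
      unfolding \<tau> A_dilate[OF D] using D by (simp add: dilate_diff f'_def[abs_def])
  qed
  also have "\<dots> \<le> ?c * (\<integral>\<^sup>+y. ennreal (norm (f' y) powr p) \<partial>lborel)"
    using K f' N' Z \<tau>_range D by (intro improve_steps) (auto simp: \<tau>'_def field_simps)
  also have "ennreal (D powr hom) * (?c * (\<integral>\<^sup>+y. ennreal (norm (f' y) powr p) \<partial>lborel)) = ?c * ?N"
    unfolding N by (simp add: mult.left_commute)
  finally show ?thesis by (simp add: mult_left_mono)
qed

end

lemma lborel_integral_reflect:
  fixes g :: "'a::euclidean_space \<Rightarrow> 'b::{banach, second_countable_topology}"
  assumes [measurable]: "g \<in> borel_measurable borel"
  shows "(LINT z|lborel. g (x - z)) = (LINT w|lborel. g w)"
proof -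
  have "(lborel :: 'a measure) = distr lborel borel (\<lambda>z. x - z)"
    by (subst lborel_affine[of "-1" x]) (auto simp: density_1)
  then have "(LINT w|lborel. g w) = (LINT w|distr lborel borel (\<lambda>z. x - z). g w)"
    by (rule arg_cong)
  also have "\<dots> = (LINT z|lborel. g (x - z))" by (subst integral_distr) auto
  finally show ?thesis ..
qed

lemma lborel_integral_shift:
  fixes g :: "'a::euclidean_space \<Rightarrow> 'b::{banach, second_countable_topology}"
  assumes [measurable]: "g \<in> borel_measurable borel"
  shows "(LINT z|lborel. g (x + z)) = (LINT w|lborel. g w)"
proof -
  have "(LINT w|lborel. g w) = (LINT w|distr lborel borel ((+) x). g w)"
    by (simp add: lborel_distr_plus)
  also have "\<dots> = (LINT w|lborel. g (x + w))" by (rule integral_distr) auto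
  finally show ?thesis ..
qed

lemma bdd_cpt_fun_integrable:
  assumes "bdd_cpt_fun f"
  shows "integrable lborel f"
proof -
  obtain c where c: "\<forall>x. norm (f x) \<le> c" "c > 0"
    using bdd_borel_bound assms bdd_cpt_fun_iff by blast
  have [measurable]: "f \<in> borel_measurable borel" using assms by (simp add: bdd_cpt_fun_def)
  let ?S = "closure {x. f x \<noteq> 0}"
  have "compact ?S" using assms by (simp add: bdd_cpt_fun_def)
  then show ?thesis
    using c closure_subset[of "{x. f x \<noteq> 0}"] emeasure_compact_finite[of ?S]
    by (intro integrableI_bounded_set[where A = ?S and B = c]) (auto intro!: AE_I2)
qed

lemma bdd_cpt_fun_mult_indicator:
  assumes "bdd_cpt_fun f" "S \<in> sets borel"
  shows "bdd_cpt_fun (\<lambda>x. f x * indicator S x)"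
  using assms unfolding bdd_cpt_fun_iff
  by (auto intro!: bdd_borel_mult_indicator elim!: bounded_subset)

context improving
begin

definition spread :: "int \<Rightarrow> real" where "spread a = (\<Sum>j\<in>UNIV. 2 * 2 powr (of_int a * b j))"

text \<open>The first two factors come from averaging over the box of translates, which is
  \<open>2 ^ CARD('n)\<close> times as large as a cell; the middle ones from
  \<open>improve_steps\<close> with translates of length at most \<open>spread a\<close>; the last
  one from comparing the volume of a cube of level \<open>k\<close> with the dilation by
  \<open>2 powr (k - a)\<close>.\<close>

definition mz_const :: "int \<Rightarrow> real" where
  "mz_const a = (2 ^ CARD('n)) powr q * 2 powr q *
     (real (nat \<lceil>spread a\<rceil>) powr q * real (nat \<lceil>spread a\<rceil>) * C * spread a powr \<epsilon> *
       (2 ^ CARD('n) * 2 powr (of_int a * hom)) powr (q / p - 1))"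

lemma spread_pos: "0 < spread a"
  unfolding spread_def by (intro sum_pos) auto

lemma mz_const_nonneg: "0 \<le> mz_const a"
  using C by (simp add: mz_const_def)

text \<open>For fixed \<open>l\<close> put \<open>h\<^sub>z(x) = h(x)\<close> if \<open>x\<close> and \<open>x - z\<close> lie in the same cell of level \<open>l\<close>, and 0 otherwise. If
  \<open>h\<close> has mean zero on these cells, then integrating \<open>h\<^sub>z(x) - h\<^sub>z(x + z)\<close> over \<open>z\<close> gives \<open>vol l \<cdot> h(x)\<close>
  at every point \<open>x\<close>.\<close>

lemma mean_zero:
  fixes s k a :: int
  assumes s: "0 \<le> s" and h: "bdd_cpt_fun h"
    and mz: "\<And>x. (LINT y|lborel. h y * indicator (cell v (k - s) x) y) = 0"
    and Z: "0 < Z" "(\<integral>\<^sup>+y. ennreal (norm (h y) powr p) \<partial>lborel) \<le> ennreal (vol k * Z)"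
    and \<tau> [measurable]: "\<tau> \<in> borel_measurable borel"
    and \<tau>_range: "\<And>y. 2 powr of_int (k - a) \<le> \<tau> y \<and> \<tau> y \<le> 2 * 2 powr of_int (k - a)"
  shows "(\<integral>\<^sup>+y. ennreal (norm (A (\<tau> y) h y) powr q) \<partial>lborel) \<le>
    ennreal (mz_const a * 2 powr (- \<epsilon> * of_int s) * Z powr (q / p - 1)) * (\<integral>\<^sup>+y. ennreal (norm (h y) powr p) \<partial>lborel)"
proof -
  let ?N = "\<integral>\<^sup>+y. ennreal (norm (h y) powr p) \<partial>lborel"
  let ?n = "2 ^ CARD('n) :: real"
  define l where "l = k - s"
  define D :: real where "D = 2 powr of_int (k - a)"
  have D: "0 < D" by (simp add: D_def)
  have [measurable]: "h \<in> borel_measurable borel" using h by (simp add: bdd_cpt_fun_def)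
  obtain c where c: "\<And>x. norm (h x) \<le> c" "c > 0"
    using bdd_borel_bound h bdd_cpt_fun_iff by blast
  \<comment> \<open>Differences of two points in a common cell of level \<open>l\<close> lie in this
    box, so \<open>z\<close> can be confined to it.\<close>
  define W where "W = cbox (- (\<chi> j. side l j)) ((\<chi> j. side l j) :: real^'n)"
  have [measurable]: "W \<in> sets borel" by (simp add: W_def)
  define \<mu> where "\<mu> = ?n * vol l"
  have \<mu>: "0 < \<mu>" by (simp add: \<mu>_def)
  have "measure lborel W = \<mu>"
  proof -
    have "0 \<in> W" by (simp add: W_def mem_box_cart)
    then show ?thesis
      unfolding W_def by (subst content_cbox_cart) (auto simp: \<mu>_def vol_def prod.distrib)
  qed
  then have eW: "emeasure lborel W = ennreal \<mu>"
    using emeasure_eq_ennreal_measure[of lborel W] emeasure_lborel_cbox_finite[of "- (\<chi> j. side l j)" "\<chi> j. side l j"]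
    by (simp add: W_def)
  define hz where "hz z x = (if same v l x (x - z) then h x else 0)" for z x
  have hz_meas [measurable]: "(\<lambda>w. hz (z w) (x w)) \<in> borel_measurable M"
    if [measurable]: "z \<in> borel_measurable M" "x \<in> borel_measurable M" for z x and M :: "'y measure"
    unfolding hz_def by measurable
  have hz_meas2 [measurable]: "(\<lambda>w. hz (z w) (x w)) \<in> borel_measurable M"
    if [measurable]: "z \<in> borel_measurable M" "x \<in> borel_measurable M" for z x and M :: "('y \<times> real^'n) measure"
    unfolding hz_def by measurable
  have hz_bound: "norm (hz z x) \<le> c" for z x using c by (simp add: hz_def less_imp_le)
  have same_W: "z \<in> W" if "same v l x (x - z)" for x z
    using same_dist[OF that] by (auto simp: W_def mem_box_cart abs_less_iff less_imp_le) (smt (verit))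
  have hz_W: "hz z x = 0" if "z \<notin> W" for x z using same_W that by (auto simp: hz_def)
  have hz_bdd: "bdd_cpt_fun (hz z)" for z
  proof -
    have [measurable]: "hz z \<in> borel_measurable borel"
      unfolding hz_def by measurable
    have "{x. hz z x \<noteq> 0} \<subseteq> {x. h x \<noteq> 0}" by (auto simp: hz_def)
    then show ?thesis unfolding bdd_cpt_fun_iff
      using h hz_bound bounded_subset by (auto intro!: bdd_borelI simp: bdd_cpt_fun_iff)
  qed
  \<comment> \<open>In the first term \<open>x - z\<close> sweeps the cell of \<open>x\<close> and
    yields \<open>vol l * h x\<close>; in the second \<open>x + z\<close> sweeps it and yields the
    integral of \<open>h\<close> over the cell, which vanishes.\<close>
  have ident: "(LINT z|lborel. hz z x - hz z (x + z)) = of_real (vol l) * h x" for x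
  proof -
    let ?I = "\<lambda>w. indicator (cell v l x) w :: complex"
    have e1: "hz z x = ?I (x - z) * h x" for z
      by (simp add: hz_def indicator_def cell_iff)
    have e2: "hz z (x + z) = ?I (x + z) * h (x + z)" for z
      by (auto simp add: hz_def indicator_def cell_iff same_sym)
    have int1: "integrable lborel (\<lambda>z. hz z x)"
      using hz_bound[of _ x] hz_W by (intro integrableI_bounded_set[where A = W and B = c])
        (auto intro!: AE_I2 simp: eW)
    have int2: "integrable lborel (\<lambda>z. hz z (x + z))"
      using hz_bound hz_W by (intro integrableI_bounded_set[where A = W and B = c])
        (auto intro!: AE_I2 simp: eW)
    have "(LINT z|lborel. hz z x) = (LINT z|lborel. ?I (x - z)) * h x"
      unfolding e1 by simp
    also have "(LINT z|lborel. ?I (x - z)) = (LINT w|lborel. ?I w)"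
      by (rule lborel_integral_reflect) measurable
    also have "\<dots> = of_real (vol l)"
    proof -
      have "(LINT w|lborel. ?I w) = (LINT w|lborel. complex_of_real (indicator (cell v l x) w))"
        by (intro Bochner_Integration.integral_cong refl) (auto simp: indicator_def)
      then show ?thesis using emeasure_cell[of v l x] by (simp add: measure_def)
    qed
    finally have i1: "(LINT z|lborel. hz z x) = of_real (vol l) * h x" .
    have "(LINT z|lborel. hz z (x + z)) = (LINT w|lborel. ?I w * h w)"
      unfolding e2 by (rule lborel_integral_shift) measurable
    also have "\<dots> = 0" using mz[of x] by (simp add: l_def mult.commute)
    finally show ?thesis using i1 int1 int2 by simp
  qed
  interpret P: pair_sigma_finite \<nu> lborel ..
  \<comment> \<open>Fubini moves the averaged identity through the operator; the integrand is
    bounded and vanishes for \<open>z\<close> outside \<open>W\<close>, which gives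
    integrability.\<close>
  have swap: "of_real (vol l) * A t h y = (LINT z|lborel. A t (hz z) y - A t (hz z) (y + z))" for t y
  proof -
    define u where "u x = y - dilate b t (\<Psi> x)" for x
    have [measurable]: "u \<in> borel_measurable \<nu>" unfolding u_def by measurable
    let ?F = "\<lambda>x z. (hz z (u x) - hz z (u x + z)) * complex_of_real (sg x)"
    have int: "integrable (\<nu> \<Otimes>\<^sub>M lborel) (\<lambda>(x, z). ?F x z)"
    proof (rule integrableI_bounded_set[where A = "space \<nu> \<times> W" and B = "2 * c"])
      show "(\<lambda>(x, z). ?F x z) \<in> borel_measurable (\<nu> \<Otimes>\<^sub>M lborel)"
        unfolding hz_def by measurable
      show "emeasure (\<nu> \<Otimes>\<^sub>M lborel) (space \<nu> \<times> W) < \<infinity>"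
        by (subst lborel.emeasure_pair_measure_Times) (auto simp: eW ennreal_mult_less_top emeasure_eq_measure)
      have "norm (?F x z) \<le> 2 * c" for x z
      proof -
        have "norm (hz z (u x) - hz z (u x + z)) \<le> 2 * c"
          using norm_triangle_ineq4[of "hz z (u x)" "hz z (u x + z)"] hz_bound[of z "u x"] hz_bound[of z "u x + z"] by linarith
        then have "norm (hz z (u x) - hz z (u x + z)) * \<bar>sg x\<bar> \<le> 2 * c * 1"
          by (intro mult_mono sg_bound) (use c in auto)
        then show ?thesis by (simp add: norm_mult)
      qed
      then show "AE w\<in>space \<nu> \<times> W in \<nu> \<Otimes>\<^sub>M lborel. norm (case w of (x, z) \<Rightarrow> ?F x z) \<le> 2 * c"
        by (intro AE_I2) auto
      show "AE w in \<nu> \<Otimes>\<^sub>M lborel. w \<notin> space \<nu> \<times> W \<longrightarrow> (case w of (x, z) \<Rightarrow> ?F x z) = 0"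
        by (intro AE_I2) (auto simp: space_pair_measure, metis hz_W)
    qed simp
    have "of_real (vol l) * A t h y = (LINT x|\<nu>. of_real (vol l) * h (u x) * complex_of_real (sg x))"
      unfolding A_def u_def[symmetric] by (simp add: mult.assoc)
    also have "\<dots> = (LINT x|\<nu>. (LINT z|lborel. ?F x z))"
      unfolding ident[symmetric] by simp
    also have "\<dots> = (LINT z|lborel. (LINT x|\<nu>. ?F x z))"
      using P.Fubini_integral[OF int] by simp
    also have "\<dots> = (LINT z|lborel. A t (hz z) y - A t (hz z) (y + z))"
    proof (intro Bochner_Integration.integral_cong refl)
      fix z
      have "bdd_borel (hz z)" using hz_bdd bdd_cpt_fun_iff by blast
      note int = A_integrable[OF this, of y t] A_integrable[OF this, of "y + z" t]
      have ue: "y + z - dilate b t (\<Psi> x) = u x + z" for x by (simp add: u_def)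
      show "(LINT x|\<nu>. ?F x z) = A t (hz z) y - A t (hz z) (y + z)"
        using int unfolding A_def ue u_def[symmetric] left_diff_distrib by simp
    qed
    finally show ?thesis .
  qed
  define U where "U z y = norm (A (\<tau> y) (hz z) y - A (\<tau> y) (hz z) (y + z))" for z y
  have U_meas [measurable]: "(\<lambda>(z, y). U z y) \<in> borel_measurable (borel \<Otimes>\<^sub>M borel)"
  proof -
    have "(\<lambda>w. A (\<tau> (snd w)) (hz (fst w)) (snd w)) \<in> borel_measurable (borel \<Otimes>\<^sub>M borel)"
      unfolding hz_def by (rule measurable_A) measurable
    moreover have "(\<lambda>w. A (\<tau> (snd w)) (hz (fst w)) (snd w + fst w)) \<in> borel_measurable (borel \<Otimes>\<^sub>M borel)"
      unfolding hz_def by (rule measurable_A) measurable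
    ultimately show ?thesis unfolding U_def case_prod_beta by measurable
  qed
  \<comment> \<open>Jensen over \<open>W\<close>: the identity bounds \<open>vol l\<close> times the
    average by the integral of \<open>U\<close>, and the measure \<open>\<mu>\<close> of
    \<open>W\<close> exceeds \<open>vol l\<close> by the factor \<open>?n\<close>.\<close>
  have ptw: "ennreal (norm (A (\<tau> y) h y) powr q) \<le>
      ennreal (?n powr q * (2 powr q / \<mu>)) * (\<integral>\<^sup>+z. ennreal (U z y powr q) * indicator W z \<partial>lborel)" for y
  proof -
    have "U z y = 0" if "z \<notin> W" for z
      using hz_W[OF that] by (simp add: U_def[abs_def] fun_eq_iff[of "hz z" "\<lambda>_. 0", THEN iffD2])
    moreover have U0: "0 \<le> U z y" for z by (simp add: U_def)
    moreover have Uy: "(\<lambda>z. U z y) \<in> borel_measurable lborel"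
      using measurable_compose[of "\<lambda>z. (z, y)" borel "borel \<Otimes>\<^sub>M borel" _ borel, OF _ U_meas] by simp
    ultimately have UW: "ennreal (U z y) = ennreal (U z y) * indicator W z" for z
      by (auto simp: indicator_def)
    have "ennreal (norm (A (\<tau> y) h y) / ?n * \<mu>) = ennreal (norm (of_real (vol l) * A (\<tau> y) h y))"
      by (simp add: \<mu>_def norm_mult mult.commute)
    also have "\<dots> \<le> (\<integral>\<^sup>+z. ennreal (U z y) \<partial>lborel)"
    proof (cases "integrable lborel (\<lambda>z. A (\<tau> y) (hz z) y - A (\<tau> y) (hz z) (y + z))")
      case True
      then show ?thesis unfolding swap U_def by (rule integral_norm_bound_ennreal)
    next
      case False
      then show ?thesis unfolding swap by (simp add: not_integrable_integral_eq)
    qed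
    also have "\<dots> = (\<integral>\<^sup>+z\<in>W. ennreal (U z y) \<partial>lborel)" by (intro nn_integral_cong UW)
    finally have "ennreal ((norm (A (\<tau> y) h y) / ?n) powr q) \<le>
        ennreal (2 powr q / \<mu>) * (\<integral>\<^sup>+z\<in>W. ennreal (U z y powr q) \<partial>lborel)"
      using \<mu> eW q Uy U0 by (intro nn_integral_power_mean) auto
    then have "ennreal (?n powr q) * ennreal ((norm (A (\<tau> y) h y) / ?n) powr q) \<le>
        ennreal (?n powr q) * (ennreal (2 powr q / \<mu>) * (\<integral>\<^sup>+z\<in>W. ennreal (U z y powr q) \<partial>lborel))"
      by (rule mult_left_mono) simp
    moreover have "ennreal (?n powr q) * ennreal ((norm (A (\<tau> y) h y) / ?n) powr q) = ennreal (norm (A (\<tau> y) h y) powr q)"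
      by (simp add: ennreal_mult[symmetric] powr_mult[symmetric])
    moreover have "ennreal (?n powr q * (2 powr q / \<mu>)) = ennreal (?n powr q) * ennreal (2 powr q / \<mu>)"
      using \<mu> by (intro ennreal_mult) auto
    ultimately show ?thesis by (simp only: mult.assoc)
  qed
  define c0 where "c0 = real (nat \<lceil>spread a\<rceil>) powr q * real (nat \<lceil>spread a\<rceil>) * C * (spread a * 2 powr (- of_int s)) powr \<epsilon> *
       (?n * 2 powr (of_int a * hom) * Z) powr (q / p - 1)"
  have c0: "0 \<le> c0" using C by (simp add: c0_def)
  have inner: "(\<integral>\<^sup>+y. ennreal (U z y powr q) \<partial>lborel) \<le> ennreal c0 * ?N" if z: "z \<in> W" for z
  proof -
    \<comment> \<open>Source of the decay: the coordinates of \<open>z\<close> are of size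
      \<open>2 powr (l * b j)\<close> with \<open>l = k - s\<close>, so after rescaling by
      \<open>D\<close> its length is at most \<open>spread a * 2 powr (- s)\<close>; this uses
      \<open>b j \<ge> 1\<close> and \<open>s \<ge> 0\<close>.\<close>
    have "norm (dilate b (1 / D) (- z)) \<le> (\<Sum>j\<in>UNIV. \<bar>dilate b (1 / D) (- z) $ j\<bar>)"
      by (rule norm_le_l1_cart)
    also have "\<dots> \<le> (\<Sum>j\<in>UNIV. 2 * 2 powr (of_int a * b j) * 2 powr (- of_int s))"
    proof (rule sum_mono)
      fix j
      have "\<bar>z $ j\<bar> \<le> side l j" using z by (auto simp: W_def mem_box_cart abs_le_iff) (metis minus_le_iff)
      also have "\<dots> \<le> 2 * 2 powr (of_int l * b j)" by (rule side_le)
      finally have "\<bar>dilate b (1 / D) (- z) $ j\<bar> \<le> (1 / D) powr b j * (2 * 2 powr (of_int l * b j))"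
        by (simp add: abs_mult mult_left_mono)
      also have "(1 / D) powr b j = 2 powr (- (of_int (k - a) * b j))"
        by (simp add: D_def powr_divide powr_powr powr_minus_divide)
      also have "2 powr (- (of_int (k - a) * b j)) * (2 * 2 powr (of_int l * b j)) = 2 * 2 powr (of_int a * b j - of_int s * b j)"
        by (simp add: powr_add[symmetric] l_def algebra_simps)
      also have "\<dots> \<le> 2 * 2 powr (of_int a * b j - of_int s)"
        using s b_ge[of j] by (intro mult_left_mono powr_mono) (auto simp: mult_le_cancel_left1)
      finally show "\<bar>dilate b (1 / D) (- z) $ j\<bar> \<le> 2 * 2 powr (of_int a * b j) * 2 powr (- of_int s)"
        by (simp add: powr_diff powr_minus_divide)
    qed
    also have "\<dots> = spread a * 2 powr (- of_int s)" by (simp add: spread_def sum_distrib_right)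
    finally have nz: "norm (dilate b (1 / D) (- z)) \<le> spread a * 2 powr (- of_int s)" .
    have "spread a * 2 powr (- of_int s) \<le> spread a * 1"
      using s spread_pos[of a] by (intro mult_left_mono) (auto simp: powr_minus_divide ge_one_powr_ge_zero)
    then have nz2: "norm (dilate b (1 / D) (- z)) \<le> real (nat \<lceil>spread a\<rceil>)"
      using nz real_nat_ceiling_ge[of "spread a"] by linarith
    have hzN: "(\<integral>\<^sup>+y. ennreal (norm (hz z y) powr p) \<partial>lborel) \<le> ?N"
      by (intro nn_integral_mono) (auto simp: hz_def)
    \<comment> \<open>Converts the normalisation by cubes of level \<open>k\<close> into the one by
      \<open>D powr hom\<close> that \<open>improve_scaled\<close> expects.\<close>
    have vk: "vol k * Z \<le> D powr hom * (?n * 2 powr (of_int a * hom) * Z)"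
    proof -
      have "vol k \<le> ?n * 2 powr (of_int k * hom)" by (rule vol_le)
      also have "2 powr (of_int k * hom) = D powr hom * 2 powr (of_int a * hom)"
        by (simp add: D_def powr_powr powr_add[symmetric] algebra_simps)
      finally show ?thesis using Z by (simp add: mult_ac)
    qed
    have "(\<integral>\<^sup>+y. ennreal (U z y powr q) \<partial>lborel) \<le>
       ennreal (real (nat \<lceil>spread a\<rceil>) powr q * real (nat \<lceil>spread a\<rceil>) * C * norm (dilate b (1 / D) (- z)) powr \<epsilon> *
         (?n * 2 powr (of_int a * hom) * Z) powr (q / p - 1)) * (\<integral>\<^sup>+y. ennreal (norm (hz z y) powr p) \<partial>lborel)"
      unfolding U_def
      using improve_scaled[of "nat \<lceil>spread a\<rceil>" D "- z" "hz z" \<tau> "?n * 2 powr (of_int a * hom) * Z"]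
        spread_pos[of a] nz2 hz_bdd D \<tau>_range Z order_trans[OF hzN order_trans[OF Z(2) ennreal_leI[OF vk]]]
      by (simp add: D_def)
    also have "\<dots> \<le> ennreal c0 * ?N"
      unfolding c0_def using nz eps C
      by (intro mult_mono ennreal_leI hzN mult_right_mono mult_left_mono powr_mono2) auto
    finally show ?thesis .
  qed
  have "(\<integral>\<^sup>+y. ennreal (norm (A (\<tau> y) h y) powr q) \<partial>lborel) \<le>
      (\<integral>\<^sup>+y. ennreal (?n powr q * (2 powr q / \<mu>)) * (\<integral>\<^sup>+z. ennreal (U z y powr q) * indicator W z \<partial>lborel) \<partial>lborel)"
    by (intro nn_integral_mono ptw)
  also have "\<dots> = ennreal (?n powr q * (2 powr q / \<mu>)) * (\<integral>\<^sup>+y. (\<integral>\<^sup>+z. ennreal (U z y powr q) * indicator W z \<partial>lborel) \<partial>lborel)"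
    by (rule nn_integral_cmult) measurable
  also have "(\<integral>\<^sup>+y. (\<integral>\<^sup>+z. ennreal (U z y powr q) * indicator W z \<partial>lborel) \<partial>lborel) =
      (\<integral>\<^sup>+z. (\<integral>\<^sup>+y. ennreal (U z y powr q) * indicator W z \<partial>lborel) \<partial>lborel)"
    by (rule lborel_pair.Fubini') measurable
  also have "\<dots> = (\<integral>\<^sup>+z. (\<integral>\<^sup>+y. ennreal (U z y powr q) \<partial>lborel) * indicator W z \<partial>lborel)"
    by (intro nn_integral_cong nn_integral_multc) measurable
  also have "\<dots> \<le> (\<integral>\<^sup>+z. ennreal c0 * ?N * indicator W z \<partial>lborel)"
    by (intro nn_integral_mono) (auto simp: indicator_def inner)
  also have "\<dots> = ennreal c0 * ?N * ennreal \<mu>"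
    by (subst nn_integral_cmult_indicator) (auto simp: eW)
  also have "ennreal (?n powr q * (2 powr q / \<mu>)) * (ennreal c0 * ?N * ennreal \<mu>) =
      ennreal (?n powr q * (2 powr q / \<mu>) * c0 * \<mu>) * ?N"
  proof -
    have "ennreal x * (ennreal c0 * ?N * ennreal \<mu>) = ennreal (x * c0 * \<mu>) * ?N" if "0 \<le> x" for x
      using c0 \<mu> that by (simp add: ennreal_mult mult_ac)
    then show ?thesis using \<mu> by simp
  qed
  also have "?n powr q * (2 powr q / \<mu>) * c0 * \<mu> = mz_const a * 2 powr (- \<epsilon> * of_int s) * Z powr (q / p - 1)"
    using \<mu> spread_pos[of a] Z
    by (simp add: c0_def mz_const_def powr_mult powr_powr mult_ac)
  finally show ?thesis by (simp add: mult_left_mono)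
qed

end

section \<open>Stopping cubes\<close>

lemma nn_integral_finite_partition:
  assumes "finite Q" "disjoint Q" "\<And>P. P \<in> Q \<Longrightarrow> P \<in> sets M" and [measurable]: "h \<in> borel_measurable M"
  shows "(\<integral>\<^sup>+x\<in>\<Union>Q. h x \<partial>M) = (\<Sum>P\<in>Q. \<integral>\<^sup>+x\<in>P. h x \<partial>M)"
proof -
  have "disjoint_family_on (\<lambda>P. P) Q"
    using assms(2) by (auto simp: disjoint_family_on_def disjoint_def)
  then have "h x * indicator (\<Union>Q) x = (\<Sum>P\<in>Q. h x * indicator P x)" for x
  proof -
    have "(indicator (\<Union>Q) x :: ennreal) = (\<Sum>P\<in>Q. indicator P x)"
      using indicator_UN_disjoint[OF assms(1) \<open>disjoint_family_on (\<lambda>P. P) Q\<close>, of x] by simp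
    then show ?thesis by (simp add: sum_distrib_left)
  qed
  then show ?thesis using assms(3) by (simp add: nn_integral_sum)
qed

context averaging
begin

lemma disjoint_cells: "disjoint {cell v k y | y. y \<in> S \<and> P y}"
proof (rule disjointI)
  fix a b' assume "a \<in> {cell v k y | y. y \<in> S \<and> P y}" "b' \<in> {cell v k y | y. y \<in> S \<and> P y}" "a \<noteq> b'"
  then obtain y y' where y: "a = cell v k y" "b' = cell v k y'" by auto
  show "a \<inter> b' = {}"
  proof (rule ccontr)
    assume "a \<inter> b' \<noteq> {}"
    then obtain z where "z \<in> a" "z \<in> b'" by auto
    then have "a = b'" using cell_eq[of z v k y] cell_eq[of z v k y'] y by simp
    then show False using \<open>a \<noteq> b'\<close> by simp
  qed
qed

lemma finite_cells: "finite {cell v k y | y. y \<in> cell v m x0 \<and> P y}"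
proof -
  define I where "I j = {\<lfloor>(corner v m x0 $ j - v $ j) / side k j\<rfloor> .. \<lfloor>(corner v m x0 $ j + side m j - v $ j) / side k j\<rfloor>}" for j
  define \<phi> where "\<phi> F = {y. \<forall>j. \<lfloor>(y $ j - v $ j) / side k j\<rfloor> = F j}" for F
  have "{cell v k y | y. y \<in> cell v m x0 \<and> P y} \<subseteq> \<phi> ` (PiE UNIV I)"
  proof
    fix Q assume "Q \<in> {cell v k y | y. y \<in> cell v m x0 \<and> P y}"
    then obtain y where y: "Q = cell v k y" "y \<in> cell v m x0" by auto
    let ?F = "\<lambda>j. \<lfloor>(y $ j - v $ j) / side k j\<rfloor>"
    have "?F \<in> PiE UNIV I"
      using y(2) unfolding cell_mem_iff I_def
      by (auto intro!: floor_mono divide_right_mono simp: less_imp_le)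
    moreover have "Q = \<phi> ?F" unfolding y \<phi>_def cell_def same_def by auto
    ultimately show "Q \<in> \<phi> ` (PiE UNIV I)" by blast
  qed
  moreover have "finite (PiE UNIV I)" by (intro finite_PiE) (auto simp: I_def)
  ultimately show ?thesis by (meson finite_imageI finite_subset)
qed

lemma Union_cells:
  assumes "k \<le> m" "\<And>x y. same v k x y \<Longrightarrow> P x \<Longrightarrow> P y"
  shows "\<Union>{cell v k y | y. y \<in> cell v m x0 \<and> P y} = {y \<in> cell v m x0. P y}"
proof (intro equalityI subsetI)
  fix z assume "z \<in> \<Union>{cell v k y | y. y \<in> cell v m x0 \<and> P y}"
  then obtain y where y: "same v m x0 y" "P y" "same v k y z" by (auto simp: cell_iff)
  have "same v m x0 z" using same_trans[OF y(1) same_mono[OF y(3) assms(1)]] .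
  then show "z \<in> {y \<in> cell v m x0. P y}"
    using assms(2)[OF y(3,2)] by (simp add: cell_iff)
next
  fix z assume "z \<in> {y \<in> cell v m x0. P y}"
  then show "z \<in> \<Union>{cell v k y | y. y \<in> cell v m x0 \<and> P y}"
    unfolding Union_eq using cell_self by blast
qed

end

section \<open>Energies, stopping levels and pivotal levels\<close>

context improving
begin

definition r :: real where "r = q / (q - 1)"

lemma r: "1 < r" "1 / q + 1 / r = 1"
  using q by (auto simp: r_def field_simps)

definition en :: "(real^'n \<Rightarrow> complex) \<Rightarrow> real^'n \<Rightarrow> int \<Rightarrow> real^'n \<Rightarrow> ennreal" where
  "en f v l y = (\<integral>\<^sup>+x. (if same v l y x then ennreal (norm (f x) powr p) else 0) \<partial>lborel)"

text \<open>The mean of |f|^p over the cell of level \<open>l\<close> around \<open>y\<close>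
  exceeds \<open>2 * \<alpha> powr p\<close>. The factor 2 is what limits the maximal stopping cells
  to half of the top cell. Levels below \<open>m0\<close>, finer than every scale of the operator,
  never stop.\<close>

definition stp :: "(real^'n \<Rightarrow> complex) \<Rightarrow> real^'n \<Rightarrow> real \<Rightarrow> int \<Rightarrow> int \<Rightarrow> int \<Rightarrow> real^'n \<Rightarrow> bool" where
  "stp f v \<alpha> m0 m l y \<longleftrightarrow> m0 \<le> l \<and> l < m \<and> ennreal (2 * \<alpha> powr p * vol l) < en f v l y"

text \<open>The pivotal level of \<open>y\<close> is its highest stopping level, with default
  \<open>m0 - 1\<close> when no level stops. Thanks to the default each point has exactly one
  pivotal level, and points outside all stopping cells are treated like the others, with cells of
  level \<open>m0 - 1\<close>.\<close>

definition piv :: "(real^'n \<Rightarrow> complex) \<Rightarrow> real^'n \<Rightarrow> real \<Rightarrow> int \<Rightarrow> int \<Rightarrow> int \<Rightarrow> real^'n \<Rightarrow> bool" where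
  "piv f v \<alpha> m0 m l y \<longleftrightarrow> (stp f v \<alpha> m0 m l y \<or> l = m0 - 1) \<and> l < m \<and> (\<forall>k. l < k \<longrightarrow> \<not> stp f v \<alpha> m0 m k y)"

definition av :: "(real^'n \<Rightarrow> complex) \<Rightarrow> real^'n \<Rightarrow> int \<Rightarrow> real^'n \<Rightarrow> complex" where
  "av f v l y = (LINT x|lborel. (if same v l y x then f x else 0)) / of_real (vol l)"

lemma same_left: "same v l x y \<Longrightarrow> same v l x = same v l y"
  by (auto simp: same_def fun_eq_iff)

lemma en_cong: "same v l x y \<Longrightarrow> en f v l x = en f v l y"
  unfolding en_def by (simp add: same_left)

lemma av_cong: "same v l x y \<Longrightarrow> av f v l x = av f v l y"
  unfolding av_def by (simp add: same_left)

lemma en_eq: "en f v l y = (\<integral>\<^sup>+x\<in>cell v l y. ennreal (norm (f x) powr p) \<partial>lborel)"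
  unfolding en_def by (intro nn_integral_cong) (simp add: indicator_def cell_iff)

lemma en_mono: "l \<le> l' \<Longrightarrow> en f v l y \<le> en f v l' y"
  unfolding en_def using same_mono by (intro nn_integral_mono) auto

lemma stp_cong: "same v l x y \<Longrightarrow> stp f v \<alpha> m0 m l x = stp f v \<alpha> m0 m l y"
  unfolding stp_def by (simp add: en_cong)

text \<open>Whether \<open>l\<close> is pivotal depends only on cells of level \<open>l\<close> and
  above, and these are shared by all points of a cell of level \<open>l\<close>.\<close>

lemma piv_cong: "same v l x y \<Longrightarrow> piv f v \<alpha> m0 m l x = piv f v \<alpha> m0 m l y"
  unfolding piv_def using stp_cong same_mono by (smt (verit, ccfv_SIG))

lemma piv_range: "piv f v \<alpha> m0 m l y \<Longrightarrow> l \<in> {m0 - 1..<m}"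
  by (auto simp: piv_def stp_def)

lemma piv_unique: "piv f v \<alpha> m0 m l y \<Longrightarrow> piv f v \<alpha> m0 m l' y \<Longrightarrow> l = l'"
proof (induction l l' rule: linorder_wlog)
  case (le a b)
  show ?case
  proof (rule ccontr)
    assume "a \<noteq> b"
    then have "a < b" using le by simp
    then have "b = m0 - 1" using le unfolding piv_def by blast
    then show False using piv_range[OF le(2)] \<open>a < b\<close> by simp
  qed
next
  case (sym a b) then show ?case by simp
qed

lemma piv_ex:
  assumes "m0 \<le> m"
  obtains l where "piv f v \<alpha> m0 m l y"
proof -
  define L where "L = insert (m0 - 1) {l. stp f v \<alpha> m0 m l y}"
  have "finite L"
    unfolding L_def by (rule finite.insertI, rule finite_subset[of _ "{m0..m}"]) (auto simp: stp_def)
  moreover have "L \<noteq> {}" by (simp add: L_def)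
  ultimately have M: "Max L \<in> L" "\<And>k. k \<in> L \<Longrightarrow> k \<le> Max L" by simp_all
  have "piv f v \<alpha> m0 m (Max L) y"
    unfolding piv_def
  proof (intro conjI allI impI)
    show "stp f v \<alpha> m0 m (Max L) y \<or> Max L = m0 - 1" 
    proof -
      have "\<forall>l\<in>L. stp f v \<alpha> m0 m l y \<or> l = m0 - 1" by (auto simp: L_def)
      then show ?thesis using M(1) by blast
    qed
    then show "Max L < m" using assms by (auto simp: stp_def)
    fix k assume "Max L < k"
    then show "\<not> stp f v \<alpha> m0 m k y" using M(2)[of k] by (auto simp: L_def)
  qed
  then show ?thesis by (rule that)
qed

text \<open>Bound for averages over pivotal cells in units of \<alpha>: \<open>2 * growth\<close> is
  the energy bound of \<open>en_le_piv\<close>, and the outer 2 is the one of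
  \<open>nn_integral_mean_le\<close>.\<close>

definition c1 :: real where "c1 = 2 * (2 * growth) powr (1 / p)"

context
  fixes f :: "real^'n \<Rightarrow> complex"
  assumes f_meas [measurable]: "f \<in> borel_measurable borel"
begin

lemma en_meas [measurable]: "en f v l \<in> borel_measurable borel"
  unfolding en_def by measurable

lemma av_meas [measurable]: "av f v l \<in> borel_measurable borel"
  unfolding av_def by measurable

lemma stp_meas [measurable]: "Measurable.pred borel (stp f v \<alpha> m0 m l)"
  unfolding stp_def by measurable

lemma piv_meas [measurable]: "Measurable.pred borel (piv f v \<alpha> m0 m l)"
  unfolding piv_def by measurable

lemma en_le_nonstop:
  assumes "piv f v \<alpha> m0 m l y" "l < k" "k \<le> m" "en f v m y \<le> ennreal (\<alpha> powr p * vol m)"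
  shows "en f v k y \<le> ennreal (2 * \<alpha> powr p * vol k)"
proof (cases "k = m")
  case True
  have "\<alpha> powr p * vol m \<le> 2 * \<alpha> powr p * vol m" by (intro mult_right_mono) auto
  then show ?thesis using True assms(4) by (auto intro: order_trans ennreal_leI)
next
  case False
  then have "\<not> stp f v \<alpha> m0 m k y" "m0 \<le> k" "k < m"
    using assms piv_range[OF assms(1)] unfolding piv_def by auto
  then show ?thesis by (auto simp: stp_def)
qed

text \<open>A pivotal cell may have a large mean, but its parent does not stop or is the top cell;
  enlarging to the parent costs the factor \<open>growth\<close>.\<close>

lemma en_le_piv:
  assumes "piv f v \<alpha> m0 m l y" "en f v m y \<le> ennreal (\<alpha> powr p * vol m)"
  shows "en f v l y \<le> ennreal (2 * growth * \<alpha> powr p * vol l)"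
proof -
  have lm: "l < m" using piv_range[OF assms(1)] by simp
  have "en f v l y \<le> en f v (l + 1) y" by (rule en_mono) simp
  also have "\<dots> \<le> ennreal (2 * \<alpha> powr p * vol (l + 1))"
    using assms lm by (intro en_le_nonstop) auto
  also have "\<dots> \<le> ennreal (2 * \<alpha> powr p * (growth * vol l))"
    by (intro ennreal_leI mult_left_mono vol_Suc_le) auto
  finally show ?thesis by (simp add: mult_ac)
qed

lemma av_le:
  assumes "piv f v \<alpha> m0 m l y" "en f v m y \<le> ennreal (\<alpha> powr p * vol m)" "0 < \<alpha>"
  shows "norm (av f v l y) \<le> c1 * \<alpha>"
proof -
  define c where "c = (2 * growth) powr (1 / p) * \<alpha>"
  have c: "0 < c" "c powr p = 2 * growth * \<alpha> powr p"
    using assms(3) p growth_pos by (auto simp: c_def powr_mult powr_powr less_imp_le dest: less_imp_neq[OF growth_pos, symmetric, THEN notE] intro!: mult_pos_pos)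
  have "(\<integral>\<^sup>+x\<in>cell v l y. ennreal (norm (f x)) \<partial>lborel) \<le> ennreal (2 * c * vol l)"
    using p c en_le_piv[OF assms(1,2)] emeasure_cell[of v l y] by (intro nn_integral_mean_le[where p = p]) (auto simp: en_eq)
  moreover have "ennreal (norm (LINT x|lborel. (if same v l y x then f x else 0))) \<le>
      (\<integral>\<^sup>+x. ennreal (norm (if same v l y x then f x else 0)) \<partial>lborel)"
  proof (cases "integrable lborel (\<lambda>x. if same v l y x then f x else 0)")
    case True then show ?thesis by (rule integral_norm_bound_ennreal)
  next
    case False then show ?thesis by (simp add: not_integrable_integral_eq)
  qed
  moreover have "(\<integral>\<^sup>+x. ennreal (norm (if same v l y x then f x else 0)) \<partial>lborel) =
      (\<integral>\<^sup>+x\<in>cell v l y. ennreal (norm (f x)) \<partial>lborel)"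
    by (intro nn_integral_cong) (simp add: indicator_def cell_iff)
  ultimately have "ennreal (norm (LINT x|lborel. (if same v l y x then f x else 0))) \<le> ennreal (2 * c * vol l)" by simp
  then have "norm (LINT x|lborel. (if same v l y x then f x else 0)) \<le> 2 * c * vol l"
    using c by (subst (asm) ennreal_le_iff) auto
  then show ?thesis
    by (simp add: av_def norm_divide c_def c1_def divide_le_eq mult_ac)
qed

end

text \<open>Oscillation of \<open>f\<close> on the cells whose level \<open>l\<close> is pivotal. At
  each point only the piece of its own pivotal level can be nonzero, so on the top cell the pieces
  add up to \<open>f\<close> minus its averages over pivotal cells.\<close>

definition osc :: "(real^'n \<Rightarrow> complex) \<Rightarrow> real^'n \<Rightarrow> real \<Rightarrow> int \<Rightarrow> int \<Rightarrow> real^'n \<Rightarrow> int \<Rightarrow> real^'n \<Rightarrow> complex" where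
  "osc f v \<alpha> m0 m x0 l x = (if same v m x0 x \<and> piv f v \<alpha> m0 m l x then f x - av f v l x else 0)"

text \<open>Energy of a piece per volume, in units of \<open>\<alpha> powr p\<close>, in a cell
  above the pivotal level: 2 from \<open>f\<close> on a cell that does not stop,
  \<open>c1 powr p\<close> from the subtracted average, and \<open>2 powr p\<close> from the power
  of a sum.\<close>

definition c2 :: real where "c2 = 2 powr p * (2 + c1 powr p)"

definition geo :: "real \<Rightarrow> real" where "geo d = 1 / (1 - 2 powr (- d))"

text \<open>Decay left for \<open>g\<close> in \<open>young_weighted\<close>: the weight
  \<open>2 powr (\<epsilon> / (2 * q) * e)\<close> used there, raised to the power
  \<open>- r\<close>.\<close>

definition d2 :: real where "d2 = \<epsilon> * r / (2 * q)"

text \<open>The three summands belong to the bounded part of \<open>f\<close>, to the powers of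
  \<open>g\<close> produced by Young's inequality, and to the oscillating pieces.\<close>

definition step_const :: "int \<Rightarrow> real" where
  "step_const a = c1 * mass * 2 + geo d2 + mz_const a * c2 powr (q / p - 1) * geo (\<epsilon> / 2) * c2"

lemma c1_pos: "0 < c1"
proof -
  have "2 * growth \<noteq> 0" using growth_pos by linarith
  then have "0 < (2 * growth) powr (1 / p)" by (subst powr_gt_zero)
  then show ?thesis unfolding c1_def by linarith
qed

lemma c2_pos: "0 < c2"
  unfolding c2_def by (intro mult_pos_pos add_pos_nonneg) auto

lemma geo_nonneg: "0 < d \<Longrightarrow> 0 \<le> geo d"
  unfolding geo_def using powr_less_one[of 2 "- d"] by (simp add: less_imp_le)

lemma d2_pos: "0 < d2" using eps r q by (simp add: d2_def)

lemma step_const_nonneg: "0 \<le> step_const a"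
  unfolding step_const_def using c1_pos c2_pos geo_nonneg[OF d2_pos] geo_nonneg[of "\<epsilon> / 2"] eps mz_const_nonneg[of a]
  by (intro add_nonneg_nonneg mult_nonneg_nonneg) auto

text \<open>The cut-off to the cell of level \<open>\<kappa> y\<close> lets different cells be
  treated separately; in a grid suited to \<open>y\<close> it changes nothing.\<close>

definition loc :: "(real^'n \<Rightarrow> real) \<Rightarrow> (real^'n \<Rightarrow> complex) \<Rightarrow> real^'n \<Rightarrow> (real^'n \<Rightarrow> int) \<Rightarrow> real^'n \<Rightarrow> complex" where
  "loc \<tau> f v \<kappa> y = A (\<tau> y) (\<lambda>x. if same v (\<kappa> y) y x then f x else 0) y"

text \<open>\<open>u\<close> is measured in units of \<alpha> and \<open>G\<close> in units of
  \<beta>. The weight \<open>lam\<close> shares out the decay: of the factor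
  \<open>2 powr (- \<epsilon> * e)\<close> brought by the operator estimate,
  \<open>2 powr (- \<epsilon> / 2 * e)\<close> survives, while the power of \<open>G\<close> gains
  \<open>2 powr (- d2 * e)\<close>. Both sum over the level gap \<open>e\<close>.\<close>

lemma young_weighted:
  fixes u G \<alpha> \<beta> e :: real
  assumes "0 \<le> u" "0 \<le> G" "0 < \<alpha>" "0 < \<beta>"
  shows "u * G \<le> \<alpha> * \<beta> * \<alpha> powr (- q) * 2 powr (\<epsilon> / 2 * e) * u powr q +
    \<alpha> * \<beta> * \<beta> powr (- r) * 2 powr (- d2 * e) * G powr r"
proof -
  define lam :: real where "lam = 2 powr (\<epsilon> / (2 * q) * e)"
  have lam: "0 < lam" by (simp add: lam_def)
  have "(lam * u / \<alpha>) * (G / (lam * \<beta>)) \<le> (lam * u / \<alpha>) powr q + (G / (lam * \<beta>)) powr r"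
    using assms lam q r by (intro young_simple) auto
  also have "(lam * u / \<alpha>) powr q = \<alpha> powr (- q) * 2 powr (\<epsilon> / 2 * e) * u powr q"
    using assms q by (simp add: lam_def powr_mult powr_divide powr_powr powr_minus_divide mult_ac)
  also have "(G / (lam * \<beta>)) powr r = \<beta> powr (- r) * 2 powr (- d2 * e) * G powr r"
    using assms q by (simp add: lam_def d2_def powr_mult powr_divide powr_powr powr_minus_divide mult_ac)
  finally have "\<alpha> * \<beta> * ((lam * u / \<alpha>) * (G / (lam * \<beta>))) \<le>
      \<alpha> * \<beta> * (\<alpha> powr (- q) * 2 powr (\<epsilon> / 2 * e) * u powr q + \<beta> powr (- r) * 2 powr (- d2 * e) * G powr r)"
    using assms by (intro mult_left_mono) auto
  also have "\<alpha> * \<beta> * ((lam * u / \<alpha>) * (G / (lam * \<beta>))) = u * G"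
    using assms lam by (simp add: field_simps)
  finally show ?thesis by (simp add: algebra_simps)
qed

end

text \<open>One stopping step below the cell of \<open>x0\<close> at level \<open>m\<close>. Here
  \<alpha> is any positive upper bound for the average of \<open>f\<close>, so that a vanishing
  average can be approached from above.\<close>

locale stopping = improving \<nu> \<Psi> sg b R p q \<epsilon> C
  for \<nu> :: "'x measure" and \<Psi> :: "'x \<Rightarrow> real^'n::finite" and sg b R p q \<epsilon> C +
  fixes f :: "real^'n \<Rightarrow> complex" and v :: "real^'n" and \<alpha> :: real and m0 m :: int and x0 :: "real^'n"
  assumes f: "bdd_cpt_fun f" and \<alpha>: "0 < \<alpha>" and m0: "m0 \<le> m"
    and en0: "en f v m x0 \<le> ennreal (\<alpha> powr p * vol m)"
begin

abbreviation "pv \<equiv> piv f v \<alpha> m0 m"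
abbreviation "B \<equiv> osc f v \<alpha> m0 m x0"

lemma f_borel [measurable]: "f \<in> borel_measurable borel"
  using f by (simp add: bdd_cpt_fun_def)

lemma en_top: "same v m x0 y \<Longrightarrow> en f v m y \<le> ennreal (\<alpha> powr p * vol m)"
  using en0 en_cong[of v m x0 y f] by simp

lemma osc_meas [measurable]: "B l \<in> borel_measurable borel"
  unfolding osc_def by measurable

lemma norm_av_le: "same v m x0 y \<Longrightarrow> pv l y \<Longrightarrow> norm (av f v l y) \<le> c1 * \<alpha>"
  by (rule av_le[OF f_borel]) (auto intro: en_top \<alpha>)

lemma osc_powr_le:
  "norm (B l x) powr p \<le> (if same v m x0 x \<and> pv l x then 2 powr p * (norm (f x) powr p + (c1 * \<alpha>) powr p) else 0)"
proof (cases "same v m x0 x \<and> pv l x")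
  case True
  have "norm (B l x) \<le> norm (f x) + c1 * \<alpha>"
    using True norm_triangle_ineq4[of "f x" "av f v l x"] norm_av_le[of x l] by (simp add: osc_def)
  then have "norm (B l x) powr p \<le> (norm (f x) + c1 * \<alpha>) powr p"
    using p by (intro powr_mono2) auto
  also have "\<dots> \<le> 2 powr p * (norm (f x) powr p + (c1 * \<alpha>) powr p)"
    using c1_pos \<alpha> p by (intro powr_add_le) auto
  finally show ?thesis using True by simp
qed (auto simp: osc_def)

lemma osc_bdd: "bdd_cpt_fun (B l)"
proof -
  obtain c where c: "\<And>x. norm (f x) \<le> c" "c > 0"
    using bdd_borel_bound f bdd_cpt_fun_iff by blast
  have "norm (B l x) \<le> c + c1 * \<alpha>" for x
  proof (cases "same v m x0 x \<and> pv l x")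
    case True
    then show ?thesis
      using norm_triangle_ineq4[of "f x" "av f v l x"] norm_av_le[of x l] c(1)[of x] by (simp add: osc_def)
  next
    case False
    then show ?thesis using c c1_pos \<alpha> by (auto simp: osc_def)
  qed
  moreover have "{x. B l x \<noteq> 0} \<subseteq> cell v m x0" by (auto simp: osc_def cell_iff)
  ultimately show ?thesis
    unfolding bdd_cpt_fun_iff using bounded_subset[OF bounded_cell] by (intro conjI bdd_borelI[where c = "c + c1 * \<alpha>"]) auto
qed

text \<open>Every point lies in the support of at most one piece, so up to \<open>2 powr p\<close>
  the total is the energy of \<open>f\<close> on the top cell plus that of a function bounded by
  \<open>c1 * \<alpha>\<close>.\<close>

lemma sum_osc_energy:
  "(\<Sum>l\<in>{m0 - 1..<m}. \<integral>\<^sup>+x. ennreal (norm (B l x) powr p) \<partial>lborel) \<le> ennreal (c2 * \<alpha> powr p * vol m)"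
proof -
  have ptw: "(\<Sum>l\<in>{m0 - 1..<m}. ennreal (norm (B l x) powr p)) \<le>
      ennreal (2 powr p) * (if same v m x0 x then ennreal (norm (f x) powr p) else 0) +
      ennreal (2 powr p * (c1 * \<alpha>) powr p) * indicator (cell v m x0) x" for x
  proof (cases "same v m x0 x")
    case True
    obtain l where l: "pv l x" using piv_ex[OF m0] .
    have "(\<Sum>l'\<in>{m0 - 1..<m}. ennreal (norm (B l' x) powr p)) = (\<Sum>l'\<in>{l}. ennreal (norm (B l' x) powr p))"
    proof (rule sum.mono_neutral_right)
      show "\<forall>i\<in>{m0 - 1..<m} - {l}. ennreal (norm (B i x) powr p) = 0"
        using piv_unique[OF l] by (auto simp: osc_def)
      show "{l} \<subseteq> {m0 - 1..<m}" using piv_range[OF l] by simp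
    qed simp
    also have "\<dots> = ennreal (norm (B l x) powr p)" by simp
    also have "\<dots> \<le> ennreal (2 powr p * (norm (f x) powr p + (c1 * \<alpha>) powr p))"
      using osc_powr_le[of l x] True l by (intro ennreal_leI) simp
    finally show ?thesis
      using True by (simp add: cell_iff ennreal_mult distrib_left)
  qed (simp add: osc_def)
  have "(\<Sum>l\<in>{m0 - 1..<m}. \<integral>\<^sup>+x. ennreal (norm (B l x) powr p) \<partial>lborel) =
      (\<integral>\<^sup>+x. (\<Sum>l\<in>{m0 - 1..<m}. ennreal (norm (B l x) powr p)) \<partial>lborel)"
    by (rule nn_integral_sum[symmetric]) measurable
  also have "\<dots> \<le> (\<integral>\<^sup>+x. ennreal (2 powr p) * (if same v m x0 x then ennreal (norm (f x) powr p) else 0) +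
      ennreal (2 powr p * (c1 * \<alpha>) powr p) * indicator (cell v m x0) x \<partial>lborel)"
    by (intro nn_integral_mono ptw)
  also have "\<dots> = ennreal (2 powr p) * en f v m x0 + ennreal (2 powr p * (c1 * \<alpha>) powr p) * emeasure lborel (cell v m x0)"
    unfolding en_def by (subst nn_integral_add) (auto simp: nn_integral_cmult nn_integral_cmult_indicator)
  also have "\<dots> \<le> ennreal (2 powr p) * ennreal (\<alpha> powr p * vol m) + ennreal (2 powr p * (c1 * \<alpha>) powr p) * ennreal (vol m)"
    unfolding emeasure_cell by (intro add_mono mult_left_mono en0) auto
  also have "\<dots> = ennreal (2 powr p * (1 + c1 powr p) * \<alpha> powr p * vol m)"
    using c1_pos \<alpha> by (simp add: ennreal_mult[symmetric] ennreal_plus[symmetric] powr_mult algebra_simps del: ennreal_plus)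
  also have "\<dots> \<le> ennreal (c2 * \<alpha> powr p * vol m)"
    unfolding c2_def by (intro ennreal_leI mult_right_mono mult_left_mono) auto
  finally show ?thesis .
qed

text \<open>A pivotal level below \<open>k\<close> at \<open>y\<close> means that the cell of level
  \<open>k\<close> does not stop or is the top cell. This yields the normalisation
  \<open>Z = c2 * \<alpha> powr p\<close> with which \<open>mean_zero\<close> is applied.\<close>

lemma osc_energy_cell:
  assumes S: "same v m x0 y" and l: "pv l' y" "l' < k" "k \<le> m"
  shows "(\<integral>\<^sup>+x. ennreal (norm (if same v k y x then B l x else 0) powr p) \<partial>lborel) \<le> ennreal (vol k * (c2 * \<alpha> powr p))"
proof -
  have "(\<integral>\<^sup>+x. ennreal (norm (if same v k y x then B l x else 0) powr p) \<partial>lborel) \<le>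
     (\<integral>\<^sup>+x. ennreal (2 powr p) * (if same v k y x then ennreal (norm (f x) powr p) else 0) +
      ennreal (2 powr p * (c1 * \<alpha>) powr p) * indicator (cell v k y) x \<partial>lborel)"
  proof (intro nn_integral_mono)
    fix x
    show "ennreal (norm (if same v k y x then B l x else 0) powr p) \<le>
      ennreal (2 powr p) * (if same v k y x then ennreal (norm (f x) powr p) else 0) +
      ennreal (2 powr p * (c1 * \<alpha>) powr p) * indicator (cell v k y) x"
    proof (cases "same v k y x")
      case True
      have "norm (B l x) powr p \<le> 2 powr p * (norm (f x) powr p + (c1 * \<alpha>) powr p)"
        using osc_powr_le[of l x] by (auto split: if_splits intro: order_trans)
      then have "ennreal (norm (B l x) powr p) \<le> ennreal (2 powr p * (norm (f x) powr p + (c1 * \<alpha>) powr p))"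
        by (rule ennreal_leI)
      then show ?thesis
        using True by (simp add: cell_iff ennreal_mult distrib_left)
    qed simp
  qed
  also have "\<dots> = ennreal (2 powr p) * en f v k y + ennreal (2 powr p * (c1 * \<alpha>) powr p) * emeasure lborel (cell v k y)"
    unfolding en_def by (subst nn_integral_add) (auto simp: nn_integral_cmult nn_integral_cmult_indicator)
  also have "\<dots> \<le> ennreal (2 powr p) * ennreal (2 * \<alpha> powr p * vol k) + ennreal (2 powr p * (c1 * \<alpha>) powr p) * ennreal (vol k)"
    unfolding emeasure_cell using en_le_nonstop[OF f_borel l en_top[OF S]] by (intro add_mono mult_left_mono) auto
  also have "\<dots> = ennreal (vol k * (c2 * \<alpha> powr p))"
    using c1_pos \<alpha> by (simp add: c2_def ennreal_mult[symmetric] ennreal_plus[symmetric] powr_mult algebra_simps del: ennreal_plus)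
  finally show ?thesis .
qed

text \<open>A cell of level \<open>l\<close> lies entirely inside or entirely outside the set where
  the truncated piece lives, because membership is decided by cells of levels \<open>l\<close>,
  \<open>k\<close> and \<open>m\<close>, none finer than \<open>l\<close>. Inside, the average has
  been subtracted.\<close>

lemma osc_mean_zero:
  assumes l: "l < k" "k \<le> m"
  shows "(LINT x|lborel. (if same v k y x then B l x else 0) * indicator (cell v l z) x) = 0"
proof (cases "same v k y z \<and> same v m x0 z \<and> pv l z")
  case True
  have eq: "(if same v k y x then B l x else 0) * indicator (cell v l z) x =
      (if same v l z x then f x else 0) - av f v l z * indicator (cell v l z) x" for x
  proof (cases "same v l z x")
    case True': True
    have "same v k y x" using same_trans[of v k y z x] same_mono[OF True'] True l by auto
    moreover have "same v m x0 x" using same_trans[of v m x0 z x] same_mono[OF True'] True l by auto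
    moreover have "pv l x" using piv_cong[OF True'] True by auto
    ultimately show ?thesis using True' by (simp add: osc_def cell_iff av_cong[OF True'])
  qed (simp add: cell_iff)
  have bc: "bdd_cpt_fun (\<lambda>x. f x * indicator (cell v l z) x)"
    by (intro bdd_cpt_fun_mult_indicator f) simp
  have e: "(\<lambda>x. if same v l z x then f x else 0) = (\<lambda>x. f x * indicator (cell v l z) x)"
    by (auto simp: cell_iff indicator_def)
  have i1: "integrable lborel (\<lambda>x. if same v l z x then f x else 0)"
    unfolding e by (rule bdd_cpt_fun_integrable[OF bc])
  have i2: "integrable lborel (indicator (cell v l z) :: _ \<Rightarrow> real)"
    by (simp add: emeasure_cell)
  have e2: "av f v l z * indicator (cell v l z) x = av f v l z * complex_of_real (indicator (cell v l z) x)" for x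
    by (simp add: indicator_def)
  have "(LINT x|lborel. (if same v l z x then f x else 0) - av f v l z * indicator (cell v l z) x) =
     (LINT x|lborel. (if same v l z x then f x else 0)) - av f v l z * of_real (measure lborel (cell v l z))"
    unfolding e2 using i1 i2 by (subst Bochner_Integration.integral_diff) auto
  also have "\<dots> = 0"
    using emeasure_cell[of v l z] vol_pos[of l] by (simp add: av_def measure_def less_imp_neq[OF vol_pos, symmetric])
  finally show ?thesis by (simp only: eq)
next
  case False
  have "(if same v k y x then B l x else 0) * indicator (cell v l z) x = 0" for x
  proof (cases "same v l z x")
    case True
    then have "same v l x z" by (simp add: same_sym)
    have "\<not> (same v k y x \<and> same v m x0 x \<and> pv l x)"
      using False same_trans[of v k y x z] same_trans[of v m x0 x z] same_mono[OF \<open>same v l x z\<close>] piv_cong[OF True] l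
      by auto
    then show ?thesis by (auto simp: osc_def)
  qed (simp add: cell_iff)
  then show ?thesis by (simp only: Bochner_Integration.integral_zero)
qed

text \<open>\<open>mean_zero\<close> is applied on each cell of level \<open>k\<close> separately.
  Its bound is linear in the energy, so the cells sum to at most the energy of the whole piece,
  while the power \<open>q / p - 1\<close> falls on the common normalisation.\<close>

lemma osc_operator:
  assumes l: "l < k" "k \<le> m" and \<tau> [measurable]: "\<tau> \<in> borel_measurable borel"
    and \<tau>_range: "\<And>y. 2 powr of_int (k - a) \<le> \<tau> y \<and> \<tau> y \<le> 2 * 2 powr of_int (k - a)"
  shows "(\<integral>\<^sup>+y\<in>{y \<in> cell v m x0. \<exists>l'<k. pv l' y}. ennreal (norm (A (\<tau> y) (\<lambda>x. if same v k y x then B l x else 0) y) powr q) \<partial>lborel) \<le>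
    ennreal (mz_const a * 2 powr (- \<epsilon> * of_int (k - l)) * (c2 * \<alpha> powr p) powr (q / p - 1)) *
      (\<integral>\<^sup>+x. ennreal (norm (B l x) powr p) \<partial>lborel)"
proof -
  let ?P = "\<lambda>y. \<exists>l'<k. pv l' y"
  let ?h = "\<lambda>y. ennreal (norm (A (\<tau> y) (\<lambda>x. if same v k y x then B l x else 0) y) powr q)"
  let ?c = "ennreal (mz_const a * 2 powr (- \<epsilon> * of_int (k - l)) * (c2 * \<alpha> powr p) powr (q / p - 1))"
  let ?Q = "{cell v k y | y. y \<in> cell v m x0 \<and> ?P y}"
  \<comment> \<open>Having a pivotal level below \<open>k\<close> is a property of the whole cell of
    level \<open>k\<close>: a pivotal level at least \<open>k\<close> would be shared by all its
    points.\<close>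
  have cong: "?P x \<Longrightarrow> ?P y" if "same v k x y" for x y
  proof -
    assume "?P x"
    then obtain l' where l': "l' < k" "pv l' x" by auto
    show "?P y"
    proof -
      obtain l'' where l'': "pv l'' y" using piv_ex[OF m0] .
      have "l'' < k"
      proof (rule ccontr)
        assume "\<not> l'' < k"
        then have "same v l'' x y" using same_mono[OF that] by simp
        then have "pv l'' x" using l'' piv_cong by blast
        then show False using piv_unique l' \<open>\<not> l'' < k\<close> by blast
      qed
      then show ?thesis using l'' by blast
    qed
  qed
  have U: "\<Union>?Q = {y \<in> cell v m x0. ?P y}"
    using l cong by (intro Union_cells) auto
  have [measurable]: "(\<lambda>y. A (\<tau> y) (\<lambda>x. if same v k y x then B l x else 0) y) \<in> borel_measurable borel"
    by (rule measurable_A) measurable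
  have "(\<integral>\<^sup>+y\<in>{y \<in> cell v m x0. ?P y}. ?h y \<partial>lborel) = (\<Sum>Q\<in>?Q. \<integral>\<^sup>+y\<in>Q. ?h y \<partial>lborel)"
    unfolding U[symmetric]
    by (rule nn_integral_finite_partition[OF finite_cells disjoint_cells]) auto
  also have "\<dots> \<le> (\<Sum>Q\<in>?Q. ?c * (\<integral>\<^sup>+x\<in>Q. ennreal (norm (B l x) powr p) \<partial>lborel))"
  proof (rule sum_mono)
    fix Q assume "Q \<in> ?Q"
    then obtain y l' where y: "Q = cell v k y" "same v m x0 y" "pv l' y" "l' < k" by (auto simp: cell_iff)
    define hQ where "hQ x = (if same v k y x then B l x else 0)" for x
    have hQ_eq: "hQ = (\<lambda>x. B l x * indicator (cell v k y) x)"
      by (auto simp: hQ_def cell_iff indicator_def)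
    have hQ: "bdd_cpt_fun hQ"
      unfolding hQ_eq by (intro bdd_cpt_fun_mult_indicator osc_bdd) simp
    have "(\<integral>\<^sup>+z\<in>Q. ?h z \<partial>lborel) \<le> (\<integral>\<^sup>+z. ennreal (norm (A (\<tau> z) hQ z) powr q) \<partial>lborel)"
      by (intro nn_integral_mono) (auto simp: y indicator_def cell_iff hQ_def[abs_def] dest: same_left)
    also have "\<dots> \<le> ?c * (\<integral>\<^sup>+x. ennreal (norm (hQ x) powr p) \<partial>lborel)"
    proof (rule mean_zero[OF _ hQ _ _ _ \<tau> \<tau>_range])
      show "0 \<le> k - l" using l by simp
      show "0 < c2 * \<alpha> powr p" using c2_pos \<alpha> by simp
      show "(\<integral>\<^sup>+x. ennreal (norm (hQ x) powr p) \<partial>lborel) \<le> ennreal (vol k * (c2 * \<alpha> powr p))"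
        unfolding hQ_def using y l by (intro osc_energy_cell)
      show "(LINT x|lborel. hQ x * indicator (cell v (k - (k - l)) z) x) = 0" for z
        using osc_mean_zero[OF l, of y z] by (simp add: hQ_def)
    qed
    also have "(\<integral>\<^sup>+x. ennreal (norm (hQ x) powr p) \<partial>lborel) = (\<integral>\<^sup>+x\<in>Q. ennreal (norm (B l x) powr p) \<partial>lborel)"
      by (intro nn_integral_cong) (auto simp: y hQ_def cell_iff indicator_def)
    finally show "(\<integral>\<^sup>+z\<in>Q. ?h z \<partial>lborel) \<le> ?c * (\<integral>\<^sup>+x\<in>Q. ennreal (norm (B l x) powr p) \<partial>lborel)" .
  qed
  also have "\<dots> = ?c * (\<integral>\<^sup>+x\<in>\<Union>?Q. ennreal (norm (B l x) powr p) \<partial>lborel)"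
    unfolding sum_distrib_left[symmetric]
    by (subst nn_integral_finite_partition[OF finite_cells disjoint_cells]) auto
  also have "\<dots> \<le> ?c * (\<integral>\<^sup>+x. ennreal (norm (B l x) powr p) \<partial>lborel)"
    by (intro mult_left_mono nn_integral_mono) (auto simp: indicator_def)
  finally show ?thesis .
qed

text \<open>If the pivotal level of \<open>y\<close> is below \<open>k\<close>, so is that of every
  point in its cell of level \<open>k\<close>. There \<open>f\<close> is its average over pivotal
  cells, bounded by \<open>c1 * \<alpha>\<close>, plus the pieces of levels below
  \<open>k\<close>.\<close>

lemma loc_split:
  assumes S: "same v m x0 y" and l: "pv l y" "l < k" "k \<le> m"
  shows "norm (A t (\<lambda>x. if same v k y x then f x else 0) y) \<le>
    c1 * \<alpha> * mass + (\<Sum>l'\<in>{m0 - 1..<k}. norm (A t (\<lambda>x. if same v k y x then B l' x else 0) y))"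
proof -
  define good where "good x = (if same v k y x then \<Sum>l'\<in>{m0 - 1..<k}. if pv l' x then av f v l' x else 0 else 0)" for x
  have piv_below: "\<exists>l'\<in>{m0 - 1..<k}. pv l' x \<and> same v m x0 x" if x: "same v k y x" for x
  proof -
    obtain l' where l': "pv l' x" using piv_ex[OF m0] .
    have "l' < k"
    proof (rule ccontr)
      assume "\<not> l' < k"
      then have "same v l' y x" using same_mono[OF x] by simp
      then have "pv l' y" using l' piv_cong by blast
      then show False using piv_unique l \<open>\<not> l' < k\<close> by blast
    qed
    then show ?thesis using l' piv_range[OF l'] same_trans[OF S same_mono[OF x]] l by auto
  qed
  have good_at: "good x = av f v l' x" if "same v k y x" "pv l' x" "l' \<in> {m0 - 1..<k}" for x l'
  proof -
    have "(\<Sum>i\<in>{m0 - 1..<k}. if pv i x then av f v i x else 0) = (\<Sum>i\<in>{l'}. if pv i x then av f v i x else 0)"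
      using that piv_unique by (intro sum.mono_neutral_right) auto
    then show ?thesis using that by (simp add: good_def)
  qed
  have B_at: "(\<Sum>i\<in>{m0 - 1..<k}. B i x) = f x - av f v l' x"
    if "same v m x0 x" "pv l' x" "l' \<in> {m0 - 1..<k}" for x l'
  proof -
    have "(\<Sum>i\<in>{m0 - 1..<k}. B i x) = (\<Sum>i\<in>{l'}. B i x)"
      using that piv_unique by (intro sum.mono_neutral_right) (auto simp: osc_def)
    then show ?thesis using that by (simp add: osc_def)
  qed
  have good_le: "norm (good x) \<le> c1 * \<alpha>" for x
  proof (cases "same v k y x")
    case True
    then obtain l' where l': "l' \<in> {m0 - 1..<k}" "pv l' x" "same v m x0 x" using piv_below by blast
    then show ?thesis using good_at[OF True l'(2,1)] norm_av_le[OF l'(3,2)] by simp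
  next
    case False
    then show ?thesis using c1_pos \<alpha> by (simp add: good_def)
  qed
  have good_bdd: "bdd_borel good"
  proof (rule bdd_borelI[OF _ good_le])
    show "good \<in> borel_measurable borel" unfolding good_def by measurable
  qed
  have osc_bdd': "bdd_borel (\<lambda>x. if same v k y x then B l' x else 0)" for l'
  proof -
    have "bdd_borel (\<lambda>x. B l' x * indicator (cell v k y) x)"
      using osc_bdd by (intro bdd_borel_mult_indicator) (auto simp: bdd_cpt_fun_iff)
    moreover have "(\<lambda>x. B l' x * indicator (cell v k y) x) = (\<lambda>x. if same v k y x then B l' x else 0)"
      by (auto simp: cell_iff indicator_def)
    ultimately show ?thesis by simp
  qed
  have split: "(\<lambda>x. if same v k y x then f x else 0) =
      (\<lambda>x. good x + (\<Sum>l'\<in>{m0 - 1..<k}. if same v k y x then B l' x else 0))"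
  proof
    fix x
    show "(if same v k y x then f x else 0) = good x + (\<Sum>l'\<in>{m0 - 1..<k}. if same v k y x then B l' x else 0)"
    proof (cases "same v k y x")
      case True
      then obtain l' where l': "l' \<in> {m0 - 1..<k}" "pv l' x" "same v m x0 x" using piv_below by blast
      then show ?thesis using True good_at[OF True l'(2,1)] B_at[OF l'(3,2,1)] by simp
    qed (simp add: good_def)
  qed
  have eq: "A t (\<lambda>x. if same v k y x then f x else 0) y =
      A t good y + (\<Sum>l'\<in>{m0 - 1..<k}. A t (\<lambda>x. if same v k y x then B l' x else 0) y)"
    unfolding split by (subst A_add) (auto intro!: bdd_borel_sum osc_bdd' good_bdd simp: A_sum[OF _ osc_bdd'])
  have "norm (A t (\<lambda>x. if same v k y x then f x else 0) y) \<le>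
      norm (A t good y) + norm (\<Sum>l'\<in>{m0 - 1..<k}. A t (\<lambda>x. if same v k y x then B l' x else 0) y)"
    unfolding eq by (rule norm_triangle_ineq)
  also have "\<dots> \<le> c1 * \<alpha> * mass + (\<Sum>l'\<in>{m0 - 1..<k}. norm (A t (\<lambda>x. if same v k y x then B l' x else 0) y))"
    by (intro add_mono A_norm_le good_le norm_sum)
  finally show ?thesis .
qed

text \<open>Covers the points whose scale lies above their pivotal level. The bound is the
  contribution of a single cube to the sparse form, with a constant independent of \<alpha>, \<beta>
  and the number of levels.\<close>

lemma step:
  assumes \<tau> [measurable]: "\<tau> \<in> borel_measurable borel" and \<kappa> [measurable]: "\<kappa> \<in> measurable borel (count_space UNIV)"
    and \<tau>_range: "\<And>y. 2 powr of_int (\<kappa> y - a) \<le> \<tau> y \<and> \<tau> y \<le> 2 * 2 powr of_int (\<kappa> y - a)"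
    and \<kappa>_ge: "\<And>y. m0 \<le> \<kappa> y"
    and g [measurable]: "g \<in> borel_measurable borel" and \<beta>: "0 < \<beta>"
    and g_le: "(\<integral>\<^sup>+y\<in>cell v m x0. ennreal (norm (g y) powr r) \<partial>lborel) \<le> ennreal (\<beta> powr r * vol m)"
  shows "(\<integral>\<^sup>+y\<in>{y \<in> cell v m x0. \<kappa> y \<le> m \<and> (\<exists>l<\<kappa> y. pv l y)}. ennreal (norm (loc \<tau> f v \<kappa> y) * norm ((g :: real^'n \<Rightarrow> complex) y)) \<partial>lborel)
    \<le> ennreal (step_const a * \<alpha> * \<beta> * vol m)"
proof -
  define S where "S = cell v m x0"
  have [measurable]: "S \<in> sets borel" by (simp add: S_def)
  define Sk where "Sk k = {y \<in> S. \<exists>l'<k. pv l' y}" for k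
  have Sk_meas [measurable]: "Sk k \<in> sets borel" for k
  proof -
    have "{y \<in> space borel. y \<in> S \<and> (\<exists>l'<k. pv l' y)} \<in> sets borel" by measurable
    then show ?thesis by (simp add: Sk_def)
  qed
  \<comment> \<open>Where \<open>\<kappa> y\<close> is not \<open>k\<close> the parameter is
    replaced by an admissible constant, because the estimate for scale \<open>k\<close> needs it in
    the right octave everywhere.\<close>
  define \<tau>k where "\<tau>k k y = (if \<kappa> y = k then \<tau> y else 2 powr of_int (k - a))" for k y
  have [measurable]: "\<tau>k k \<in> borel_measurable borel" for k unfolding \<tau>k_def by measurable
  define V where "V k l y = ennreal (norm (A (\<tau>k k y) (\<lambda>x. if same v k y x then B l x else 0) y) powr q)" for k l y
  have [measurable]: "V k l \<in> borel_measurable borel" for k l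
  proof -
    have "(\<lambda>y. A (\<tau>k k y) (\<lambda>x. if same v k y x then B l x else 0) y) \<in> borel_measurable borel"
      by (rule measurable_A) measurable
    then show ?thesis unfolding V_def by measurable
  qed
  define N where "N l = (\<integral>\<^sup>+x. ennreal (norm (B l x) powr p) \<partial>lborel)" for l
  \<comment> \<open>Coefficient of the q-th power in \<open>young_weighted\<close> with gap
    \<open>k - l\<close>, set to 0 for \<open>l \<ge> k\<close> so that the double sum can run over
    a full rectangle of levels.\<close>
  define w where "w k l = (if l < k then \<alpha> * \<beta> * \<alpha> powr (- q) * 2 powr (\<epsilon> / 2 * of_int (k - l)) else 0)" for k l :: int
  have w0: "0 \<le> w k l" for k l using \<alpha> \<beta> by (simp add: w_def)
  let ?K = "{m0..m}" and ?L = "{m0 - 1..<m}"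
  define a2 where "a2 = \<alpha> * \<beta> * \<beta> powr (- r) * geo d2"
  have a2: "0 \<le> a2" using \<alpha> \<beta> geo_nonneg[OF d2_pos] by (simp add: a2_def)
  have ptw: "ennreal (norm (loc \<tau> f v \<kappa> y) * norm (g y)) * indicator {y \<in> S. \<kappa> y \<le> m \<and> (\<exists>l<\<kappa> y. pv l y)} y \<le>
      ennreal (c1 * \<alpha> * mass) * (ennreal (norm (g y)) * indicator S y) + ennreal a2 * (ennreal (norm (g y) powr r) * indicator S y) +
      (\<Sum>k\<in>?K. \<Sum>l\<in>?L. ennreal (w k l) * (V k l y * indicator (Sk k) y))" for y
  proof (cases "y \<in> S \<and> \<kappa> y \<le> m \<and> (\<exists>l<\<kappa> y. pv l y)")
    case True
    define k where "k = \<kappa> y"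
    define u where "u l = norm (A (\<tau> y) (\<lambda>x. if same v k y x then B l x else 0) y)" for l
    define G where "G = norm (g y)"
    obtain l0 where l0: "l0 < k" "pv l0 y" using True by (auto simp: k_def)
    have km: "m0 \<le> k" "k \<le> m" using \<kappa>_ge True by (auto simp: k_def)
    have ySk: "y \<in> Sk k" using True l0 by (auto simp: Sk_def)
    have "norm (loc \<tau> f v \<kappa> y) \<le> c1 * \<alpha> * mass + (\<Sum>l\<in>{m0 - 1..<k}. u l)"
      unfolding loc_def u_def k_def[symmetric] using True l0 km
      by (intro loc_split) (auto simp: S_def cell_iff)
    then have "norm (loc \<tau> f v \<kappa> y) * G \<le> (c1 * \<alpha> * mass + (\<Sum>l\<in>{m0 - 1..<k}. u l)) * G"
      by (intro mult_right_mono) (auto simp: G_def)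
    also have "\<dots> = c1 * \<alpha> * mass * G + (\<Sum>l\<in>{m0 - 1..<k}. u l * G)"
      by (simp add: distrib_right sum_distrib_right)
    also have "(\<Sum>l\<in>{m0 - 1..<k}. u l * G) \<le>
        (\<Sum>l\<in>{m0 - 1..<k}. w k l * u l powr q + \<alpha> * \<beta> * \<beta> powr (- r) * 2 powr (- d2 * of_int (k - l)) * G powr r)"
    proof (rule sum_mono)
      fix l assume "l \<in> {m0 - 1..<k}"
      then show "u l * G \<le> w k l * u l powr q + \<alpha> * \<beta> * \<beta> powr (- r) * 2 powr (- d2 * of_int (k - l)) * G powr r"
        using young_weighted[of "u l" G \<alpha> \<beta> "of_int (k - l)"] \<alpha> \<beta> by (simp add: w_def u_def G_def)
    qed
    also have "\<dots> = (\<Sum>l\<in>{m0 - 1..<k}. w k l * u l powr q) +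
        \<alpha> * \<beta> * \<beta> powr (- r) * (\<Sum>l\<in>{m0 - 1..<k}. 2 powr (- d2 * of_int (k - l))) * G powr r"
      by (simp add: sum.distrib sum_distrib_left sum_distrib_right)
    also have "\<dots> \<le> (\<Sum>l\<in>?L. w k l * u l powr q) + a2 * G powr r"
    proof (intro add_mono)
      show "(\<Sum>l\<in>{m0 - 1..<k}. w k l * u l powr q) \<le> (\<Sum>l\<in>?L. w k l * u l powr q)"
        using km w0 by (intro sum_mono2) auto
      have "(\<Sum>l\<in>{m0 - 1..<k}. 2 powr (- d2 * of_int (k - l))) \<le> geo d2"
        unfolding geo_def using d2_pos by (intro geometric_powr_sum_le) (auto simp: inj_on_def)
      then show "\<alpha> * \<beta> * \<beta> powr (- r) * (\<Sum>l\<in>{m0 - 1..<k}. 2 powr (- d2 * of_int (k - l))) * G powr r \<le> a2 * G powr r"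
        unfolding a2_def using \<alpha> \<beta> by (intro mult_right_mono mult_left_mono) auto
    qed
    finally have real_le: "norm (loc \<tau> f v \<kappa> y) * G \<le> c1 * \<alpha> * mass * G + (a2 * G powr r + (\<Sum>l\<in>?L. w k l * u l powr q))"
      by linarith
    have "(\<Sum>l\<in>?L. ennreal (w k l * u l powr q)) = (\<Sum>l\<in>?L. ennreal (w k l) * (V k l y * indicator (Sk k) y))"
      using ySk w0 by (intro sum.cong refl) (simp add: V_def u_def \<tau>k_def k_def[symmetric] ennreal_mult)
    \<comment> \<open>At a given point only the scale \<open>k = \<kappa> y\<close> occurs; adding
      the nonnegative terms of all other scales removes the dependence on \<open>y\<close>.\<close>
    also have "\<dots> \<le> (\<Sum>k\<in>?K. \<Sum>l\<in>?L. ennreal (w k l) * (V k l y * indicator (Sk k) y))"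
      using km by (intro member_le_sum[of k]) auto
    finally have sum_le: "(\<Sum>l\<in>?L. ennreal (w k l * u l powr q)) \<le> (\<Sum>k\<in>?K. \<Sum>l\<in>?L. ennreal (w k l) * (V k l y * indicator (Sk k) y))" .
    have "ennreal (norm (loc \<tau> f v \<kappa> y) * G) \<le> ennreal (c1 * \<alpha> * mass * G + (a2 * G powr r + (\<Sum>l\<in>?L. w k l * u l powr q)))"
      by (rule ennreal_leI[OF real_le])
    also have "\<dots> = ennreal (c1 * \<alpha> * mass) * ennreal G + (ennreal a2 * ennreal (G powr r) + (\<Sum>l\<in>?L. ennreal (w k l * u l powr q)))"
    proof -
      have n: "0 \<le> c1 * \<alpha> * mass * G" "0 \<le> a2 * G powr r" "0 \<le> (\<Sum>l\<in>?L. w k l * u l powr q)"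
        using c1_pos \<alpha> a2 w0 by (auto simp: G_def intro!: sum_nonneg)
      have m: "ennreal (c1 * \<alpha> * mass * G) = ennreal (c1 * \<alpha> * mass) * ennreal G"
          "ennreal (a2 * G powr r) = ennreal a2 * ennreal (G powr r)"
        using c1_pos \<alpha> a2 by (auto simp: G_def intro!: ennreal_mult)
      have "(\<Sum>l\<in>?L. ennreal (w k l * u l powr q)) = ennreal (\<Sum>l\<in>?L. w k l * u l powr q)"
        using w0 by (intro sum_ennreal) auto
      then show ?thesis using n m by (simp only: ennreal_plus add_nonneg_nonneg)
    qed
    also have "\<dots> \<le> ennreal (c1 * \<alpha> * mass) * ennreal G + (ennreal a2 * ennreal (G powr r) +
        (\<Sum>k\<in>?K. \<Sum>l\<in>?L. ennreal (w k l) * (V k l y * indicator (Sk k) y)))"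
      by (intro add_left_mono sum_le)
    finally show ?thesis using True by (simp add: G_def add.assoc)
  qed auto
  have gmeas: "(\<integral>\<^sup>+y. ennreal (norm (g y)) * indicator S y \<partial>lborel) \<le> ennreal (2 * \<beta> * vol m)"
    using r \<beta> g_le by (intro nn_integral_mean_le[where p = r]) (auto simp: S_def emeasure_cell)
  \<comment> \<open>The growing weight uses up half of the decay, and the powers of \<alpha> combine
    to \<open>\<alpha> powr (- p)\<close>.\<close>
  have piece: "ennreal (w k l) * (\<integral>\<^sup>+y. V k l y * indicator (Sk k) y \<partial>lborel) \<le>
      ennreal ((if l < k then 2 powr (- (\<epsilon> / 2) * of_int (k - l)) else 0) * (\<alpha> * \<beta> * \<alpha> powr (- p) * (mz_const a * c2 powr (q / p - 1)))) * N l"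
    if k: "k \<in> ?K" for k l
  proof (cases "l < k")
    case True
    have "(\<integral>\<^sup>+y. V k l y * indicator (Sk k) y \<partial>lborel) \<le>
      ennreal (mz_const a * 2 powr (- \<epsilon> * of_int (k - l)) * (c2 * \<alpha> powr p) powr (q / p - 1)) * N l"
      unfolding V_def Sk_def S_def N_def
    proof (rule osc_operator[OF True])
      show "2 powr of_int (k - a) \<le> \<tau>k k y \<and> \<tau>k k y \<le> 2 * 2 powr of_int (k - a)" for y
        using \<tau>_range[of y] by (auto simp: \<tau>k_def)
    qed (use k in auto)
    then have "ennreal (w k l) * (\<integral>\<^sup>+y. V k l y * indicator (Sk k) y \<partial>lborel) \<le>
      ennreal (w k l) * (ennreal (mz_const a * 2 powr (- \<epsilon> * of_int (k - l)) * (c2 * \<alpha> powr p) powr (q / p - 1)) * N l)"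
      by (rule mult_left_mono) simp
    also have "\<dots> = ennreal (w k l * (mz_const a * 2 powr (- \<epsilon> * of_int (k - l)) * (c2 * \<alpha> powr p) powr (q / p - 1))) * N l"
      using w0 mz_const_nonneg by (simp add: ennreal_mult mult.assoc)
    also have "w k l * (mz_const a * 2 powr (- \<epsilon> * of_int (k - l)) * (c2 * \<alpha> powr p) powr (q / p - 1)) =
      2 powr (- (\<epsilon> / 2) * of_int (k - l)) * (\<alpha> * \<beta> * \<alpha> powr (- p) * (mz_const a * c2 powr (q / p - 1)))"
    proof -
      have e1: "2 powr (\<epsilon> / 2 * of_int (k - l)) * 2 powr (- \<epsilon> * of_int (k - l)) = 2 powr (- (\<epsilon> / 2) * of_int (k - l))"
      proof -
        have "\<epsilon> / 2 * x + - \<epsilon> * x = - (\<epsilon> / 2) * x" for x by (simp add: field_simps)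
        then show ?thesis by (simp only: powr_add[symmetric])
      qed
      have e2: "(c2 * \<alpha> powr p) powr (q / p - 1) = c2 powr (q / p - 1) * \<alpha> powr (q - p)"
        using p by (simp add: powr_mult powr_powr algebra_simps)
      have e3: "\<alpha> powr (- q) * \<alpha> powr (q - p) = \<alpha> powr (- p)" by (simp add: powr_add[symmetric])
      have "w k l * (mz_const a * 2 powr (- \<epsilon> * of_int (k - l)) * (c2 * \<alpha> powr p) powr (q / p - 1)) =
        (2 powr (\<epsilon> / 2 * of_int (k - l)) * 2 powr (- \<epsilon> * of_int (k - l))) *
        (\<alpha> * \<beta> * (\<alpha> powr (- q) * \<alpha> powr (q - p)) * (mz_const a * c2 powr (q / p - 1)))"
        using True by (simp add: w_def e2 mult_ac)
      then show ?thesis unfolding e1 e3 .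
    qed
    finally show ?thesis using True by simp
  qed (simp add: w_def)
  define c3 where "c3 = \<alpha> * \<beta> * \<alpha> powr (- p) * (mz_const a * c2 powr (q / p - 1))"
  have c3: "0 \<le> c3" using \<alpha> \<beta> mz_const_nonneg by (simp add: c3_def)
  have "(\<integral>\<^sup>+y\<in>{y \<in> cell v m x0. \<kappa> y \<le> m \<and> (\<exists>l<\<kappa> y. pv l y)}. ennreal (norm (loc \<tau> f v \<kappa> y) * norm (g y)) \<partial>lborel)
     \<le> (\<integral>\<^sup>+y. ennreal (c1 * \<alpha> * mass) * (ennreal (norm (g y)) * indicator S y) + ennreal a2 * (ennreal (norm (g y) powr r) * indicator S y) +
      (\<Sum>k\<in>?K. \<Sum>l\<in>?L. ennreal (w k l) * (V k l y * indicator (Sk k) y)) \<partial>lborel)"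
    unfolding S_def[symmetric] by (intro nn_integral_mono ptw)
  also have "\<dots> = ennreal (c1 * \<alpha> * mass) * (\<integral>\<^sup>+y. ennreal (norm (g y)) * indicator S y \<partial>lborel) +
      ennreal a2 * (\<integral>\<^sup>+y. ennreal (norm (g y) powr r) * indicator S y \<partial>lborel) +
      (\<Sum>k\<in>?K. \<Sum>l\<in>?L. ennreal (w k l) * (\<integral>\<^sup>+y. V k l y * indicator (Sk k) y \<partial>lborel))"
    by (simp add: nn_integral_add nn_integral_cmult nn_integral_sum)
  also have "\<dots> \<le> ennreal (c1 * \<alpha> * mass) * ennreal (2 * \<beta> * vol m) + ennreal a2 * ennreal (\<beta> powr r * vol m) +
      (\<Sum>k\<in>?K. \<Sum>l\<in>?L. ennreal ((if l < k then 2 powr (- (\<epsilon> / 2) * of_int (k - l)) else 0) * c3) * N l)"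
    using g_le unfolding c3_def by (intro add_mono mult_left_mono gmeas sum_mono piece) (auto simp: S_def)
  \<comment> \<open>For a fixed pivotal level \<open>l\<close> the sum over scales
    \<open>k > l\<close> is geometric. What remains is a sum of energies over \<open>l\<close>,
    which \<open>sum_osc_energy\<close> bounds by one energy of the top cell.\<close>
  also have "(\<Sum>k\<in>?K. \<Sum>l\<in>?L. ennreal ((if l < k then 2 powr (- (\<epsilon> / 2) * of_int (k - l)) else 0) * c3) * N l) \<le>
      (\<Sum>l\<in>?L. ennreal (geo (\<epsilon> / 2) * c3) * N l)"
  proof (subst sum.swap, rule sum_mono)
    fix l
    have "(\<Sum>k\<in>?K. (if l < k then 2 powr (- (\<epsilon> / 2) * of_int (k - l)) else 0) * c3) =
       (\<Sum>k\<in>?K \<inter> {k. l < k}. 2 powr (- (\<epsilon> / 2) * of_int (k - l))) * c3"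
      unfolding sum_distrib_right[symmetric] by (subst sum.inter_restrict) (simp_all only: finite_atLeastAtMost_int mem_Collect_eq)
    also have "\<dots> \<le> geo (\<epsilon> / 2) * c3"
      unfolding geo_def using eps c3 by (intro mult_right_mono geometric_powr_sum_le) (auto simp: inj_on_def)
    finally have "ennreal (\<Sum>k\<in>?K. (if l < k then 2 powr (- (\<epsilon> / 2) * of_int (k - l)) else 0) * c3) \<le> ennreal (geo (\<epsilon> / 2) * c3)"
      by (rule ennreal_leI)
    moreover have "(\<Sum>k\<in>?K. ennreal ((if l < k then 2 powr (- (\<epsilon> / 2) * of_int (k - l)) else 0) * c3) * N l) =
       ennreal (\<Sum>k\<in>?K. (if l < k then 2 powr (- (\<epsilon> / 2) * of_int (k - l)) else 0) * c3) * N l"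
      by (subst sum_ennreal[symmetric]) (use c3 in \<open>auto simp only: sum_distrib_right intro!: mult_nonneg_nonneg split: if_splits\<close>, auto)
    ultimately show "(\<Sum>k\<in>?K. ennreal ((if l < k then 2 powr (- (\<epsilon> / 2) * of_int (k - l)) else 0) * c3) * N l) \<le> ennreal (geo (\<epsilon> / 2) * c3) * N l"
      by (simp add: mult_right_mono)
  qed
  also have "(\<Sum>l\<in>?L. ennreal (geo (\<epsilon> / 2) * c3) * N l) \<le> ennreal (geo (\<epsilon> / 2) * c3) * ennreal (c2 * \<alpha> powr p * vol m)"
    unfolding sum_distrib_left[symmetric] N_def by (intro mult_left_mono sum_osc_energy) auto
  also have "ennreal (c1 * \<alpha> * mass) * ennreal (2 * \<beta> * vol m) + ennreal a2 * ennreal (\<beta> powr r * vol m) +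
      ennreal (geo (\<epsilon> / 2) * c3) * ennreal (c2 * \<alpha> powr p * vol m) =
      ennreal (c1 * \<alpha> * mass * (2 * \<beta> * vol m) + a2 * (\<beta> powr r * vol m) + geo (\<epsilon> / 2) * c3 * (c2 * \<alpha> powr p * vol m))"
    using c1_pos c2_pos c3 \<alpha> \<beta> a2 geo_nonneg[of "\<epsilon> / 2"] eps
    by (simp add: ennreal_mult ennreal_plus)
  also have "c1 * \<alpha> * mass * (2 * \<beta> * vol m) + a2 * (\<beta> powr r * vol m) + geo (\<epsilon> / 2) * c3 * (c2 * \<alpha> powr p * vol m) =
      step_const a * \<alpha> * \<beta> * vol m"
  proof -
    \<comment> \<open>By homogeneity \<open>\<alpha> powr (- p)\<close> and
      \<open>\<beta> powr (- r)\<close> cancel against the energies of \<open>f\<close> and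
      \<open>g\<close>, leaving the product \<open>\<alpha> * \<beta>\<close>.\<close>
    have e1: "a2 * \<beta> powr r = \<alpha> * \<beta> * geo d2" using \<beta> by (simp add: a2_def powr_minus_divide)
    have e2: "c3 * \<alpha> powr p = \<alpha> * \<beta> * (mz_const a * c2 powr (q / p - 1))" using \<alpha> by (simp add: c3_def powr_minus_divide)
    have m1: "a2 * (\<beta> powr r * vol m) = \<alpha> * \<beta> * geo d2 * vol m" using e1 by (metis mult.assoc)
    have m2: "geo (\<epsilon> / 2) * c3 * (c2 * \<alpha> powr p * vol m) =
        geo (\<epsilon> / 2) * (\<alpha> * \<beta> * (mz_const a * c2 powr (q / p - 1))) * c2 * vol m"
      unfolding e2[symmetric] by (simp add: mult_ac)
    show ?thesis unfolding m1 m2 step_const_def by (simp add: algebra_simps)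
  qed
  finally show ?thesis by (simp add: add_mono mult_left_mono)
qed

end

section \<open>Sparse families\<close>

definition lp_avg :: "real \<Rightarrow> ('a::euclidean_space \<Rightarrow> complex) \<Rightarrow> 'a set \<Rightarrow> real" where
  "lp_avg p h S = ((LINT y:S|lborel. norm (h y) powr p) / measure lborel S) powr (1 / p)"

lemma lp_avg_nonneg [simp]: "0 \<le> lp_avg p h S" by (simp add: lp_avg_def)

lemma bdd_cpt_fun_powr_integrable:
  assumes "bdd_cpt_fun h" "0 < p"
  shows "integrable lborel (\<lambda>y. norm (h y) powr p)"
proof -
  obtain c where c: "\<forall>x. norm (h x) \<le> c" "c > 0"
    using bdd_borel_bound assms bdd_cpt_fun_iff by blast
  have [measurable]: "h \<in> borel_measurable borel" using assms by (simp add: bdd_cpt_fun_def)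
  let ?S = "closure {x. h x \<noteq> 0}"
  have "compact ?S" using assms by (simp add: bdd_cpt_fun_def)
  then show ?thesis
    using c closure_subset[of "{x. h x \<noteq> 0}"] emeasure_compact_finite[of ?S] assms
    by (intro integrableI_bounded_set[where A = ?S and B = "c powr p"]) (auto intro!: AE_I2 powr_mono2)
qed

lemma nn_integral_lp_avg:
  assumes h: "bdd_cpt_fun h" and p: "0 < p" and S [measurable]: "S \<in> sets borel" and m: "0 < measure lborel S"
  shows "(\<integral>\<^sup>+y\<in>S. ennreal (norm (h y) powr p) \<partial>lborel) = ennreal (lp_avg p h S powr p * measure lborel S)"
proof -
  have [measurable]: "h \<in> borel_measurable borel" using h by (simp add: bdd_cpt_fun_def)
  have int: "integrable lborel (\<lambda>y. indicator S y * (norm (h y) powr p))"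
    using integrable_mult_indicator[OF _ bdd_cpt_fun_powr_integrable[OF h p], of S] by simp
  have "(\<integral>\<^sup>+y\<in>S. ennreal (norm (h y) powr p) \<partial>lborel) = (\<integral>\<^sup>+y. ennreal (indicator S y * (norm (h y) powr p)) \<partial>lborel)"
    by (intro nn_integral_cong) (simp add: indicator_def)
  also have "\<dots> = ennreal (LINT y:S|lborel. norm (h y) powr p)"
    unfolding set_lebesgue_integral_def using int by (subst nn_integral_eq_integral) auto
  also have "(LINT y:S|lborel. norm (h y) powr p) = lp_avg p h S powr p * measure lborel S"
  proof -
    have "0 \<le> (LINT y:S|lborel. norm (h y) powr p)"
      unfolding set_lebesgue_integral_def by (intro integral_nonneg_AE AE_I2) (simp add: indicator_def)
    then show ?thesis using p m by (simp add: lp_avg_def powr_powr)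
  qed
  finally show ?thesis .
qed

lemma ennreal_eq_0_if_small:
  fixes X :: ennreal
  assumes "\<And>e::real. 0 < e \<Longrightarrow> X \<le> ennreal (c * e)"
  shows "X = 0"
proof -
  have *: "X \<le> 0 + ennreal e" if "0 < e" for e
  proof -
    have "c * (e / (\<bar>c\<bar> + 1)) \<le> \<bar>c\<bar> * (e / (\<bar>c\<bar> + 1))"
      using that by (intro mult_right_mono) auto
    also have "\<dots> \<le> e" using that by (simp add: field_simps)
    finally have 1: "ennreal (c * (e / (\<bar>c\<bar> + 1))) \<le> ennreal e" by (rule ennreal_leI)
    have "X \<le> ennreal (c * (e / (\<bar>c\<bar> + 1)))"
      using that by (intro assms) (simp add: add_nonneg_pos)
    from order_trans[OF this 1] show ?thesis by simp
  qed
  have "X \<le> 0" by (rule ennreal_le_epsilon) (use * in auto)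
  then show ?thesis by simp
qed

context improving
begin

lemma cube_borel [measurable]: "cube v l x \<in> sets borel"
  by (simp add: cube_def)

lemma interior_cube_subset: "interior (cube v l x) \<subseteq> cell v l x"
  unfolding interior_cube by (rule box_subset_cell)

lemma cube_diff_cell_null: "cube v l x - cell v l x \<in> null_sets lborel"
proof -
  have "emeasure lborel (cube v l x - cell v l x) = emeasure lborel (cube v l x) - emeasure lborel (cell v l x)"
    by (rule emeasure_Diff) (auto simp: emeasure_cell cell_subset_cube)
  then have "emeasure lborel (cube v l x - cell v l x) = 0" by (simp add: emeasure_cell emeasure_cube)
  then show ?thesis by (intro null_setsI) auto
qed

lemma nn_integral_cell_cube:
  "(\<integral>\<^sup>+y\<in>cell v l x. h y \<partial>lborel) = (\<integral>\<^sup>+y\<in>cube v l x. h y \<partial>lborel)"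
proof (rule nn_integral_null_delta)
  have "(cell v l x - cube v l x) \<union> (cube v l x - cell v l x) = cube v l x - cell v l x"
    using cell_subset_cube by blast
  then show "(cell v l x - cube v l x) \<union> (cube v l x - cell v l x) \<in> null_sets lborel"
    using cube_diff_cell_null[of v l x] by simp
qed auto

lemma nn_integral_cell_lp_avg:
  "bdd_cpt_fun h \<Longrightarrow> 0 < s \<Longrightarrow>
    (\<integral>\<^sup>+y\<in>cell v l x. ennreal (norm (h y) powr s) \<partial>lborel) = ennreal (lp_avg s h (cube v l x) powr s * vol l)"
  unfolding nn_integral_cell_cube
  by (subst nn_integral_lp_avg) (auto simp: measure_cube)

text \<open>The witnesses of sparseness are kept inside half-open cells, since closed cubes of
  disjoint cells may touch; finiteness makes the sparse form an ordinary sum.\<close>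

definition good_fam :: "real^'n \<Rightarrow> int \<Rightarrow> (real^'n) set \<Rightarrow> (real^'n) set set \<Rightarrow> ((real^'n) set \<Rightarrow> (real^'n) set) \<Rightarrow> bool" where
  "good_fam v m0 T \<S> E \<longleftrightarrow> finite \<S> \<and> disjoint_family_on E \<S> \<and>
    (\<forall>S\<in>\<S>. \<exists>l x. m0 \<le> l \<and> S = cube v l x \<and> cell v l x \<subseteq> T \<and> E S \<in> sets borel \<and> E S \<subseteq> cell v l x \<and>
      vol l / 4 < measure lborel (E S))"

lemma good_famD:
  assumes "good_fam v m0 T \<S> E" "S \<in> \<S>"
  obtains l x where "m0 \<le> l" "S = cube v l x" "cell v l x \<subseteq> T" "E S \<in> sets borel" "E S \<subseteq> cell v l x"
    "vol l / 4 < measure lborel (E S)"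
  using assms unfolding good_fam_def by blast

text \<open>The top cube receives as witness what the stopping cells leave of its cell, at least
  half of it. Families of different stopping cells share no cube, because the interior of a cube
  lies in its cell; hence every cube is counted once in the sum.\<close>

lemma good_fam_combine:
  assumes fin: "finite \<P>" and disj: "disjoint \<P>" and m: "m0 \<le> m"
    and \<P>: "\<And>P. P \<in> \<P> \<Longrightarrow> P \<subseteq> cell v m x0 \<and> P \<in> sets borel \<and> emeasure lborel P < ennreal (vol m)"
    and small: "emeasure lborel (\<Union>\<P>) \<le> ennreal (vol m / 2)"
    and fam: "\<And>P. P \<in> \<P> \<Longrightarrow> good_fam v m0 P (\<S> P) (E P)"
  obtains E' where "good_fam v m0 (cell v m x0) (insert (cube v m x0) (\<Union>P\<in>\<P>. \<S> P)) E'"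
    and "\<And>w :: (real^'n) set \<Rightarrow> real. sum w (insert (cube v m x0) (\<Union>P\<in>\<P>. \<S> P)) = w (cube v m x0) + (\<Sum>P\<in>\<P>. sum w (\<S> P))"
proof -
  let ?C = "cube v m x0"
  have finS: "finite (\<S> P)" if "P \<in> \<P>" for P using fam[OF that] by (simp add: good_fam_def)
  \<comment> \<open>A cube in the family below \<open>P\<close> has at most the volume of
    \<open>P\<close>, which is strictly smaller than that of the top cube.\<close>
  have ne: "?C \<notin> \<S> P" if P: "P \<in> \<P>" for P
  proof
    assume "?C \<in> \<S> P"
    then obtain l x where l: "?C = cube v l x" "cell v l x \<subseteq> P"
      using good_famD[OF fam[OF P]] by metis
    have "ennreal (vol m) = emeasure lborel (cell v l x)"
      using emeasure_cube[of v m x0] l emeasure_cube[of v l x] emeasure_cell[of v l x] by simp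
    also have "\<dots> \<le> emeasure lborel P" using l \<P>[OF P] by (intro emeasure_mono) auto
    finally show False using \<P>[OF P] by (meson leD)
  qed
  have inj: "P = P'" if i: "P \<in> \<P>" "P' \<in> \<P>" "S \<in> \<S> P" "S \<in> \<S> P'" for P P' S
  proof -
    obtain l x where l: "S = cube v l x" "cell v l x \<subseteq> P"
      using good_famD[OF fam[OF i(1)] i(3)] by metis
    obtain l' x' where l': "S = cube v l' x'" "cell v l' x' \<subseteq> P'"
      using good_famD[OF fam[OF i(2)] i(4)] by metis
    have "emeasure lborel (interior S) \<noteq> 0"
      using l emeasure_cube_interior[of v l x] less_imp_neq[OF vol_pos[of l]] by simp
    then obtain z where "z \<in> interior S" by fastforce
    then have "z \<in> P \<inter> P'"
      using l l' interior_cube_subset[of v l x] interior_cube_subset[of v l' x'] by auto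
    then show ?thesis using disj that by (auto simp: disjoint_def)
  qed
  define par where "par S = (THE P. P \<in> \<P> \<and> S \<in> \<S> P)" for S
  have par: "par S = P" if "P \<in> \<P>" "S \<in> \<S> P" for S P
    unfolding par_def using that inj by (intro the_equality) auto
  define E' where "E' S = (if S = ?C then cell v m x0 - \<Union>\<P> else E (par S) S)" for S
  have E'_eq: "E' S = E P S" if "P \<in> \<P>" "S \<in> \<S> P" for S P
    using that ne by (auto simp: E'_def par)
  have E'_sub: "E' S \<subseteq> P" if "P \<in> \<P>" "S \<in> \<S> P" for S P
    using good_famD[OF fam[OF that(1)] that(2)] E'_eq[OF that] by (metis order_trans)
  have "good_fam v m0 (cell v m x0) (insert ?C (\<Union>P\<in>\<P>. \<S> P)) E'"
    unfolding good_fam_def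
  proof (intro conjI ballI)
    show "finite (insert ?C (\<Union>P\<in>\<P>. \<S> P))" using fin finS by simp
    show "disjoint_family_on E' (insert ?C (\<Union>P\<in>\<P>. \<S> P))"
      unfolding disjoint_family_on_def
    proof (intro ballI impI)
      fix S S' assume S: "S \<in> insert ?C (\<Union>P\<in>\<P>. \<S> P)" "S' \<in> insert ?C (\<Union>P\<in>\<P>. \<S> P)" "S \<noteq> S'"
      have main: "E' ?C \<inter> E' S = {}" if "S \<in> \<S> P" "P \<in> \<P>" for S P
      proof -
        have "E' ?C = cell v m x0 - \<Union>\<P>" by (simp add: E'_def)
        then show ?thesis using E'_sub[OF that(2,1)] that(2) by blast
      qed
      consider "S = ?C" "S' \<noteq> ?C" | "S' = ?C" "S \<noteq> ?C" | "S \<noteq> ?C" "S' \<noteq> ?C" using S by blast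
      then show "E' S \<inter> E' S' = {}"
      proof cases
        case 1 then show ?thesis using S main by auto
      next
        case 2 then show ?thesis using S main by blast
      next
        case 3
        then obtain P P' where P: "P \<in> \<P>" "S \<in> \<S> P" "P' \<in> \<P>" "S' \<in> \<S> P'" using S by auto
        show ?thesis
        proof (cases "P = P'")
          case True
          then show ?thesis
            using fam[OF P(1)] P S E'_eq unfolding good_fam_def disjoint_family_on_def by metis
        next
          case False
          then have "P \<inter> P' = {}" using disj P by (auto simp: disjoint_def)
          then show ?thesis using E'_sub[OF P(1,2)] E'_sub[OF P(3,4)] by blast
        qed
      qed
    qed
    fix S assume S: "S \<in> insert ?C (\<Union>P\<in>\<P>. \<S> P)"
    show "\<exists>l x. m0 \<le> l \<and> S = cube v l x \<and> cell v l x \<subseteq> cell v m x0 \<and> E' S \<in> sets borel \<and> E' S \<subseteq> cell v l x \<and>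
      vol l / 4 < measure lborel (E' S)"
    proof (cases "S = ?C")
      case True
      have UP: "\<Union>\<P> \<in> sets borel" using \<P> fin by (auto intro!: sets.finite_Union)
      have "emeasure lborel (cell v m x0 - \<Union>\<P>) = emeasure lborel (cell v m x0) - emeasure lborel (\<Union>\<P>)"
        using UP \<P> small by (intro emeasure_Diff) (auto simp: top_unique)
      moreover have "ennreal (vol m / 2) \<le> emeasure lborel (cell v m x0) - emeasure lborel (\<Union>\<P>)"
      proof -
        have "ennreal (vol m / 2) = ennreal (vol m) - ennreal (vol m / 2)"
          by (subst ennreal_minus) auto
        also have "\<dots> \<le> emeasure lborel (cell v m x0) - emeasure lborel (\<Union>\<P>)"
          unfolding emeasure_cell by (intro ennreal_minus_mono small) auto
        finally show ?thesis .
      qed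
      ultimately have "ennreal (vol m / 2) \<le> emeasure lborel (cell v m x0 - \<Union>\<P>)" by simp
      moreover have "emeasure lborel (cell v m x0 - \<Union>\<P>) \<le> ennreal (vol m)"
        unfolding emeasure_cell[symmetric, of m v x0] by (intro emeasure_mono) auto
      ultimately have "vol m / 2 \<le> measure lborel (cell v m x0 - \<Union>\<P>)"
        using enn2real_mono[of "ennreal (vol m / 2)" "emeasure lborel (cell v m x0 - \<Union>\<P>)"]
        by (simp add: measure_def le_less_trans[OF _ ennreal_less_top])
      then have "vol m / 4 < measure lborel (cell v m x0 - \<Union>\<P>)" using vol_pos[of m] by linarith
      then have "vol m / 4 < measure lborel (E' S)" using True by (simp add: E'_def)
      then show ?thesis
        using True m UP by (intro exI[of _ m] exI[of _ x0]) (auto simp: E'_def)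
    next
      case False
      then obtain P where P: "P \<in> \<P>" "S \<in> \<S> P" using S by auto
      obtain l x where "m0 \<le> l" "S = cube v l x" "cell v l x \<subseteq> P" "E P S \<in> sets borel" "E P S \<subseteq> cell v l x"
          "vol l / 4 < measure lborel (E P S)"
        by (rule good_famD[OF fam[OF P(1)] P(2)])
      then show ?thesis unfolding E'_eq[OF P] using \<P>[OF P(1)] by blast
    qed
  qed
  moreover have "sum w (insert ?C (\<Union>P\<in>\<P>. \<S> P)) = w ?C + (\<Sum>P\<in>\<P>. sum w (\<S> P))" for w :: "(real^'n) set \<Rightarrow> real"
  proof -
    have "sum w (insert ?C (\<Union>P\<in>\<P>. \<S> P)) = w ?C + sum w (\<Union>P\<in>\<P>. \<S> P)"
      using fin finS ne by (intro sum.insert) auto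
    also have "sum w (\<Union>P\<in>\<P>. \<S> P) = (\<Sum>P\<in>\<P>. sum w (\<S> P))"
      using fin finS inj by (intro sum.UNION_disjoint) auto
    finally show ?thesis .
  qed
  ultimately show ?thesis by (rule that)
qed

lemma loc_meas:
  assumes [measurable]: "f \<in> borel_measurable borel" "\<tau> \<in> borel_measurable borel" "\<kappa> \<in> measurable borel (count_space UNIV)"
  shows "loc \<tau> f v \<kappa> \<in> borel_measurable borel"
proof -
  \<comment> \<open>\<kappa> takes countably many values, and for each fixed level the relation is
    measurable.\<close>
  have [measurable]: "Measurable.pred (borel \<Otimes>\<^sub>M borel) (\<lambda>w. same v (\<kappa> (fst w)) (fst w) (snd w))"
    by (rule measurable_compose_countable[of "\<lambda>i w. same v i (fst w) (snd w)" _ _ "\<lambda>w. \<kappa> (fst w)"]) measurable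
  show ?thesis
    unfolding loc_def by (rule measurable_A) (simp add: case_prod_beta, measurable)
qed

text \<open>Chebyshev: disjoint cells, each with energy above \<open>2 * \<alpha> powr p\<close>
  times its volume, share an energy of at most \<open>\<alpha> powr p * vol m\<close>.\<close>

lemma small_stopping:
  assumes fin: "finite \<P>" and disj: "disjoint \<P>" and \<alpha>: "0 < \<alpha>"
    and \<P>: "\<And>P. P \<in> \<P> \<Longrightarrow> P \<subseteq> cell v m x0 \<and> (\<exists>l y. P = cell v l y \<and> ennreal (2 * \<alpha> powr p * vol l) < en f v l y)"
    and f [measurable]: "f \<in> borel_measurable borel" and en0: "en f v m x0 \<le> ennreal (\<alpha> powr p * vol m)"
  shows "emeasure lborel (\<Union>\<P>) \<le> ennreal (vol m / 2)"
proof -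
  have meas: "P \<in> sets lborel" if "P \<in> \<P>" for P using \<P>[OF that] by auto
  have "ennreal (2 * \<alpha> powr p) * emeasure lborel (\<Union>\<P>) = (\<Sum>P\<in>\<P>. ennreal (2 * \<alpha> powr p) * emeasure lborel P)"
  proof -
    have "disjoint_family_on (\<lambda>P. P) \<P>" using disj by (auto simp: disjoint_family_on_def disjoint_def)
    then have "(\<Sum>P\<in>\<P>. emeasure lborel P) = emeasure lborel (\<Union>\<P>)"
      using sum_emeasure[of "\<lambda>P. P" \<P> lborel] fin meas by auto
    then show ?thesis by (simp add: sum_distrib_left[symmetric])
  qed
  also have "\<dots> \<le> (\<Sum>P\<in>\<P>. \<integral>\<^sup>+x\<in>P. ennreal (norm (f x) powr p) \<partial>lborel)"
  proof (rule sum_mono)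
    fix P assume "P \<in> \<P>"
    then obtain l y where "P = cell v l y" "ennreal (2 * \<alpha> powr p * vol l) < en f v l y" using \<P> by blast
    then show "ennreal (2 * \<alpha> powr p) * emeasure lborel P \<le> (\<integral>\<^sup>+x\<in>P. ennreal (norm (f x) powr p) \<partial>lborel)"
      by (simp add: emeasure_cell en_eq ennreal_mult less_imp_le)
  qed
  also have "\<dots> = (\<integral>\<^sup>+x\<in>\<Union>\<P>. ennreal (norm (f x) powr p) \<partial>lborel)"
    by (rule nn_integral_finite_partition[symmetric]) (use fin disj meas in auto)
  also have "\<dots> \<le> en f v m x0"
    unfolding en_eq using \<P> by (intro nn_integral_mono) (auto simp: indicator_def)
  also have "\<dots> \<le> ennreal (2 * \<alpha> powr p) * ennreal (vol m / 2)"
    using en0 by (simp add: ennreal_mult[symmetric])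
  finally show ?thesis
    using \<alpha> by (subst (asm) ennreal_mult_le_mult_iff) auto
qed

text \<open>Strong induction on the number \<open>d\<close> of levels from \<open>m0\<close> to the
  top; for \<open>d = 0\<close> the domain of integration is empty. The stopping step handles scales
  above the pivotal level of a point; a scale at or below it sees only the stopping cell containing
  the point, which has fewer levels left.\<close>

lemma sparse_family:
  assumes f: "bdd_cpt_fun f" and g: "bdd_cpt_fun g"
    and \<tau> [measurable]: "\<tau> \<in> borel_measurable borel" and \<kappa> [measurable]: "\<kappa> \<in> measurable borel (count_space UNIV)"
    and \<tau>_range: "\<And>y. 2 powr of_int (\<kappa> y - a) \<le> \<tau> y \<and> \<tau> y \<le> 2 * 2 powr of_int (\<kappa> y - a)"
    and \<kappa>_ge: "\<And>y. m0 \<le> \<kappa> y"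
  shows "\<exists>\<S> E. good_fam v m0 (cell v (m0 - 1 + int d) x0) \<S> E \<and>
    (\<integral>\<^sup>+y\<in>{y \<in> cell v (m0 - 1 + int d) x0. \<kappa> y \<le> m0 - 1 + int d}. ennreal (norm (loc \<tau> f v \<kappa> y) * norm (g y)) \<partial>lborel)
      \<le> ennreal (step_const a * (\<Sum>S\<in>\<S>. measure lborel S * lp_avg p f S * lp_avg r g S))"
proof (induction d arbitrary: x0 rule: less_induct)
  case (less d)
  have [measurable]: "f \<in> borel_measurable borel" "g \<in> borel_measurable borel"
    using f g by (auto simp: bdd_cpt_fun_def)
  have [measurable]: "loc \<tau> f v \<kappa> \<in> borel_measurable borel"
    by (rule loc_meas) measurable
  define m where "m = m0 - 1 + int d"
  define h where "h y = ennreal (norm (loc \<tau> f v \<kappa> y) * norm (g y))" for y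
  have h_meas [measurable]: "h \<in> borel_measurable borel" unfolding h_def by measurable
  have empty_fam: "good_fam v m0 (cell v m x0) {} (\<lambda>_. {})"
    by (simp add: good_fam_def disjoint_family_on_def)
  define T where "T = {y \<in> cell v m x0. \<kappa> y \<le> m}"
  let ?w = "\<lambda>S. measure lborel S * lp_avg p f S * lp_avg r g S"
  have "\<exists>\<S> E. good_fam v m0 (cell v m x0) \<S> E \<and> (\<integral>\<^sup>+y\<in>T. h y \<partial>lborel) \<le> ennreal (step_const a * sum ?w \<S>)"
  proof (cases "m0 \<le> m")
    case False
    then have "T = {}" using \<kappa>_ge order_trans unfolding T_def by blast
    then show ?thesis by (intro exI[of _ "{}"] exI[of _ "\<lambda>_. {}"] conjI empty_fam) simp
  next
    case m0: True
    define \<alpha> where "\<alpha> = lp_avg p f (cube v m x0)"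
    define \<beta> where "\<beta> = lp_avg r g (cube v m x0)"
    have en_f: "en f v m x0 = ennreal (\<alpha> powr p * vol m)"
      unfolding en_eq \<alpha>_def using p by (intro nn_integral_cell_lp_avg f) simp
    have en_g: "(\<integral>\<^sup>+y\<in>cell v m x0. ennreal (norm (g y) powr r) \<partial>lborel) = ennreal (\<beta> powr r * vol m)"
      unfolding \<beta>_def using r by (intro nn_integral_cell_lp_avg g) simp
    \<comment> \<open>The averages may vanish while the stopping step wants positive bounds: \<beta>
      is approached from above here, and \<open>\<alpha>'\<close> stays free for the case
      distinction below.\<close>
    have step0: "(\<integral>\<^sup>+y\<in>{y \<in> cell v m x0. \<kappa> y \<le> m \<and> (\<exists>l<\<kappa> y. piv f v \<alpha>' m0 m l y)}. h y \<partial>lborel)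
       \<le> ennreal (step_const a * \<alpha>' * \<beta> * vol m)" if \<alpha>': "0 < \<alpha>'" "\<alpha> \<le> \<alpha>'" for \<alpha>'
    proof -
      have "en f v m x0 \<le> ennreal (\<alpha>' powr p * vol m)"
        unfolding en_f using \<alpha>' p by (intro ennreal_leI mult_right_mono powr_mono2) (auto simp: \<alpha>_def)
      then interpret st: stopping \<nu> \<Psi> sg b R p q \<epsilon> C f v \<alpha>' m0 m x0
        using f \<alpha>' m0 by unfold_locales
      have bd: "(\<integral>\<^sup>+y\<in>{y \<in> cell v m x0. \<kappa> y \<le> m \<and> (\<exists>l<\<kappa> y. piv f v \<alpha>' m0 m l y)}. h y \<partial>lborel)
        \<le> ennreal (step_const a * \<alpha>' * (\<beta> + e) * vol m)" if e: "0 < e" for e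
        unfolding h_def
      proof (rule st.step[OF \<tau> \<kappa> \<tau>_range \<kappa>_ge])
        show "0 < \<beta> + e" using e by (simp add: \<beta>_def add_nonneg_pos)
        show "(\<integral>\<^sup>+y\<in>cell v m x0. ennreal (norm (g y) powr r) \<partial>lborel) \<le> ennreal ((\<beta> + e) powr r * vol m)"
          unfolding en_g using e r by (intro ennreal_leI mult_right_mono powr_mono2) (auto simp: \<beta>_def)
      qed measurable
      show ?thesis
      proof (rule ennreal_le_epsilon)
        fix e :: real assume e: "0 < e"
        define c where "c = step_const a * \<alpha>' * vol m"
        have c: "0 \<le> c" using step_const_nonneg \<alpha>' by (simp add: c_def)
        have "(\<integral>\<^sup>+y\<in>{y \<in> cell v m x0. \<kappa> y \<le> m \<and> (\<exists>l<\<kappa> y. piv f v \<alpha>' m0 m l y)}. h y \<partial>lborel)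
          \<le> ennreal (step_const a * \<alpha>' * (\<beta> + e / (c + 1)) * vol m)"
          using e c by (intro bd) simp
        also have "step_const a * \<alpha>' * (\<beta> + e / (c + 1)) * vol m = step_const a * \<alpha>' * \<beta> * vol m + c * (e / (c + 1))"
          by (simp add: c_def algebra_simps)
        also have "\<dots> \<le> step_const a * \<alpha>' * \<beta> * vol m + e"
          using e c by (simp add: field_simps)
        also have "ennreal (step_const a * \<alpha>' * \<beta> * vol m + e) = ennreal (step_const a * \<alpha>' * \<beta> * vol m) + ennreal e"
          using e step_const_nonneg \<alpha>' by (intro ennreal_plus) (auto simp: \<beta>_def)
        finally show "(\<integral>\<^sup>+y\<in>{y \<in> cell v m x0. \<kappa> y \<le> m \<and> (\<exists>l<\<kappa> y. piv f v \<alpha>' m0 m l y)}. h y \<partial>lborel)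
          \<le> ennreal (step_const a * \<alpha>' * \<beta> * vol m) + ennreal e" by (simp add: ennreal_leI)
      qed
    qed
    show ?thesis
    proof (cases "\<alpha> = 0")
      case True
      \<comment> \<open>At every height \<open>e > 0\<close> no cube stops, so a single step covers all of \<open>T\<close>.\<close>
      have "(\<integral>\<^sup>+y\<in>T. h y \<partial>lborel) = 0"
      proof (rule ennreal_eq_0_if_small)
        fix e :: real assume e: "0 < e"
        have "\<not> stp f v e m0 m k y" if "y \<in> cell v m x0" for k y
        proof
          assume st: "stp f v e m0 m k y"
          then have "en f v k y \<le> en f v m y" by (intro en_mono) (simp add: stp_def)
          also have "\<dots> = 0" using en_cong[of v m x0 y f] that en_f True p by (simp add: cell_iff)
          finally show False using st by (simp add: stp_def)
        qed
        then have pv0: "piv f v e m0 m (m0 - 1) y" if "y \<in> cell v m x0" for y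
          using m0 that by (simp add: piv_def)
        have "m0 - 1 < \<kappa> y" for y using \<kappa>_ge[of y] by simp
        then have "T = {y \<in> cell v m x0. \<kappa> y \<le> m \<and> (\<exists>l<\<kappa> y. piv f v e m0 m l y)}"
          using pv0 unfolding T_def by blast
        then show "(\<integral>\<^sup>+y\<in>T. h y \<partial>lborel) \<le> ennreal (step_const a * \<beta> * vol m * e)"
          using step0[of e] e True by (simp add: mult_ac)
      qed
      then show ?thesis by (intro exI[of _ "{}"] exI[of _ "\<lambda>_. {}"] conjI empty_fam) simp
    next
      case False
      then have \<alpha>: "0 < \<alpha>" using lp_avg_nonneg[of p f] by (simp add: \<alpha>_def less_le)
      let ?pv = "piv f v \<alpha> m0 m"
      have [measurable]: "Measurable.pred borel (?pv l)" for l by (rule piv_meas) measurable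
      \<comment> \<open>Only pivotal levels from \<open>m0\<close> on are genuine stopping levels;
        the default \<open>m0 - 1\<close> is left out.\<close>
      define \<P> where "\<P> = (\<Union>l\<in>{m0..<m}. {cell v l y | y. y \<in> cell v m x0 \<and> ?pv l y})"
      have fin: "finite \<P>" unfolding \<P>_def by (intro finite_UN_I finite_cells) auto
      have \<P>_E: "\<exists>l y. l \<in> {m0..<m} \<and> P = cell v l y \<and> y \<in> cell v m x0 \<and> ?pv l y" if "P \<in> \<P>" for P
        using that by (auto simp: \<P>_def)
      have sub: "cell v l y \<subseteq> cell v m x0" if "l < m" "y \<in> cell v m x0" for l y
        using cell_mono[of l m v y] cell_eq[OF that(2)] that by simp
      have disj: "disjoint \<P>"
      proof (rule disjointI)
        fix P P' assume P: "P \<in> \<P>" "P' \<in> \<P>" "P \<noteq> P'"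
        obtain l y where l: "P = cell v l y" "?pv l y" using \<P>_E[OF P(1)] by blast
        obtain l' y' where l': "P' = cell v l' y'" "?pv l' y'" using \<P>_E[OF P(2)] by blast
        show "P \<inter> P' = {}"
        proof (rule ccontr)
          assume "P \<inter> P' \<noteq> {}"
          then obtain z where z: "z \<in> cell v l y" "z \<in> cell v l' y'" using l l' by auto
          then have "?pv l z" "?pv l' z" using l l' piv_cong by (auto simp: cell_iff)
          then have "l = l'" by (rule piv_unique)
          then have "P = P'" using cell_eq[OF z(1)] cell_eq[OF z(2)] l l' by simp
          then show False using P by simp
        qed
      qed
      have stop: "ennreal (2 * \<alpha> powr p * vol l) < en f v l y" if "?pv l y" "m0 \<le> l" for l y
        using that by (auto simp: piv_def stp_def)
      have small: "emeasure lborel (\<Union>\<P>) \<le> ennreal (vol m / 2)"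
      proof (rule small_stopping[OF fin disj \<alpha>])
        fix P assume "P \<in> \<P>"
        then show "P \<subseteq> cell v m x0 \<and> (\<exists>l y. P = cell v l y \<and> ennreal (2 * \<alpha> powr p * vol l) < en f v l y)"
          using \<P>_E[of P] sub stop by fastforce
      qed (auto simp: en_f)
      define \<R> where "\<R> P l y \<S> E \<longleftrightarrow> l \<in> {m0..<m} \<and> P = cell v l y \<and> y \<in> cell v m x0 \<and> ?pv l y \<and> good_fam v m0 P \<S> E \<and>
          (\<integral>\<^sup>+y\<in>{y \<in> P. \<kappa> y \<le> l}. h y \<partial>lborel) \<le> ennreal (step_const a * sum ?w \<S>)" for P l y \<S> E
      have ex: "\<exists>t. \<R> P (fst t) (fst (snd t)) (fst (snd (snd t))) (snd (snd (snd t)))" if P: "P \<in> \<P>" for P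
      proof -
        obtain l y where l: "l \<in> {m0..<m}" "P = cell v l y" "y \<in> cell v m x0" "?pv l y" using \<P>_E[OF P] by blast
        \<comment> \<open>Makes \<open>l\<close> the top level in the induction hypothesis.\<close>
        define d' where "d' = nat (l - m0 + 1)"
        have d': "d' < d" "m0 - 1 + int d' = l" using l m0 by (auto simp: d'_def m_def)
        obtain \<S> E where "\<R> P l y \<S> E"
          using less.IH[OF d'(1), of y] l unfolding d' h_def \<R>_def by blast
        then show ?thesis by (intro exI[of _ "(l, y, \<S>, E)"]) simp
      qed
      obtain t where t: "\<And>P. P \<in> \<P> \<Longrightarrow> \<R> P (fst (t P)) (fst (snd (t P))) (fst (snd (snd (t P)))) (snd (snd (snd (t P))))"
        using bchoice[of \<P> "\<lambda>P t. \<R> P (fst t) (fst (snd t)) (fst (snd (snd t))) (snd (snd (snd t)))"] ex by blast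
      define lv where "lv P = fst (t P)" for P
      define yv where "yv P = fst (snd (t P))" for P
      define \<S> where "\<S> P = fst (snd (snd (t P)))" for P
      define E where "E P = snd (snd (snd (t P)))" for P
      have ch: "lv P \<in> {m0..<m} \<and> P = cell v (lv P) (yv P) \<and> yv P \<in> cell v m x0 \<and>
          ?pv (lv P) (yv P) \<and> good_fam v m0 P (\<S> P) (E P) \<and>
          (\<integral>\<^sup>+y\<in>{y \<in> P. \<kappa> y \<le> lv P}. h y \<partial>lborel) \<le> ennreal (step_const a * sum ?w (\<S> P))"
        if "P \<in> \<P>" for P
        using t[OF that] unfolding \<R>_def lv_def yv_def \<S>_def E_def .
      have \<P>_sub: "P \<subseteq> cell v m x0 \<and> P \<in> sets borel \<and> emeasure lborel P < ennreal (vol m)" if "P \<in> \<P>" for P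
      proof -
        have c: "lv P < m" "P = cell v (lv P) (yv P)" "yv P \<in> cell v m x0" using ch[OF that] by auto
        have "emeasure lborel P = ennreal (vol (lv P))" using c(2) emeasure_cell by metis
        moreover have "P \<in> sets borel" using c(2) cell_borel by metis
        moreover have "P \<subseteq> cell v m x0" using sub[OF c(1,3)] c(2) by simp
        ultimately show ?thesis using vol_less[OF c(1)] by (simp add: ennreal_less_iff)
      qed
      obtain E' where E': "good_fam v m0 (cell v m x0) (insert (cube v m x0) (\<Union>P\<in>\<P>. \<S> P)) E'"
        and sum_eq: "sum ?w (insert (cube v m x0) (\<Union>P\<in>\<P>. \<S> P)) = ?w (cube v m x0) + (\<Sum>P\<in>\<P>. sum ?w (\<S> P))"
      proof (rule good_fam_combine[OF fin disj m0 \<P>_sub small, of \<S> E])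
        show "good_fam v m0 P (\<S> P) (E P)" if "P \<in> \<P>" for P using ch[OF that] by blast
        fix E' assume "good_fam v m0 (cell v m x0) (insert (cube v m x0) (\<Union>P\<in>\<P>. \<S> P)) E'"
          "\<And>w :: (real^'n) set \<Rightarrow> real. sum w (insert (cube v m x0) (\<Union>P\<in>\<P>. \<S> P)) = w (cube v m x0) + (\<Sum>P\<in>\<P>. sum w (\<S> P))"
        then show ?thesis by (rule that)
      qed
      let ?T1 = "{y \<in> cell v m x0. \<kappa> y \<le> m \<and> (\<exists>l<\<kappa> y. ?pv l y)}"
      \<comment> \<open>If the scale of \<open>y\<close> is not above its pivotal level, then that
        level is at least \<open>m0\<close>, so it is not the default value, and \<open>y\<close>
        lies in a stopping cell \<open>P\<close> whose level bounds the scale.\<close>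
      have ptw: "h y * indicator T y \<le> h y * indicator ?T1 y + (\<Sum>P\<in>\<P>. h y * indicator {y \<in> P. \<kappa> y \<le> lv P} y)" for y
      proof (cases "y \<in> T \<and> y \<notin> ?T1")
        case True
        obtain l where l: "?pv l y" using piv_ex[OF m0] .
        have le: "\<kappa> y \<le> l" using True l by (force simp: T_def)
        then have lr: "l \<in> {m0..<m}" using piv_range[OF l] \<kappa>_ge[of y] by auto
        define P where "P = cell v l y"
        have P: "P \<in> \<P>" using lr l True by (auto simp: \<P>_def P_def T_def)
        have "y \<in> cell v (lv P) (yv P)" using ch[OF P] cell_self[of y v l] P_def by metis
        then have "?pv (lv P) y" using ch[OF P] piv_cong by (metis cell_iff)
        then have "lv P = l" using l by (rule piv_unique)
        then have "h y * indicator T y \<le> h y * indicator {y \<in> P. \<kappa> y \<le> lv P} y"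
          using le by (simp add: P_def indicator_def)
        also have "\<dots> \<le> (\<Sum>P\<in>\<P>. h y * indicator {y \<in> P. \<kappa> y \<le> lv P} y)"
          using P fin by (intro member_le_sum) auto
        finally show ?thesis by (simp add: add_increasing)
      next
        case False
        then show ?thesis by (auto simp: indicator_def intro: add_increasing2)
      qed
      have [measurable]: "?T1 \<in> sets borel"
      proof -
        have "{y \<in> space borel. y \<in> cell v m x0 \<and> \<kappa> y \<le> m \<and> (\<exists>l<\<kappa> y. ?pv l y)} \<in> sets borel" by measurable
        then show ?thesis by simp
      qed
      have PT: "{y \<in> P. \<kappa> y \<le> lv P} \<in> sets borel" if "P \<in> \<P>" for P
      proof -
        have [measurable]: "P \<in> sets borel" using \<P>_sub[OF that] by blast
        have "{y \<in> space borel. y \<in> P \<and> \<kappa> y \<le> lv P} \<in> sets borel" by measurable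
        then show ?thesis by simp
      qed
      have "(\<integral>\<^sup>+y\<in>T. h y \<partial>lborel) \<le>
          (\<integral>\<^sup>+y. h y * indicator ?T1 y + (\<Sum>P\<in>\<P>. h y * indicator {y \<in> P. \<kappa> y \<le> lv P} y) \<partial>lborel)"
        by (intro nn_integral_mono ptw)
      also have "\<dots> = (\<integral>\<^sup>+y\<in>?T1. h y \<partial>lborel) + (\<Sum>P\<in>\<P>. \<integral>\<^sup>+y\<in>{y \<in> P. \<kappa> y \<le> lv P}. h y \<partial>lborel)"
        using PT by (subst nn_integral_add) (auto simp: nn_integral_sum intro!: borel_measurable_sum)
      also have "\<dots> \<le> ennreal (step_const a * ?w (cube v m x0)) + (\<Sum>P\<in>\<P>. ennreal (step_const a * sum ?w (\<S> P)))"
        using step0[of \<alpha>] \<alpha> ch by (intro add_mono sum_mono) (auto simp: measure_cube \<alpha>_def \<beta>_def mult_ac)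
      also have "\<dots> = ennreal (step_const a * ?w (cube v m x0) + (\<Sum>P\<in>\<P>. step_const a * sum ?w (\<S> P)))"
        using step_const_nonneg by (subst sum_ennreal) (auto intro!: ennreal_plus[symmetric] sum_nonneg mult_nonneg_nonneg)
      also have "step_const a * ?w (cube v m x0) + (\<Sum>P\<in>\<P>. step_const a * sum ?w (\<S> P)) =
          step_const a * sum ?w (insert (cube v m x0) (\<Union>P\<in>\<P>. \<S> P))"
        unfolding sum_eq by (simp add: distrib_left sum_distrib_left)
      finally show ?thesis using E' by blast
    qed
  qed
  then show ?case unfolding m_def T_def h_def .
qed

end

section \<open>Linearised maximal function\<close>

lemma floor_add_eq:
  fixes x h :: real
  assumes "of_int n + 1/6 \<le> x" "x \<le> of_int n + 5/6" "\<bar>h\<bar> < 1/6"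
  shows "\<lfloor>x + h\<rfloor> = \<lfloor>x\<rfloor>"
proof -
  have "\<lfloor>x\<rfloor> = n" "\<lfloor>x + h\<rfloor> = n" using assms by (auto intro!: floor_unique)
  then show ?thesis by simp
qed

text \<open>The one-third trick: since \<^term>\<open>2 ^ d\<close> is not divisible by 3, the shifts of a real number by
  one third and by two thirds of \<^term>\<open>2 ^ d\<close> cannot both be close to an integer.\<close>

lemma one_third_trick:
  fixes u :: real
  obtains w :: real where "w \<in> {1, 2}" "\<And>h. \<bar>h\<bar> < 1/6 \<Longrightarrow> \<lfloor>u - w * 2 ^ d / 3 + h\<rfloor> = \<lfloor>u - w * 2 ^ d / 3\<rfloor>"
proof -
  define x where "x = u - 2 ^ d / 3"
  define n where "n = \<lfloor>x\<rfloor>"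
  have n: "of_int n \<le> x" "x < of_int n + 1" by (auto simp: n_def)
  show ?thesis
  proof (cases "of_int n + 1/6 \<le> x \<and> x \<le> of_int n + 5/6")
    case True
    then show ?thesis by (intro that[of 1]) (auto simp: x_def intro: floor_add_eq)
  next
    case False
    have "(2 ^ d :: int) mod 3 = 1 \<or> (2 ^ d :: int) mod 3 = 2"
    proof (induction d)
      case (Suc d)
      then show ?case unfolding power_Suc by presburger
    qed simp
    then obtain c e :: int where ce: "2 ^ d = 3 * c + e" "e = 1 \<or> e = 2"
      by (metis mult_div_mod_eq)
    then have "(of_int (2 ^ d) :: real) = of_int (3 * c + e)" by simp
    then have "(2 ^ d :: real) = 3 * of_int c + of_int e" by simp
    then have x2: "u - 2 * 2 ^ d / 3 = x - of_int c - of_int e / 3"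
      by (simp add: x_def field_simps)
    \<comment> \<open>When \<open>x\<close> is within 1/6 of an integer, subtracting an integer plus
      1/3 or 2/3 moves it to distance at least 1/6 from all integers.\<close>
    have "\<exists>n'. of_int n' + 1/6 \<le> u - 2 * 2 ^ d / 3 \<and> u - 2 * 2 ^ d / 3 \<le> of_int n' + (5/6 :: real)"
    proof (cases "x < of_int n + 1/6")
      case True
      then show ?thesis using n ce(2) unfolding x2 by (intro exI[of _ "n - c - 1"]) auto
    next
      case False
      then show ?thesis using \<open>\<not> (of_int n + 1/6 \<le> x \<and> x \<le> of_int n + 5/6)\<close> n ce(2)
        unfolding x2 by (intro exI[of _ "n - c"]) auto
    qed
    then show ?thesis by (intro that[of 2]) (auto intro: floor_add_eq)
  qed
qed

lemma cube_avg_eq_lp_avg: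
  assumes "h \<in> borel_measurable borel" "S \<in> sets borel" "0 \<le> s"
  shows "cube_avg S (ennreal s) h = ennreal (lp_avg s h S)"
proof -
  have [measurable]: "h \<in> borel_measurable borel" "S \<in> sets borel" by fact+
  have "(LINT y:S|lebesgue. norm (h y) powr s) = (LINT y:S|lborel. norm (h y) powr s)"
    unfolding set_lebesgue_integral_def by (rule integral_completion) measurable
  moreover have "measure lebesgue S = measure lborel S" using assms by simp
  ultimately show ?thesis using assms(3) by (simp add: cube_avg_def lp_avg_def)
qed

lemma two_powr_int: "(2::real) powr of_int (int n) = 2 ^ n"
  by (simp add: powr_realpow)

section \<open>Shifted grids and the bound for a measurable choice of parameter\<close>

context improving
begin

lemma good_fam_le_sparse_sup:
  assumes fam: "good_fam v m0 T \<S> E" and f: "bdd_cpt_fun f" and g: "bdd_cpt_fun g"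
  shows "ennreal (\<Sum>S\<in>\<S>. measure lborel S * lp_avg p f S * lp_avg r g S) \<le> sparse_sup b (ennreal p) (ennreal r) f g"
proof -
  have [measurable]: "f \<in> borel_measurable borel" "g \<in> borel_measurable borel"
    using f g by (auto simp: bdd_cpt_fun_def)
  have meas: "S \<in> sets borel" if "S \<in> \<S>" for S using good_famD[OF fam that] cube_borel by metis
  have sp: "sparse \<S>"
    unfolding sparse_def
  proof (intro exI[of _ E] conjI ballI)
    show "disjoint_family_on E \<S>" using fam by (simp add: good_fam_def)
    fix S assume S: "S \<in> \<S>"
    obtain l x where l: "S = cube v l x" "E S \<in> sets borel" "E S \<subseteq> cell v l x" "vol l / 4 < measure lborel (E S)"
      using good_famD[OF fam S] by metis
    show "E S \<in> sets lebesgue" using l by auto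
    show "E S \<subseteq> S" using l cell_subset_cube by blast
    show "measure lebesgue S / 4 < measure lebesgue (E S)"
      using l measure_cube[of v l x] by simp
  qed
  have dc: "delta_cube b S" if "S \<in> \<S>" for S
    using good_famD[OF fam that] delta_cube_cube by metis
  have "ennreal (\<Sum>S\<in>\<S>. measure lborel S * lp_avg p f S * lp_avg r g S) =
     (\<Sum>S\<in>\<S>. ennreal (measure lebesgue S) * cube_avg S (ennreal p) f * cube_avg S (ennreal r) g)"
    using p r meas
    by (subst sum_ennreal[symmetric]) (auto simp: cube_avg_eq_lp_avg ennreal_mult intro!: sum.cong)
  also have "\<dots> = sparse_form \<S> (ennreal p) (ennreal r) f g"
    unfolding sparse_form_def using fam by (subst infsum_finite) (auto simp: good_fam_def)
  also have "\<dots> \<le> sparse_sup b (ennreal p) (ennreal r) f g"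
    unfolding sparse_sup_def using sp dc by (intro SUP_upper) auto
  finally show ?thesis .
qed

text \<open>Origins shifted in each coordinate by one or two thirds of the side at the top level
  \<open>M\<close>. Measured in sides of a level \<open>k \<le> M\<close> the shift is
  \<open>2 ^ d / 3\<close> or twice that, the form required by \<open>one_third_trick\<close>, so
  the same \<open>2 ^ CARD('n)\<close> grids serve all levels.\<close>

definition grid :: "int \<Rightarrow> ('n \<Rightarrow> bool) \<Rightarrow> real^'n" where
  "grid M \<omega> = (\<chi> j. (if \<omega> j then 2 else 1) * side M j / 3)"

lemma grid_cover:
  assumes "k \<le> M"
  shows "\<exists>\<omega>. \<forall>x. (\<forall>j. \<bar>y $ j - x $ j\<bar> < side k j / 6) \<longrightarrow> same (grid M \<omega>) k y x"
proof -
  have "\<exists>w. \<forall>h. \<bar>h\<bar> < 1/6 \<longrightarrow>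
      \<lfloor>(y $ j - (if w then 2 else 1) * side M j / 3) / side k j + h\<rfloor> = \<lfloor>(y $ j - (if w then 2 else 1) * side M j / 3) / side k j\<rfloor>" for j
  proof -
    obtain d :: nat where d: "side M j = side k j * 2 ^ d" using side_mono_int[OF assms] .
    obtain w :: real where w: "w \<in> {1, 2}" "\<And>h. \<bar>h\<bar> < 1/6 \<Longrightarrow> \<lfloor>y $ j / side k j - w * 2 ^ d / 3 + h\<rfloor> = \<lfloor>y $ j / side k j - w * 2 ^ d / 3\<rfloor>"
      by (rule one_third_trick[of "y $ j / side k j" d]) (rule that)
    have "(y $ j - w * side M j / 3) / side k j = y $ j / side k j - w * 2 ^ d / 3"
      by (simp add: d diff_divide_distrib)
    then show ?thesis using w by (intro exI[of _ "w = 2"]) auto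
  qed
  then obtain \<omega> where \<omega>: "\<And>j h. \<bar>h\<bar> < 1/6 \<Longrightarrow>
      \<lfloor>(y $ j - grid M \<omega> $ j) / side k j + h\<rfloor> = \<lfloor>(y $ j - grid M \<omega> $ j) / side k j\<rfloor>"
    unfolding grid_def vec_lambda_beta by metis
  show ?thesis
  proof (intro exI allI impI)
    fix x assume x: "\<forall>j. \<bar>y $ j - x $ j\<bar> < side k j / 6"
    show "same (grid M \<omega>) k y x"
      unfolding same_def
    proof
      fix j
      have "\<bar>(x $ j - y $ j) / side k j\<bar> < 1 / 6"
        using spec[OF x, of j] by (simp add: abs_minus_commute pos_divide_less_eq)
      from \<omega>[OF this, of j] show "\<lfloor>(y $ j - grid M \<omega> $ j) / side k j\<rfloor> = \<lfloor>(x $ j - grid M \<omega> $ j) / side k j\<rfloor>"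
        by (simp add: add_divide_distrib[symmetric])
    qed
  qed
qed

text \<open>No grid plane of the top level comes closer to 0 than a third of the side, so in every
  grid the top cell of 0 contains a fixed box.\<close>

lemma grid_top:
  assumes "\<And>j. \<bar>x $ j\<bar> < side M j / 3"
  shows "x \<in> cell (grid M \<omega>) M 0"
  unfolding cell_iff same_def
proof
  fix j
  define w :: real where "w = (if \<omega> j then 2 else 1)"
  have w: "w = 1 \<or> w = 2" by (simp add: w_def)
  have "\<lfloor>(y - grid M \<omega> $ j) / side M j\<rfloor> = -1" if "\<bar>y\<bar> < side M j / 3" for y
  proof -
    have "\<bar>y / side M j\<bar> < 1/3" using that by (simp add: pos_divide_less_eq)
    moreover have "(y - grid M \<omega> $ j) / side M j = y / side M j - w / 3"
      by (simp add: grid_def w_def diff_divide_distrib)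
    ultimately have "-1 \<le> (y - grid M \<omega> $ j) / side M j" "(y - grid M \<omega> $ j) / side M j < 0"
      using w by linarith+
    then show ?thesis by (intro floor_unique) simp_all
  qed
  from this[of 0] this[OF assms[of j]]
  show "\<lfloor>((0::real^'n) $ j - grid M \<omega> $ j) / side M j\<rfloor> = \<lfloor>(x $ j - grid M \<omega> $ j) / side M j\<rfloor>"
    by simp
qed

text \<open>Number of levels by which the cell must exceed the parameter for the distance
  \<open>R * t powr b j\<close> to stay below one sixth of the side. The extra 1 pays for parameters
  up to twice a power of 2.\<close>

definition reach :: int where "reach = 1 + int (nat \<lceil>6 * \<bar>R\<bar>\<rceil>)"

lemma reach: "6 * R < 2 powr of_int (reach - 1)"
proof -
  have "6 * R \<le> real (nat \<lceil>6 * \<bar>R\<bar>\<rceil>)" by linarith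
  also have "\<dots> < 2 ^ nat \<lceil>6 * \<bar>R\<bar>\<rceil>" by (rule of_nat_less_two_power)
  also have "\<dots> = 2 powr of_int (int (nat \<lceil>6 * \<bar>R\<bar>\<rceil>))" by (rule two_powr_int[symmetric])
  also have "int (nat \<lceil>6 * \<bar>R\<bar>\<rceil>) = reach - 1" by (simp only: reach_def)
  finally show ?thesis .
qed

lemma reach_side:
  assumes "0 < t" "t \<le> 2 * 2 powr of_int (k - reach)"
  shows "R * t powr b j < side k j / 6"
proof (cases "R \<le> 0")
  case True
  then have "R * t powr b j \<le> 0" by (intro mult_nonpos_nonneg) auto
  also have "0 < side k j / 6" by simp
  finally show ?thesis .
next
  case False
  let ?e = "2 powr (of_int (k - reach + 1)) :: real"
  have "t \<le> ?e" using assms by (simp add: powr_add)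
  then have "t powr b j \<le> ?e powr b j" using assms b_ge[of j] by (intro powr_mono2) auto
  then have "6 * R * t powr b j \<le> 6 * R * ?e powr b j" using False by (intro mult_left_mono) auto
  also have "\<dots> < 2 powr of_int (reach - 1) * ?e powr b j"
    by (intro mult_strict_right_mono reach) auto
  also have "\<dots> \<le> 2 powr (of_int (reach - 1) * b j) * ?e powr b j"
    using b_ge[of j] by (intro mult_right_mono powr_mono) (auto simp: reach_def mult_le_cancel_left1)
  also have "\<dots> = 2 powr (of_int k * b j)"
    by (simp add: powr_powr powr_add[symmetric] algebra_simps)
  also have "\<dots> \<le> side k j" by (rule side_ge)
  finally show ?thesis by simp
qed

text \<open>Each point uses the level \<open>\<kappa> y\<close> fitting its parameter and a grid in
  which its cell contains everything the average sees; summing over all grids gives the factor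
  \<open>2 ^ CARD('n)\<close>. The bounds \<open>lo\<close> and \<open>hi\<close> keep the number of
  levels finite, and the constant is independent of them.\<close>

lemma core_bound:
  assumes f: "bdd_cpt_fun f" and g: "bdd_cpt_fun g"
    and \<tau> [measurable]: "\<tau> \<in> borel_measurable borel" and lo: "0 < lo" and \<tau>_range: "\<And>y. lo \<le> \<tau> y \<and> \<tau> y \<le> hi"
  shows "(\<integral>\<^sup>+y. ennreal (norm (A (\<tau> y) f y) * norm (g y)) \<partial>lborel) \<le>
    ennreal (2 ^ CARD('n) * step_const reach) * sparse_sup b (ennreal p) (ennreal r) f g"
proof -
  have [measurable]: "f \<in> borel_measurable borel" "g \<in> borel_measurable borel"
    using f g by (auto simp: bdd_cpt_fun_def)
  define \<kappa> where "\<kappa> y = \<lfloor>log 2 (\<tau> y)\<rfloor> + reach" for y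
  have [measurable]: "\<kappa> \<in> measurable borel (count_space UNIV)"
  proof -
    have [measurable]: "(\<lambda>y. \<lfloor>log 2 (\<tau> y)\<rfloor>) \<in> measurable borel (count_space UNIV)" by measurable
    show ?thesis unfolding \<kappa>_def by measurable
  qed
  have \<tau>_pos: "0 < \<tau> y" for y using \<tau>_range[of y] lo by linarith
  have \<kappa>_range: "2 powr of_int (\<kappa> y - reach) \<le> \<tau> y \<and> \<tau> y \<le> 2 * 2 powr of_int (\<kappa> y - reach)" for y
  proof -
    have "2 powr of_int \<lfloor>log 2 (\<tau> y)\<rfloor> \<le> 2 powr log 2 (\<tau> y)" by (intro powr_mono) auto
    moreover have "2 powr log 2 (\<tau> y) \<le> 2 powr (of_int \<lfloor>log 2 (\<tau> y)\<rfloor> + 1)" by (intro powr_mono) linarith+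
    ultimately show ?thesis using \<tau>_pos[of y] by (simp add: \<kappa>_def powr_add)
  qed
  define m0 where "m0 = \<lfloor>log 2 lo\<rfloor> + reach"
  have \<kappa>_ge: "m0 \<le> \<kappa> y" for y
    unfolding m0_def \<kappa>_def using \<tau>_range[of y] lo by (intro add_mono floor_mono) auto
  obtain \<rho> where \<rho>: "\<And>x. g x \<noteq> 0 \<Longrightarrow> norm x \<le> \<rho>"
    using g unfolding bdd_cpt_fun_iff bounded_iff by auto
  \<comment> \<open>Above all scales in use, and large enough for the top cell of 0 to contain the
    support of \<open>g\<close> in every grid.\<close>
  define M where "M = max (max m0 (\<lfloor>log 2 hi\<rfloor> + reach)) (int (nat \<lceil>3 * \<bar>\<rho>\<bar>\<rceil>))"
  have \<kappa>_le: "\<kappa> y \<le> M" for y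
  proof -
    have "\<kappa> y \<le> \<lfloor>log 2 hi\<rfloor> + reach"
      unfolding \<kappa>_def using \<tau>_range[of y] \<tau>_pos[of y] by (intro add_mono floor_mono) auto
    then show ?thesis by (simp add: M_def)
  qed
  have top: "y \<in> cell (grid M \<omega>) M 0" if "g y \<noteq> 0" for y \<omega>
  proof (rule grid_top)
    fix j
    have "\<bar>y $ j\<bar> \<le> \<bar>\<rho>\<bar>" using component_le_norm_cart[of y j] \<rho>[OF that] by linarith
    then have "3 * \<bar>y $ j\<bar> \<le> real (nat \<lceil>3 * \<bar>\<rho>\<bar>\<rceil>)" by linarith
    also have "\<dots> < 2 ^ nat \<lceil>3 * \<bar>\<rho>\<bar>\<rceil>" by (rule of_nat_less_two_power)
    also have "\<dots> = 2 powr of_int (int (nat \<lceil>3 * \<bar>\<rho>\<bar>\<rceil>))" by (rule two_powr_int[symmetric])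
    also have "\<dots> \<le> 2 powr (of_int M * b j)"
    proof (intro powr_mono)
      have 1: "int (nat \<lceil>3 * \<bar>\<rho>\<bar>\<rceil>) \<le> M" unfolding M_def by (rule max.cobounded2)
      then have "0 \<le> M" by linarith
      note this 1
      then have "of_int (int (nat \<lceil>3 * \<bar>\<rho>\<bar>\<rceil>)) \<le> (of_int M :: real)" "0 \<le> (of_int M :: real)"
        by (simp_all only: of_int_le_iff of_int_0_le_iff)
      moreover have "(of_int M :: real) * 1 \<le> of_int M * b j"
        using b_ge[of j] \<open>0 \<le> M\<close> by (intro mult_left_mono) auto
      ultimately show "of_int (int (nat \<lceil>3 * \<bar>\<rho>\<bar>\<rceil>)) \<le> of_int M * b j" by linarith
    qed simp
    also have "\<dots> \<le> side M j" by (rule side_ge)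
    finally show "\<bar>y $ j\<bar> < side M j / 3" by simp
  qed
  define I where "I \<omega> = (\<integral>\<^sup>+y\<in>{y \<in> cell (grid M \<omega>) M 0. \<kappa> y \<le> M}.
      ennreal (norm (loc \<tau> f (grid M \<omega>) \<kappa> y) * norm (g y)) \<partial>lborel)" for \<omega>
  have I_le: "I \<omega> \<le> ennreal (step_const reach) * sparse_sup b (ennreal p) (ennreal r) f g" for \<omega>
  proof -
    have M: "m0 - 1 + int (nat (M - m0 + 1)) = M" by (simp add: M_def)
    obtain \<S> E where fam: "good_fam (grid M \<omega>) m0 (cell (grid M \<omega>) M 0) \<S> E"
      and le: "I \<omega> \<le> ennreal (step_const reach * (\<Sum>S\<in>\<S>. measure lborel S * lp_avg p f S * lp_avg r g S))"
      using sparse_family[OF f g \<tau> _ \<kappa>_range \<kappa>_ge, of "grid M \<omega>" "nat (M - m0 + 1)" 0]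
      unfolding I_def M by auto
    note le
    also have "ennreal (step_const reach * (\<Sum>S\<in>\<S>. measure lborel S * lp_avg p f S * lp_avg r g S)) =
        ennreal (step_const reach) * ennreal (\<Sum>S\<in>\<S>. measure lborel S * lp_avg p f S * lp_avg r g S)"
      using step_const_nonneg by (intro ennreal_mult) (auto intro!: sum_nonneg)
    also have "\<dots> \<le> ennreal (step_const reach) * sparse_sup b (ennreal p) (ennreal r) f g"
      by (intro mult_left_mono good_fam_le_sparse_sup[OF fam f g]) simp
    finally show ?thesis .
  qed
  have [measurable]: "loc \<tau> f v \<kappa> \<in> borel_measurable borel" for v by (rule loc_meas) measurable
  have set_meas [measurable]: "{y \<in> cell v M 0. \<kappa> y \<le> M} \<in> sets borel" for v
  proof -
    have "{y \<in> space borel. y \<in> cell v M 0 \<and> \<kappa> y \<le> M} \<in> sets borel" by measurable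
    then show ?thesis by simp
  qed
  have "(\<integral>\<^sup>+y. ennreal (norm (A (\<tau> y) f y) * norm (g y)) \<partial>lborel) \<le>
    (\<integral>\<^sup>+y. (\<Sum>\<omega>\<in>UNIV. ennreal (norm (loc \<tau> f (grid M \<omega>) \<kappa> y) * norm (g y)) * indicator {y \<in> cell (grid M \<omega>) M 0. \<kappa> y \<le> M} y) \<partial>lborel)"
  proof (intro nn_integral_mono)
    fix y
    show "ennreal (norm (A (\<tau> y) f y) * norm (g y)) \<le>
       (\<Sum>\<omega>\<in>UNIV. ennreal (norm (loc \<tau> f (grid M \<omega>) \<kappa> y) * norm (g y)) * indicator {y \<in> cell (grid M \<omega>) M 0. \<kappa> y \<le> M} y)"
    proof (cases "g y = 0")
      case False
      obtain \<omega> where \<omega>: "\<forall>x. (\<forall>j. \<bar>y $ j - x $ j\<bar> < side (\<kappa> y) j / 6) \<longrightarrow> same (grid M \<omega>) (\<kappa> y) y x"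
        using grid_cover[OF \<kappa>_le[of y], of y] by blast
      have "A (\<tau> y) f y = loc \<tau> f (grid M \<omega>) \<kappa> y"
        unfolding loc_def
      proof (rule A_local)
        fix u assume u: "\<And>j. \<bar>y $ j - u $ j\<bar> \<le> R * \<tau> y powr b j"
        have "same (grid M \<omega>) (\<kappa> y) y u"
          using \<omega> u reach_side[OF \<tau>_pos[of y]] \<kappa>_range[of y] by (meson le_less_trans)
        then show "f u = (if same (grid M \<omega>) (\<kappa> y) y u then f u else 0)" by simp
      qed
      then have "ennreal (norm (A (\<tau> y) f y) * norm (g y)) =
        ennreal (norm (loc \<tau> f (grid M \<omega>) \<kappa> y) * norm (g y)) * indicator {y \<in> cell (grid M \<omega>) M 0. \<kappa> y \<le> M} y"
        using top[OF False, of \<omega>] \<kappa>_le by simp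
      also have "\<dots> \<le> (\<Sum>\<omega>\<in>UNIV. ennreal (norm (loc \<tau> f (grid M \<omega>) \<kappa> y) * norm (g y)) * indicator {y \<in> cell (grid M \<omega>) M 0. \<kappa> y \<le> M} y)"
        by (rule member_le_sum) auto
      finally show ?thesis .
    qed simp
  qed
  also have "\<dots> = (\<Sum>\<omega>\<in>UNIV. I \<omega>)"
    unfolding I_def by (rule nn_integral_sum) measurable
  also have "\<dots> \<le> (\<Sum>\<omega>\<in>(UNIV :: ('n \<Rightarrow> bool) set). ennreal (step_const reach) * sparse_sup b (ennreal p) (ennreal r) f g)"
    by (intro sum_mono I_le)
  also have "\<dots> = ennreal (2 ^ CARD('n) * step_const reach) * sparse_sup b (ennreal p) (ennreal r) f g"
    using step_const_nonneg
    by (simp add: card_fun ennreal_mult ennreal_power mult.assoc ennreal_of_nat_eq_real_of_nat)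
  finally show ?thesis .
qed

end

section \<open>Regularity in the dilation parameter\<close>

lemma lebesgue_shift:
  fixes a :: "'a::euclidean_space"
  shows "lebesgue = distr lebesgue lebesgue ((+) a)" "(+) a \<in> lebesgue \<rightarrow>\<^sub>M lebesgue"
proof -
  have "(\<lambda>x. a + (\<Sum>j\<in>Basis. (1 * (x \<bullet> j)) *\<^sub>R j)) = (+) a"
    by (simp add: euclidean_representation fun_eq_iff)
  then show "lebesgue = distr lebesgue lebesgue ((+) a)" "(+) a \<in> lebesgue \<rightarrow>\<^sub>M lebesgue"
    using lebesgue_affine_euclidean[of "\<lambda>_. 1" a] lebesgue_affine_measurable[of "\<lambda>_. 1" a]
    by (simp_all add: density_1)
qed

text \<open>The supremum over the dilation parameter is known to be Lebesgue measurable only, so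
  translations are needed for the completed measure.\<close>

lemma nn_integral_translate_lebesgue:
  fixes a :: "'a::euclidean_space"
  assumes h: "h \<in> borel_measurable lebesgue"
  shows "(\<integral>\<^sup>+x. h (x + a) \<partial>lebesgue) = (\<integral>\<^sup>+x. h x \<partial>lebesgue)"
    "(\<lambda>x. h (x + a)) \<in> borel_measurable lebesgue"
proof -
  have "(\<integral>\<^sup>+x. h x \<partial>lebesgue) = (\<integral>\<^sup>+x. h x \<partial>distr lebesgue lebesgue ((+) a))"
    using lebesgue_shift(1)[of a] by simp
  also have "\<dots> = (\<integral>\<^sup>+x. h (a + x) \<partial>lebesgue)"
    by (rule nn_integral_distr[OF lebesgue_shift(2)]) (simp add: h)
  finally show "(\<integral>\<^sup>+x. h (x + a) \<partial>lebesgue) = (\<integral>\<^sup>+x. h x \<partial>lebesgue)" by (simp add: add.commute)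
  show "(\<lambda>x. h (x + a)) \<in> borel_measurable lebesgue"
    using measurable_compose[OF lebesgue_shift(2) h, of a] by (simp add: add.commute)
qed

text \<open>A measurable function is an almost everywhere limit of continuous ones; clipping their
  values and cutting off near the support of \<open>f\<close> makes dominated convergence
  applicable. All supports stay in one ball, so later a single number of telescoping steps serves
  every approximant.\<close>

lemma continuous_approx:
  fixes f :: "'a::euclidean_space \<Rightarrow> complex"
  assumes f: "bdd_cpt_fun f" and p: "0 < p" and \<rho>: "\<And>x. f x \<noteq> 0 \<Longrightarrow> norm x \<le> \<rho>" and e: "0 < e"
  obtains g where "continuous_on UNIV g" "bdd_cpt_fun g" "\<And>x. g x \<noteq> 0 \<Longrightarrow> norm x \<le> \<rho> + 1"
    "(LINT x|lborel. norm (f x - g x) powr p) < e"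
proof -
  have [measurable]: "f \<in> borel_measurable borel" using f by (simp add: bdd_cpt_fun_def)
  obtain c where c: "\<And>x. norm (f x) \<le> c" "c > 0"
    using bdd_borel_bound f bdd_cpt_fun_iff by blast
  have "f \<in> borel_measurable lebesgue" by (simp add: measurable_completion)
  then have "f measurable_on UNIV"
    by (subst measurable_on_iff_borel_measurable) (auto simp: lebesgue_on_UNIV_eq)
  then obtain N gg where N: "negligible N" and gg: "\<And>n. continuous_on UNIV (gg n)"
    and lim: "\<And>x. x \<notin> N \<Longrightarrow> (\<lambda>n. gg n x) \<longlonglongrightarrow> f x"
    unfolding measurable_on_def by auto
  define cut where "cut x = max 0 (min 1 (\<rho> + 1 - norm x))" for x :: 'a
  define clip where "clip w = (c / max c (norm w)) *\<^sub>R w" for w :: complex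
  have clip_le: "norm (clip w) \<le> c" for w
    using c(2) by (auto simp: clip_def divide_simps max_def)
  have clip_id: "clip w = w" if "norm w \<le> c" for w
    using that c(2) by (simp add: clip_def max_def)
  have clip_cont: "continuous_on UNIV clip"
    unfolding clip_def using c(2) by (intro continuous_intros) (auto simp: max_def)
  define h where "h n x = of_real (cut x) * clip (gg n x)" for n x
  have cut: "0 \<le> cut x" "cut x \<le> 1" for x by (auto simp: cut_def)
  have h_cont: "continuous_on UNIV (h n)" for n
    unfolding h_def cut_def
    by (intro continuous_intros continuous_on_compose2[OF clip_cont gg]) auto
  have h_supp: "norm x \<le> \<rho> + 1" if "h n x \<noteq> 0" for n x
    using that by (auto simp: h_def cut_def max_def split: if_splits)
  have h_le: "norm (h n x) \<le> c" for n x
    using mult_mono[OF cut(2)[of x] clip_le[of "gg n x"]] cut(1)[of x] by (simp add: h_def norm_mult)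
  have h_bdd: "bdd_cpt_fun (h n)" for n
    unfolding bdd_cpt_fun_iff
  proof
    show "bdd_borel (h n)" using h_cont h_le by (intro bdd_borelI borel_measurable_continuous_onI)
    show "bounded {x. h n x \<noteq> 0}" using h_supp unfolding bounded_iff by blast
  qed
  have [measurable]: "h n \<in> borel_measurable borel" for n using h_bdd by (simp add: bdd_cpt_fun_def)
  have h_lim: "(\<lambda>n. h n x) \<longlonglongrightarrow> f x" if "x \<notin> N" for x
  proof -
    have "isCont clip (f x)" using clip_cont by (simp add: continuous_on_eq_continuous_at)
    then have "(\<lambda>n. h n x) \<longlonglongrightarrow> of_real (cut x) * clip (f x)"
      unfolding h_def by (intro tendsto_intros isCont_tendsto_compose[where g = clip] lim[OF that])
    moreover have "of_real (cut x) * clip (f x) = f x"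
    proof (cases "f x = 0")
      case True then show ?thesis by (simp add: clip_def)
    next
      case False
      then have "cut x = 1" using \<rho>[OF False] by (simp add: cut_def)
      then show ?thesis using clip_id[OF c(1)] by simp
    qed
    ultimately show ?thesis by simp
  qed
  have "(\<lambda>n. LINT x|lborel. norm (f x - h n x) powr p) \<longlonglongrightarrow> (LINT x|(lborel :: 'a measure). 0)"
  proof (rule integral_dominated_convergence)
    show "integrable lborel (\<lambda>x. (2 * c) powr p * indicator (cball 0 (\<rho> + 1)) x :: real)"
      using emeasure_compact_finite[OF compact_cball, of 0 "\<rho> + 1"] by (intro integrable_mult_right integrable_real_indicator) auto
    show "AE x in lborel. (\<lambda>n. norm (f x - h n x) powr p) \<longlonglongrightarrow> 0"
    proof -
      have "AE x in lebesgue. x \<notin> N" using N by (auto simp: negligible_iff_null_sets intro: AE_not_in)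
      then have "AE x in lborel. x \<notin> N" by (simp add: AE_completion_iff)
      then show ?thesis
      proof eventually_elim
        case (elim x)
        have "(\<lambda>n. norm (f x - h n x)) \<longlonglongrightarrow> norm (f x - f x)"
          by (intro tendsto_intros h_lim elim)
        then show ?case using p by (intro tendsto_zero_powrI[where b = p] tendsto_const) auto
      qed
    qed
    fix n
    show "AE x in lborel. norm (norm (f x - h n x) powr p) \<le> (2 * c) powr p * indicator (cball 0 (\<rho> + 1)) x"
    proof (rule AE_I2)
      fix x :: 'a
      show "norm (norm (f x - h n x) powr p) \<le> (2 * c) powr p * indicator (cball 0 (\<rho> + 1)) x"
      proof (cases "norm x \<le> \<rho> + 1")
        case True
        have "norm (f x - h n x) \<le> 2 * c"
          using norm_triangle_ineq4[of "f x" "h n x"] c(1)[of x] h_le[of n x] by linarith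
        then show ?thesis using True p by (simp add: powr_mono2)
      next
        case False
        then have "f x = 0" "h n x = 0" using \<rho>[of x] h_supp[of n x] by force+
        then show ?thesis by simp
      qed
    qed
  qed measurable
  then have "\<forall>\<^sub>F n in sequentially. (LINT x|lborel. norm (f x - h n x) powr p) < e"
    using e by (intro order_tendstoD) auto
  then obtain n where "(LINT x|lborel. norm (f x - h n x) powr p) < e"
    by (auto simp: eventually_sequentially)
  then show ?thesis using that[of "h n"] h_cont h_bdd h_supp by blast
qed

section \<open>From differences of translates to the local maximal operator\<close>

context averaging
begin

definition lds :: "real^'n \<Rightarrow> (real^'n \<Rightarrow> complex) \<Rightarrow> real^'n \<Rightarrow> real" where
  "lds z f y = (SUP t\<in>{1..2}. norm (A t f y - A t f (y - z)))"

lemma A_bound: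
  assumes "bdd_borel f"
  obtains c where "0 \<le> c" "\<And>t y. norm (A t f y) \<le> c"
proof -
  obtain c where c: "\<forall>x. norm (f x) \<le> c" "c > 0" using bdd_borel_bound assms by blast
  show ?thesis by (rule that[of "c * mass"]) (use c A_norm_le[of f c] in auto)
qed

lemma lds_bdd_above:
  assumes "bdd_borel f"
  shows "bdd_above ((\<lambda>t. norm (A t f y - A t f (y - z))) ` {1..2})"
proof -
  obtain c where c: "\<And>t y. norm (A t f y) \<le> c" using A_bound assms by blast
  have "norm (A t f y - A t f (y - z)) \<le> c + c" for t
    using norm_triangle_ineq4[of "A t f y" "A t f (y - z)"] c[of t y] c[of t "y - z"] by linarith
  then show ?thesis by (intro bdd_aboveI2[where M = "c + c"]) auto
qed

lemma lds_upper:
  assumes "bdd_borel f" "1 \<le> t" "t \<le> 2"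
  shows "norm (A t f y - A t f (y - z)) \<le> lds z f y"
  unfolding lds_def using assms by (intro cSUP_upper lds_bdd_above) auto

lemma lds_nonneg:
  assumes "bdd_borel f"
  shows "0 \<le> lds z f y"
  using order_trans[OF norm_ge_zero lds_upper[OF assms, of 1 y z]] by simp

text \<open>How far averages with parameters up to 2 can enlarge a support.\<close>

definition ext :: real where "ext = (\<Sum>j\<in>UNIV. \<bar>R\<bar> * 2 powr b j)"

lemma A_support:
  assumes f: "\<And>x. f x \<noteq> 0 \<Longrightarrow> norm x \<le> \<rho>" and t: "0 \<le> t" "t \<le> 2" and y: "\<rho> + ext < norm y"
  shows "A t f y = 0"
proof -
  have "f (y - dilate b t (\<Psi> x)) = 0" for x
  proof (rule ccontr)
    assume "f (y - dilate b t (\<Psi> x)) \<noteq> 0"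
    then have "norm (y - dilate b t (\<Psi> x)) \<le> \<rho>" by (rule f)
    moreover have "norm (dilate b t (\<Psi> x)) \<le> ext"
    proof -
      have "norm (dilate b t (\<Psi> x)) \<le> (\<Sum>j\<in>UNIV. \<bar>dilate b t (\<Psi> x) $ j\<bar>)" by (rule norm_le_l1_cart)
      also have "\<dots> \<le> ext"
        unfolding ext_def
      proof (rule sum_mono)
        fix j
        have "t powr b j \<le> 2 powr b j" using t b_ge[of j] by (intro powr_mono2) auto
        then have "t powr b j * \<bar>\<Psi> x $ j\<bar> \<le> 2 powr b j * \<bar>R\<bar>"
          using Psi_bound[of x j] by (intro mult_mono) auto
        then show "\<bar>dilate b t (\<Psi> x) $ j\<bar> \<le> \<bar>R\<bar> * 2 powr b j" by (simp add: abs_mult mult.commute)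
      qed
      finally show ?thesis .
    qed
    ultimately show False using y norm_triangle_ineq[of "y - dilate b t (\<Psi> x)" "dilate b t (\<Psi> x)"] by simp
  qed
  then show ?thesis by (simp add: A_def)
qed

text \<open>If \<open>y\<close> lies where the average may be nonzero, then \<open>m\<close> unit
  steps lead to a point where it vanishes. The telescoping sum of differences thus controls the
  average itself, uniformly in \<open>t\<close>.\<close>

lemma telescope:
  assumes f: "bdd_borel f" "\<And>x. f x \<noteq> 0 \<Longrightarrow> norm x \<le> \<rho>" and z: "norm z = 1" and m: "2 * (\<rho> + ext) < real m"
    and t: "1 \<le> t" "t \<le> 2"
  shows "norm (A t f y) \<le> (\<Sum>i<m. lds z f (y - real i *\<^sub>R z))"
proof (cases "\<rho> + ext < norm y")
  case True
  then have "A t f y = 0" using t by (intro A_support[OF f(2)]) auto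
  then show ?thesis using lds_nonneg[OF f(1)] by (simp add: sum_nonneg)
next
  case False
  have "real m \<le> norm (y - real m *\<^sub>R z) + norm y"
    using norm_triangle_ineq4[of y "y - real m *\<^sub>R z"] z by simp
  then have zero: "A t f (y - real m *\<^sub>R z) = 0"
    using False m t f(2) by (intro A_support[where \<rho> = \<rho>]) auto
  have eqk: "A t f y - A t f (y - real k *\<^sub>R z) =
      (\<Sum>i<k. A t f (y - real i *\<^sub>R z) - A t f (y - real i *\<^sub>R z - z))" for k
  proof (induction k)
    case (Suc k)
    have eq: "y - real (Suc k) *\<^sub>R z = y - real k *\<^sub>R z - z" by (simp add: scaleR_left_distrib)
    show ?case unfolding eq using Suc by (simp add: diff_eq_eq)
  qed simp
  have "norm (A t f y) = norm (\<Sum>i<m. A t f (y - real i *\<^sub>R z) - A t f (y - real i *\<^sub>R z - z))"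
    using eqk[of m] zero by simp
  also have "\<dots> \<le> (\<Sum>i<m. norm (A t f (y - real i *\<^sub>R z) - A t f (y - real i *\<^sub>R z - z)))" by (rule norm_sum)
  also have "\<dots> \<le> (\<Sum>i<m. lds z f (y - real i *\<^sub>R z))"
    using t by (intro sum_mono lds_upper f) auto
  finally show ?thesis .
qed

lemma A_continuous:
  assumes g: "continuous_on UNIV g" "bdd_borel g" and S: "S \<subseteq> {0<..}"
  shows "continuous_on S (\<lambda>t. A t g y)"
proof (rule continuous_on_sequentiallyI)
  fix u t assume u: "\<forall>n. u n \<in> S" "t \<in> S" "u \<longlonglongrightarrow> t"
  obtain c where c: "\<forall>x. norm (g x) \<le> c" "c > 0" using bdd_borel_bound g by blast
  have [measurable]: "g \<in> borel_measurable borel" using g by (auto dest: bdd_borelD)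
  have t: "0 < t" using u S by auto
  show "(\<lambda>n. A (u n) g y) \<longlonglongrightarrow> A t g y"
    unfolding A_def
  proof (rule integral_dominated_convergence[where w = "\<lambda>_. c"])
    show "AE x in \<nu>. (\<lambda>n. g (y - dilate b (u n) (\<Psi> x)) * complex_of_real (sg x)) \<longlonglongrightarrow> g (y - dilate b t (\<Psi> x)) * complex_of_real (sg x)"
    proof (rule AE_I2)
      fix x
      have "(\<lambda>n. dilate b (u n) (\<Psi> x)) \<longlonglongrightarrow> dilate b t (\<Psi> x)"
        unfolding dilate_def using u(3) t by (intro tendsto_vec_lambda tendsto_intros) auto
      then have "(\<lambda>n. y - dilate b (u n) (\<Psi> x)) \<longlonglongrightarrow> y - dilate b t (\<Psi> x)"
        by (intro tendsto_intros)
      then have "(\<lambda>n. g (y - dilate b (u n) (\<Psi> x))) \<longlonglongrightarrow> g (y - dilate b t (\<Psi> x))"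
        using g(1) by (intro isCont_tendsto_compose[where g = g]) (auto simp: continuous_on_eq_continuous_at)
      then show "(\<lambda>n. g (y - dilate b (u n) (\<Psi> x)) * complex_of_real (sg x)) \<longlonglongrightarrow> g (y - dilate b t (\<Psi> x)) * complex_of_real (sg x)"
        by (intro tendsto_intros)
    qed
    fix n
    show "AE x in \<nu>. norm (g (y - dilate b (u n) (\<Psi> x)) * complex_of_real (sg x)) \<le> c"
    proof (rule AE_I2)
      fix x
      show "norm (g (y - dilate b (u n) (\<Psi> x)) * complex_of_real (sg x)) \<le> c"
        using mult_mono[of "norm (g (y - dilate b (u n) (\<Psi> x)))" c "\<bar>sg x\<bar>" 1] c sg_bound[of x] by (simp add: norm_mult)
    qed
  qed (auto, measurable)
qed

end

text \<open>Local continuity for a single pair of exponents, with no order between them yet: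
  \<open>p \<le> q\<close> leads on to \<open>improving\<close>, and \<open>q < p\<close> is left to
  \<open>lds_vanish\<close>.\<close>

locale loccont = averaging \<nu> \<Psi> sg b R
  for \<nu> :: "'x measure" and \<Psi> :: "'x \<Rightarrow> real^'n::finite" and sg b R +
  fixes p q \<epsilon> C :: real
  assumes p: "1 < p" and q: "1 < q" and eps: "0 < \<epsilon>"
    and lc_int: "\<And>z f. norm z \<le> 1 \<Longrightarrow> bdd_cpt_fun f \<Longrightarrow> integrable lebesgue (\<lambda>y. lds z f y powr q)"
    and lc: "\<And>z f. norm z \<le> 1 \<Longrightarrow> bdd_cpt_fun f \<Longrightarrow> Lp_norm q (lds z f) \<le> C * norm z powr \<epsilon> * Lp_norm p f"
begin

text \<open>A supremum over uncountably many parameters; its measurability is extracted from the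
  integrability of its q-th power.\<close>

lemma lds_meas:
  assumes "norm z \<le> 1" "bdd_cpt_fun f"
  shows "lds z f \<in> borel_measurable lebesgue"
proof -
  have [measurable]: "(\<lambda>y. lds z f y powr q) \<in> borel_measurable lebesgue"
    using lc_int[OF assms] by auto
  have "lds z f y = (lds z f y powr q) powr (1 / q)" for y
    using lds_nonneg[of f z y] assms q by (simp add: powr_powr bdd_cpt_fun_iff)
  then have "lds z f = (\<lambda>y. (lds z f y powr q) powr (1 / q))" by auto
  also have "\<dots> \<in> borel_measurable lebesgue" by measurable
  finally show ?thesis .
qed

lemma lds_nn:
  assumes z: "norm z \<le> 1" and f: "bdd_cpt_fun f" and Y: "0 \<le> Y" "(\<integral>\<^sup>+y. ennreal (norm (f y) powr p) \<partial>lborel) \<le> ennreal Y"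
  shows "(\<integral>\<^sup>+y. ennreal (lds z f y powr q) \<partial>lebesgue) \<le> ennreal (\<bar>C\<bar> powr q * norm z powr (\<epsilon> * q) * Y powr (q / p))"
proof -
  have [measurable]: "f \<in> borel_measurable borel" using f by (simp add: bdd_cpt_fun_def)
  define X where "X = (LINT y|lebesgue. lds z f y powr q)"
  have X: "0 \<le> X" unfolding X_def by (intro integral_nonneg_AE AE_I2) auto
  have nX: "(\<integral>\<^sup>+y. ennreal (lds z f y powr q) \<partial>lebesgue) = ennreal X"
    unfolding X_def by (intro nn_integral_eq_integral lc_int z f) auto
  define F where "F = (LINT y|lborel. norm (f y) powr p)"
  have F0: "0 \<le> F" unfolding F_def by (intro integral_nonneg_AE AE_I2) auto
  have "ennreal F = (\<integral>\<^sup>+y. ennreal (norm (f y) powr p) \<partial>lborel)"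
    unfolding F_def using p by (intro nn_integral_eq_integral[symmetric] bdd_cpt_fun_powr_integrable f) auto
  then have "ennreal F \<le> ennreal Y" using Y(2) by (simp only:)
  then have FY: "F \<le> Y" using Y(1) by simp
  have "Lp_norm q (lds z f) = X powr (1 / q)"
  proof -
    have "norm (lds z f y) = lds z f y" for y using lds_nonneg[of f z y] f by (simp add: bdd_cpt_fun_iff)
    then show ?thesis by (simp add: Lp_norm_def X_def)
  qed
  moreover have "Lp_norm p f = F powr (1 / p)"
    unfolding Lp_norm_def F_def by (subst integral_completion) auto
  ultimately have "X powr (1 / q) \<le> C * norm z powr \<epsilon> * F powr (1 / p)"
    using lc[OF z f] by simp
  also have "\<dots> \<le> \<bar>C\<bar> * norm z powr \<epsilon> * Y powr (1 / p)"
    using FY F0 p by (intro mult_mono[OF mult_right_mono powr_mono2]) auto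
  finally have "(X powr (1 / q)) powr q \<le> (\<bar>C\<bar> * norm z powr \<epsilon> * Y powr (1 / p)) powr q"
    using q by (intro powr_mono2) auto
  also have "(X powr (1 / q)) powr q = X" using X q by (simp add: powr_powr)
  also have "(\<bar>C\<bar> * norm z powr \<epsilon> * Y powr (1 / p)) powr q = \<bar>C\<bar> powr q * norm z powr (\<epsilon> * q) * Y powr (q / p)"
    by (simp add: powr_mult powr_powr)
  finally show ?thesis unfolding nX by (rule ennreal_leI)
qed

lemma improvingI:
  assumes "p \<le> q"
  shows "improving \<nu> \<Psi> sg b R p q (\<epsilon> * q) (\<bar>C\<bar> powr q)"
proof unfold_locales
  show "1 < p" "p \<le> q" "0 < \<epsilon> * q" "0 \<le> \<bar>C\<bar> powr q" using p q eps assms by auto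
  fix z :: "real^'n" and f :: "real^'n \<Rightarrow> complex" and \<tau> :: "real^'n \<Rightarrow> real" and Z :: real
  assume z: "norm z \<le> 1" and f: "bdd_cpt_fun f" and \<tau>: "\<tau> \<in> borel_measurable borel" "\<And>y. 1 \<le> \<tau> y \<and> \<tau> y \<le> 2"
    and Z: "0 < Z" "(\<integral>\<^sup>+y. ennreal (norm (f y) powr p) \<partial>lborel) \<le> ennreal Z"
  let ?N = "\<integral>\<^sup>+y. ennreal (norm (f y) powr p) \<partial>lborel"
  have "?N < \<infinity>" using Z(2) by (simp add: le_less_trans)
  then obtain Y where Y: "0 \<le> Y" "?N = ennreal Y" by (cases ?N) auto
  have YZ: "Y \<le> Z" using Y Z by simp
  have bf: "bdd_borel f" using f by (simp add: bdd_cpt_fun_iff)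
  have "(\<integral>\<^sup>+y. ennreal (norm (A (\<tau> y) f y - A (\<tau> y) f (y - z)) powr q) \<partial>lborel) \<le> (\<integral>\<^sup>+y. ennreal (lds z f y powr q) \<partial>lborel)"
    using q \<tau> by (intro nn_integral_mono ennreal_leI powr_mono2 lds_upper bf) auto
  also have "\<dots> = (\<integral>\<^sup>+y. ennreal (lds z f y powr q) \<partial>lebesgue)" by (simp add: nn_integral_completion)
  also have "\<dots> \<le> ennreal (\<bar>C\<bar> powr q * norm z powr (\<epsilon> * q) * Y powr (q / p))"
    using Y by (intro lds_nn z f) auto
  also have "\<dots> \<le> ennreal (\<bar>C\<bar> powr q * norm z powr (\<epsilon> * q) * Z powr (q / p - 1)) * ennreal Y"
  proof (cases "Y = 0")
    case True
    then show ?thesis by simp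
  next
    case False
    \<comment> \<open>Here \<open>p \<le> q\<close> enters: the exponent \<open>q / p - 1\<close> is
      nonnegative, so \<open>Y\<close> may be replaced by \<open>Z\<close> in that factor.\<close>
    have "Y powr (q / p) = Y powr (q / p - 1) * Y powr 1" unfolding powr_add[symmetric] by simp
    also have "\<dots> \<le> Z powr (q / p - 1) * Y powr 1"
      using Y YZ assms p by (intro mult_right_mono powr_mono2) auto
    finally have "\<bar>C\<bar> powr q * norm z powr (\<epsilon> * q) * Y powr (q / p) \<le> \<bar>C\<bar> powr q * norm z powr (\<epsilon> * q) * (Z powr (q / p - 1) * Y)"
      using Y by (intro mult_left_mono) auto
    then show ?thesis using Y by (simp add: ennreal_mult[symmetric] ennreal_leI mult.assoc)
  qed
  finally show "(\<integral>\<^sup>+y. ennreal (norm (A (\<tau> y) f y - A (\<tau> y) f (y - z)) powr q) \<partial>lborel) \<le>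
      ennreal (\<bar>C\<bar> powr q * norm z powr (\<epsilon> * q) * Z powr (q / p - 1)) * ?N"
    unfolding Y(2) .
qed

lemma tbound:
  assumes z: "norm z = 1" and f: "bdd_cpt_fun f" and Y: "0 \<le> Y" "(\<integral>\<^sup>+y. ennreal (norm (f y) powr p) \<partial>lborel) \<le> ennreal Y"
  shows "(\<integral>\<^sup>+y. ennreal ((\<Sum>i<m. lds z f (y - real i *\<^sub>R z)) powr q) \<partial>lebesgue) \<le>
      ennreal (real m powr q * real m * \<bar>C\<bar> powr q * Y powr (q / p))"
    and "(\<lambda>y. (\<Sum>i<m. lds z f (y - real i *\<^sub>R z))) \<in> borel_measurable lebesgue"
proof -
  have bf: "bdd_borel f" using f by (simp add: bdd_cpt_fun_iff)
  have m1: "(\<lambda>y. lds z f (y - a)) \<in> borel_measurable lebesgue" for a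
    using nn_integral_translate_lebesgue(2)[of "\<lambda>y. ennreal (lds z f y)" "- a"] lds_meas[of z f] z f
      measurable_compose[OF measurable_compose[OF lebesgue_shift(2)[of "- a"] lds_meas[of z f]] measurable_ident_sets[OF refl]]
    by simp
  then show "(\<lambda>y. (\<Sum>i<m. lds z f (y - real i *\<^sub>R z))) \<in> borel_measurable lebesgue" by simp
  have "(\<integral>\<^sup>+y. ennreal ((\<Sum>i<m. lds z f (y - real i *\<^sub>R z)) powr q) \<partial>lebesgue) \<le>
     (\<integral>\<^sup>+y. ennreal (real m powr q) * (\<Sum>i<m. ennreal (lds z f (y - real i *\<^sub>R z) powr q)) \<partial>lebesgue)"
  proof (intro nn_integral_mono)
    fix y
    have "(\<Sum>i<m. lds z f (y - real i *\<^sub>R z)) powr q \<le> real (card {..<m}) powr q * (\<Sum>i<m. lds z f (y - real i *\<^sub>R z) powr q)"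
      using q by (intro powr_sum_le lds_nonneg bf) auto
    then have "ennreal ((\<Sum>i<m. lds z f (y - real i *\<^sub>R z)) powr q) \<le> ennreal (real m powr q * (\<Sum>i<m. lds z f (y - real i *\<^sub>R z) powr q))"
      by (intro ennreal_leI) simp
    then show "ennreal ((\<Sum>i<m. lds z f (y - real i *\<^sub>R z)) powr q) \<le> ennreal (real m powr q) * (\<Sum>i<m. ennreal (lds z f (y - real i *\<^sub>R z) powr q))"
      by (simp add: ennreal_mult sum_nonneg)
  qed
  also have "\<dots> = ennreal (real m powr q) * (\<Sum>i<m. \<integral>\<^sup>+y. ennreal (lds z f (y - real i *\<^sub>R z) powr q) \<partial>lebesgue)"
    using m1 by (subst nn_integral_cmult) (auto simp: nn_integral_sum simp del: sum_ennreal)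
  also have "(\<Sum>i<m. \<integral>\<^sup>+y. ennreal (lds z f (y - real i *\<^sub>R z) powr q) \<partial>lebesgue) =
      (\<Sum>i<m. \<integral>\<^sup>+y. ennreal (lds z f y powr q) \<partial>lebesgue)"
  proof (rule sum.cong[OF refl])
    fix i
    have [measurable]: "lds z f \<in> borel_measurable lebesgue" using lds_meas z f by simp
    show "(\<integral>\<^sup>+y. ennreal (lds z f (y - real i *\<^sub>R z) powr q) \<partial>lebesgue) = (\<integral>\<^sup>+y. ennreal (lds z f y powr q) \<partial>lebesgue)"
      using nn_integral_translate_lebesgue(1)[of "\<lambda>y. ennreal (lds z f y powr q)" "- (real i *\<^sub>R z)"] by simp
  qed
  also have "ennreal (real m powr q) * \<dots> \<le> ennreal (real m powr q) * (\<Sum>i<m. ennreal (\<bar>C\<bar> powr q * Y powr (q / p)))"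
    using lds_nn[OF _ f Y, of z] z by (intro mult_left_mono sum_mono) auto
  also have "\<dots> = ennreal (real m powr q * real m * \<bar>C\<bar> powr q * Y powr (q / p))"
    by (simp add: ennreal_mult ennreal_of_nat_eq_real_of_nat mult.assoc)
  finally show "(\<integral>\<^sup>+y. ennreal ((\<Sum>i<m. lds z f (y - real i *\<^sub>R z)) powr q) \<partial>lebesgue) \<le>
      ennreal (real m powr q * real m * \<bar>C\<bar> powr q * Y powr (q / p))" .
qed

lemma unit_vector: obtains z :: "real^'n" where "norm z = 1"
  using vector_choose_size[of 1] by auto

lemma AE_zero:
  assumes z: "norm z = 1" and f: "bdd_cpt_fun f" and zero: "(\<integral>\<^sup>+y. ennreal (lds z f y powr q) \<partial>lebesgue) = 0"
  shows "AE y in lborel. \<forall>t\<in>{1..2}. A t f y = 0"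
proof -
  have bf: "bdd_borel f" using f by (simp add: bdd_cpt_fun_iff)
  have [measurable]: "lds z f \<in> borel_measurable lebesgue" using lds_meas z f by simp
  obtain \<rho> where \<rho>: "\<And>x. f x \<noteq> 0 \<Longrightarrow> norm x \<le> \<rho>"
    using f unfolding bdd_cpt_fun_iff bounded_iff by auto
  obtain m :: nat where m: "2 * (\<rho> + ext) < real m" using reals_Archimedean2 by blast
  have "AE y in lebesgue. lds z f (y - a) = 0" for a
  proof -
    have "(\<integral>\<^sup>+y. ennreal (lds z f (y - a) powr q) \<partial>lebesgue) = 0"
      using nn_integral_translate_lebesgue(1)[of "\<lambda>y. ennreal (lds z f y powr q)" "- a"] zero by simp
    moreover have "(\<lambda>y. ennreal (lds z f (y - a) powr q)) \<in> borel_measurable lebesgue"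
      using nn_integral_translate_lebesgue(2)[of "\<lambda>y. ennreal (lds z f y powr q)" "- a"] by simp
    ultimately have "AE y in lebesgue. ennreal (lds z f (y - a) powr q) = 0"
      by (subst (asm) nn_integral_0_iff_AE)
    then show ?thesis by eventually_elim (simp add: ennreal_eq_0_iff not_less[symmetric] split: if_splits)
  qed
  then have "AE y in lebesgue. \<forall>i\<in>{..<m}. lds z f (y - real i *\<^sub>R z) = 0"
    by (subst AE_finite_all) auto
  then have "AE y in lebesgue. \<forall>t\<in>{1..2}. A t f y = 0"
  proof eventually_elim
    case (elim y)
    show ?case
    proof
      fix t :: real assume "t \<in> {1..2}"
      then have "norm (A t f y) \<le> (\<Sum>i<m. lds z f (y - real i *\<^sub>R z))"
        using telescope[OF bf \<rho> z m] by auto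
      then show "A t f y = 0" using elim by simp
    qed
  qed
  then show ?thesis by (simp add: AE_completion_iff)
qed

text \<open>Averages of continuous approximants are continuous in \<open>t\<close>. The telescoped
  bound turns closeness in the p-norm into maximal errors whose q-th powers have integrals at most
  \<open>(1 / 2) ^ n\<close>; these are summable, so for almost every \<open>y\<close> the averages
  converge uniformly in \<open>t\<close>.\<close>

lemma AE_continuous:
  assumes f: "bdd_cpt_fun f"
  shows "AE y in lborel. continuous_on {1..2} (\<lambda>t. A t f y)"
proof -
  have bf: "bdd_borel f" using f by (simp add: bdd_cpt_fun_iff)
  obtain z :: "real^'n" where z: "norm z = 1" using unit_vector .
  obtain \<rho> where \<rho>: "\<And>x. f x \<noteq> 0 \<Longrightarrow> norm x \<le> \<rho>"
    using f unfolding bdd_cpt_fun_iff bounded_iff by auto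
  \<comment> \<open>The radius is \<open>\<rho> + 1\<close> because the differences between
    \<open>f\<close> and its approximants live on the larger ball.\<close>
  obtain m :: nat where m: "2 * (\<rho> + 1 + ext) < real m" using reals_Archimedean2 by blast
  define K where "K = real m powr q * real m * \<bar>C\<bar> powr q"
  have K: "0 \<le> K" by (simp add: K_def)
  \<comment> \<open>Tuned so that the error bound \<open>K * e n powr (q / p)\<close> is at most
    \<open>(1 / 2) ^ n\<close>; dividing by \<open>K + 1\<close> also covers
    \<open>K = 0\<close>.\<close>
  define e where "e n = ((1 / 2) ^ n / (K + 1)) powr (p / q)" for n :: nat
  have e: "0 < e n" "K * e n powr (q / p) \<le> (1 / 2) ^ n" for n
  proof -
    have "0 < (1 / 2) ^ n / (K + 1)" using K by simp
    then show "0 < e n" unfolding e_def by (subst powr_gt_zero) (rule less_imp_neq[symmetric])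
    have "e n powr (q / p) = (1 / 2) ^ n / (K + 1)" using p q K by (simp add: e_def powr_powr)
    then have "K * e n powr (q / p) = K / (K + 1) * (1 / 2) ^ n" by simp
    also have "\<dots> \<le> 1 * (1 / 2) ^ n" using K by (intro mult_right_mono) auto
    finally show "K * e n powr (q / p) \<le> (1 / 2) ^ n" by simp
  qed
  have "\<exists>g. continuous_on UNIV g \<and> bdd_cpt_fun g \<and> (\<forall>x. g x \<noteq> 0 \<longrightarrow> norm x \<le> \<rho> + 1) \<and>
      (LINT x|lborel. norm (f x - g x) powr p) < e n" for n
  proof -
    have "0 < p" using p by simp
    from continuous_approx[OF f this \<rho> e(1)[of n]] show ?thesis by blast
  qed
  then have "\<forall>n. \<exists>g. continuous_on UNIV g \<and> bdd_cpt_fun g \<and> (\<forall>x. g x \<noteq> 0 \<longrightarrow> norm x \<le> \<rho> + 1) \<and>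
      (LINT x|lborel. norm (f x - g x) powr p) < e n" by blast
  from choice[OF this] obtain g where g: "\<And>n. continuous_on UNIV (g n)" "\<And>n. bdd_cpt_fun (g n)" "\<And>n x. g n x \<noteq> 0 \<Longrightarrow> norm x \<le> \<rho> + 1"
      "\<And>n. (LINT x|lborel. norm (f x - g n x) powr p) < e n" by blast
  define d where "d n x = f x - g n x" for n x
  have d_supp: "norm x \<le> \<rho> + 1" if "d n x \<noteq> 0" for n x
    using that \<rho>[of x] g(3)[of n x] by (cases "f x = 0") (auto simp: d_def)
  have d: "bdd_cpt_fun (d n)" for n
    unfolding bdd_cpt_fun_iff
  proof
    show "bdd_borel (d n)"
      unfolding d_def using bf g(2)[of n] by (intro bdd_borel_diff) (auto simp: bdd_cpt_fun_iff)
    show "bounded {x. d n x \<noteq> 0}" using d_supp unfolding bounded_iff by blast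
  qed
  have bd: "bdd_borel (d n)" for n using d by (simp add: bdd_cpt_fun_iff)
  define H where "H n y = (\<Sum>i<m. lds z (d n) (y - real i *\<^sub>R z))" for n y
  have H0: "0 \<le> H n y" for n y unfolding H_def by (intro sum_nonneg lds_nonneg bd)
  have dn: "(\<integral>\<^sup>+y. ennreal (norm (d n y) powr p) \<partial>lborel) \<le> ennreal (e n)" for n
  proof -
    have "(\<integral>\<^sup>+y. ennreal (norm (d n y) powr p) \<partial>lborel) = ennreal (LINT y|lborel. norm (d n y) powr p)"
      using p by (intro nn_integral_eq_integral bdd_cpt_fun_powr_integrable d) auto
    then show ?thesis using g(4)[of n] by (simp add: d_def ennreal_leI)
  qed
  have e0: "0 \<le> e n" for n using e(1)[of n] by simp
  have H_meas [measurable]: "H n \<in> borel_measurable lebesgue" for n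
    unfolding H_def by (rule tbound(2)[OF z d[of n] e0[of n] dn[of n]])
  have H_int: "(\<integral>\<^sup>+y. ennreal (H n y powr q) \<partial>lebesgue) \<le> ennreal ((1 / 2) ^ n)" for n
    using order_trans[OF tbound(1)[OF z d[of n] e0[of n] dn[of n], of m] ennreal_leI[OF e(2)[of n, unfolded K_def]]]
    unfolding H_def .
  have "(\<integral>\<^sup>+y. (\<Sum>n. ennreal (H n y powr q)) \<partial>lebesgue) = (\<Sum>n. \<integral>\<^sup>+y. ennreal (H n y powr q) \<partial>lebesgue)"
    by (rule nn_integral_suminf) measurable
  also have "\<dots> \<le> (\<Sum>n. ennreal ((1 / 2) ^ n))" by (intro suminf_le H_int) auto
  also have "\<dots> = ennreal 2"
    using power_half_series by (intro suminf_ennreal_eq) (auto simp: geometric_sums[of "1/2 :: real", simplified])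
  finally have "(\<integral>\<^sup>+y. (\<Sum>n. ennreal (H n y powr q)) \<partial>lebesgue) \<noteq> \<infinity>"
    by (metis ennreal_neq_top infinity_ennreal_def neq_top_trans)
  then have "AE y in lebesgue. (\<Sum>n. ennreal (H n y powr q)) \<noteq> \<infinity>"
    by (intro nn_integral_PInf_AE) measurable
  then have "AE y in lebesgue. continuous_on {1..2} (\<lambda>t. A t f y)"
  proof eventually_elim
    case (elim y)
    have "summable (\<lambda>n. H n y powr q)"
      using elim by (intro summable_suminf_not_top) auto
    then have "(\<lambda>n. H n y powr q) \<longlonglongrightarrow> 0" by (rule summable_LIMSEQ_zero)
    then have "(\<lambda>n. (H n y powr q) powr (1 / q)) \<longlonglongrightarrow> 0"
      by (rule tendsto_zero_powrI[OF _ tendsto_const]) (use q in auto)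
    then have H_lim: "(\<lambda>n. H n y) \<longlonglongrightarrow> 0" using H0 q by (simp add: powr_powr)
    have close: "dist (A t (g n) y) (A t f y) \<le> H n y" if "t \<in> {1..2}" for t n
    proof -
      have "A t (d n) y = A t f y - A t (g n) y"
        unfolding d_def using bf g(2)[of n] by (intro A_diff) (auto simp: bdd_cpt_fun_iff)
      then show ?thesis
        using telescope[OF bd[of n] d_supp z m, where t = t and y = y] that
        by (simp add: H_def dist_norm norm_minus_commute)
    qed
    show ?case
    proof (rule uniform_limit_theorem)
      show "uniform_limit {1..2} (\<lambda>n t. A t (g n) y) (\<lambda>t. A t f y) sequentially"
      proof (rule uniform_limitI)
        fix \<delta> :: real assume "0 < \<delta>"
        then have "\<forall>\<^sub>F n in sequentially. H n y < \<delta>" using H_lim by (rule order_tendstoD(2)[rotated])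
        then show "\<forall>\<^sub>F n in sequentially. \<forall>t\<in>{1..2}. dist (A t (g n) y) (A t f y) < \<delta>"
        proof eventually_elim
          case (elim n)
          show ?case using le_less_trans[OF close elim] by blast
        qed
      qed
      show "\<forall>\<^sub>F n in sequentially. continuous_on {1..2} (\<lambda>t. A t (g n) y)"
        using g by (intro always_eventually allI A_continuous) (auto simp: bdd_cpt_fun_iff)
    qed simp
  qed
  then show ?thesis by (simp add: AE_completion_iff)
qed

end

lemma bdd_cpt_fun_translate:
  assumes f: "bdd_cpt_fun f"
  shows "bdd_cpt_fun (\<lambda>x. f (x - w))"
  unfolding bdd_cpt_fun_iff
proof
  show "bdd_borel (\<lambda>x. f (x - w))"
    using f by (rule_tac bdd_borel_compose[of f "\<lambda>x. x - w"]) (simp add: bdd_cpt_fun_iff, measurable)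
  have "{x. f (x - w) \<noteq> 0} = (+) w ` {x. f x \<noteq> 0}"
    by (auto simp: image_iff) (metis add_diff_cancel_left' diff_add_cancel add.commute)
  then show "bounded {x. f (x - w) \<noteq> 0}"
    using f bounded_translation[of "{x. f x \<noteq> 0}" w] by (simp add: bdd_cpt_fun_iff)
qed

lemma bdd_cpt_fun_add:
  assumes "bdd_cpt_fun f" "bdd_cpt_fun g"
  shows "bdd_cpt_fun (\<lambda>x. f x + g x)"
proof -
  have "{x. f x + g x \<noteq> 0} \<subseteq> {x. f x \<noteq> 0} \<union> {x. g x \<noteq> 0}" by auto
  then have "bounded {x. f x + g x \<noteq> 0}"
    using assms unfolding bdd_cpt_fun_iff by (meson bounded_Un bounded_subset)
  then show ?thesis using assms by (simp add: bdd_cpt_fun_iff bdd_borel_add)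
qed

lemma pairing_le:
  "ennreal (norm (pairing F g)) \<le> (\<integral>\<^sup>+y. ennreal (\<bar>F y\<bar> * norm (g y)) \<partial>lborel)"
proof (cases "integrable lebesgue (\<lambda>y. complex_of_real (F y) * g y)")
  case True
  have "ennreal (norm (pairing F g)) \<le> (\<integral>\<^sup>+y. ennreal (norm (complex_of_real (F y) * g y)) \<partial>lebesgue)"
    unfolding pairing_def using True by (rule integral_norm_bound_ennreal)
  then show ?thesis by (simp add: nn_integral_completion norm_mult)
next
  case False
  then show ?thesis by (simp add: pairing_def not_integrable_integral_eq)
qed

lemma dyadic_scale:
  fixes t :: real
  assumes "0 < t"
  obtains e :: int where "2 powr of_int e \<le> t" "t \<le> 2 * 2 powr of_int e"
proof (rule that)
  have "2 powr of_int \<lfloor>log 2 t\<rfloor> \<le> 2 powr log 2 t" by (intro powr_mono) auto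
  then show "2 powr of_int \<lfloor>log 2 t\<rfloor> \<le> t" using assms by simp
  have "2 powr log 2 t \<le> 2 powr (of_int \<lfloor>log 2 t\<rfloor> + 1)" by (intro powr_mono) linarith+
  then show "t \<le> 2 * 2 powr of_int \<lfloor>log 2 t\<rfloor>" using assms by (simp add: powr_add)
qed

section \<open>Measurable choice of a nearly optimal parameter\<close>

context averaging
begin

definition maxA :: "(real^'n \<Rightarrow> complex) \<Rightarrow> real^'n \<Rightarrow> real" where
  "maxA f y = (SUP t\<in>{0<..}. norm (A t f y))"

lemma maxA_le: "(\<And>t. 0 < t \<Longrightarrow> norm (A t f y) \<le> X) \<Longrightarrow> maxA f y \<le> X"
  unfolding maxA_def by (intro cSUP_least) (auto intro: exI[of _ 1])

lemma maxA_upper: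
  assumes "bdd_borel f" "0 < t"
  shows "norm (A t f y) \<le> maxA f y"
proof -
  obtain c where c: "\<And>t y. norm (A t f y) \<le> c" using A_bound assms by blast
  show ?thesis unfolding maxA_def
    using c assms by (intro cSUP_upper) (auto intro!: bdd_aboveI2[where M = c])
qed

lemma maxA_nonneg: "bdd_borel f \<Longrightarrow> 0 \<le> maxA f y"
  using maxA_upper[of f 1 y] order_trans[OF norm_ge_zero] by simp

text \<open>A parameter among \<open>s 0, ..., s j\<close> that maximises the size of the average at
  \<open>y\<close>. The recursion through comparisons keeps it Borel measurable, and it takes
  finitely many values, so for positive \<open>s\<close> it is bounded and stays away from
  0.\<close>

primrec best :: "(nat \<Rightarrow> real) \<Rightarrow> (real^'n \<Rightarrow> complex) \<Rightarrow> nat \<Rightarrow> real^'n \<Rightarrow> real" where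
  "best s f 0 y = s 0"
| "best s f (Suc j) y =
    (if norm (A (best s f j y) f y) < norm (A (s (Suc j)) f y) then s (Suc j) else best s f j y)"

lemma best_meas [measurable]: "f \<in> borel_measurable borel \<Longrightarrow> best s f j \<in> borel_measurable borel"
proof (induction j)
  case 0
  have "best s f 0 = (\<lambda>_. s 0)" by auto
  then show ?case by simp
next
  case (Suc j)
  note [measurable] = Suc
  have "best s f (Suc j) =
      (\<lambda>y. if norm (A (best s f j y) f y) < norm (A (s (Suc j)) f y) then s (Suc j) else best s f j y)" by auto
  also have "\<dots> \<in> borel_measurable borel" by measurable
  finally show ?case .
qed

lemma best_in: "best s f j y \<in> s ` {..j}"
  by (induction j) (auto simp: image_iff intro: le_SucI)

lemma best_ge: "i \<le> j \<Longrightarrow> norm (A (s i) f y) \<le> norm (A (best s f j y) f y)"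
  by (induction j) (auto simp: le_Suc_eq)

lemma best_mono: "i \<le> j \<Longrightarrow> norm (A (best s f i y) f y) \<le> norm (A (best s f j y) f y)"
  by (induction j) (auto simp: le_Suc_eq)

end

context loccont
begin

lemma AE_scales:
  assumes "\<And>D. 0 < D \<Longrightarrow> AE y in lborel. P D (dilate b (1 / D) y)"
  shows "AE y in lborel. \<forall>e::int. P (2 powr of_int e) (dilate b (1 / 2 powr of_int e) y)"
  by (subst AE_all_countable) (intro allI assms, simp)

text \<open>Vanishing for parameters in [1, 2] is carried to each dyadic octave by dilation, at the
  cost of countably many null sets.\<close>

lemma maxA_zero:
  assumes z: "norm z = 1" and f: "bdd_cpt_fun f"
    and zero: "\<And>D. 0 < D \<Longrightarrow> (\<integral>\<^sup>+y. ennreal (lds z (\<lambda>x. f (dilate b D x)) y powr q) \<partial>lebesgue) = 0"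
  shows "AE y in lborel. maxA f y = 0"
proof -
  have "AE y in lborel. \<forall>t\<in>{1..2}. A t (\<lambda>x. f (dilate b D x)) (dilate b (1 / D) y) = 0" if D: "0 < D" for D
    using AE_dilate[OF AE_zero[OF z bdd_cpt_fun_dilate[OF f D] zero[OF D]], of "1 / D"] D by simp
  then have "AE y in lborel. \<forall>e::int. \<forall>t\<in>{1..2}. A t (\<lambda>x. f (dilate b (2 powr of_int e) x)) (dilate b (1 / 2 powr of_int e) y) = 0"
    by (rule AE_scales)
  then show ?thesis
  proof eventually_elim
    case (elim y)
    have "A t f y = 0" if "0 < t" for t
    proof -
      obtain e :: int where e: "2 powr of_int e \<le> t" "t \<le> 2 * 2 powr of_int e" using dyadic_scale[OF \<open>0 < t\<close>] .
      define D :: real where "D = 2 powr of_int e"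
      have D: "0 < D" by (simp add: D_def)
      have "t / D \<in> {1..2}" using e by (simp add: D_def field_simps)
      then have "A (t / D) (\<lambda>x. f (dilate b D x)) (dilate b (1 / D) y) = 0" using elim by (simp add: D_def)
      then show ?thesis using A_dilate[OF D, of "t / D" f y] D by simp
    qed
    then have "maxA f y \<le> 0" by (intro maxA_le) simp
    then show ?case using maxA_nonneg[of f y] f by (simp add: bdd_cpt_fun_iff)
  qed
qed

lemma AE_continuous_scales:
  assumes f: "bdd_cpt_fun f"
  shows "AE y in lborel. \<forall>e::int. continuous_on {2 powr of_int e..2 * 2 powr of_int e} (\<lambda>t. A t f y)"
proof -
  have "AE y in lborel. continuous_on {1..2} (\<lambda>t. A t (\<lambda>x. f (dilate b D x)) (dilate b (1 / D) y))" if D: "0 < D" for D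
    using AE_dilate[OF AE_continuous[OF bdd_cpt_fun_dilate[OF f D]], of "1 / D"] D by simp
  then have "AE y in lborel. \<forall>e::int. continuous_on {1..2} (\<lambda>t. A t (\<lambda>x. f (dilate b (2 powr of_int e) x)) (dilate b (1 / 2 powr of_int e) y))"
    by (rule AE_scales)
  then show ?thesis
  proof eventually_elim
    case (elim y)
    show ?case
    proof
      fix e :: int
      define D :: real where "D = 2 powr of_int e"
      have D: "0 < D" by (simp add: D_def)
      have c: "continuous_on {1..2} (\<lambda>t. A (D * t) f y)"
        unfolding A_dilate[OF D] using elim by (simp add: D_def)
      have "continuous_on {D..2 * D} (\<lambda>t. A (D * (t / D)) f y)"
        using D by (intro continuous_on_compose2[OF c] continuous_intros) (auto simp: field_simps)
      then show "continuous_on {2 powr of_int e..2 * 2 powr of_int e} (\<lambda>t. A t f y)"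
        using D by (simp add: D_def)
    qed
  qed
qed

text \<open>By continuity in each octave the supremum over all parameters is, almost everywhere, a
  supremum over positive rationals. Maxima over finitely many rationals are linearised averages,
  bounded independently of their number, and they increase to it.\<close>

lemma maximal_sparse_bound:
  assumes pq: "p \<le> q"
  obtains K :: real where "\<And>f g. bdd_cpt_fun f \<Longrightarrow> bdd_cpt_fun g \<Longrightarrow>
    (\<integral>\<^sup>+y. ennreal (maxA f y * norm (g y)) \<partial>lborel) \<le> ennreal K * sparse_sup b (ennreal p) (ennreal (q / (q - 1))) f g"
proof -
  interpret I: improving \<nu> \<Psi> sg b R p q "\<epsilon> * q" "\<bar>C\<bar> powr q" by (rule improvingI[OF pq])
  define K where "K = 2 ^ CARD('n) * I.step_const I.reach"
  define s where "s = from_nat_into (\<rat> \<inter> {0<..} :: real set)"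
  have "(1 :: real) \<in> \<rat> \<inter> {0<..}" by simp
  then have s: "range s = \<rat> \<inter> {0<..}"
    unfolding s_def by (intro range_from_nat_into) (auto simp: countable_rat)
  have spos: "0 < s i" for i using s by auto
  show ?thesis
  proof (rule that[of K])
    fix f g :: "real^'n \<Rightarrow> complex"
    assume f: "bdd_cpt_fun f" and g: "bdd_cpt_fun g"
    have bf: "bdd_borel f" using f by (simp add: bdd_cpt_fun_iff)
    have [measurable]: "f \<in> borel_measurable borel" "g \<in> borel_measurable borel"
      using f g by (auto simp: bdd_cpt_fun_def)
    define a where "a j y = norm (A (best s f j y) f y)" for j y
    have a_meas [measurable]: "a j \<in> borel_measurable borel" for j unfolding a_def by measurable
    obtain c where c: "\<And>t y. norm (A t f y) \<le> c" using A_bound bf by blast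
    have "AE y in lborel. ennreal (maxA f y * norm (g y)) \<le> (SUP j. ennreal (a j y * norm (g y)))"
      using AE_continuous_scales[OF f]
    proof eventually_elim
      case (elim y)
      define X where "X = (SUP j. a j y)"
      have bdd: "bdd_above (range (\<lambda>j. a j y))" using c by (intro bdd_aboveI2[where M = c]) (simp add: a_def)
      have rat: "norm (A t f y) \<le> X" if t: "t \<in> \<rat>" "0 < t" for t
      proof -
        have "t \<in> range s" using t s by simp
        then obtain i where "t = s i" by blast
        then have "norm (A t f y) \<le> a i y" using best_ge[of i i s f y] by (simp add: a_def)
        also have "\<dots> \<le> X" unfolding X_def by (rule cSUP_upper[OF _ bdd]) simp
        finally show ?thesis .
      qed
      have "norm (A t f y) \<le> X" if "0 < t" for t
      proof -
        obtain e :: int where e: "2 powr of_int e \<le> t" "t \<le> 2 * 2 powr of_int e" using dyadic_scale[OF \<open>0 < t\<close>] .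
        define D :: real where "D = 2 powr of_int e"
        have D: "0 < D" by (simp add: D_def)
        \<comment> \<open>The rationals of the open octave are dense in the closed one, so bounds on
          them extend by continuity, endpoints included.\<close>
        have cl: "closure ({D<..<2 * D} \<inter> \<rat>) = {D..2 * D}"
          using D by (subst closure_open_Int_superset) (auto simp: Rats_closure_real)
        have "continuous_on (closure ({D<..<2 * D} \<inter> \<rat>)) (\<lambda>t. A t f y)"
          unfolding cl using elim by (simp add: D_def)
        then show ?thesis
          by (rule continuous_on_closure_norm_le) (use D e rat cl in \<open>auto simp: D_def\<close>)
      qed
      then have "maxA f y \<le> X" by (rule maxA_le)
      then have "ennreal (maxA f y * norm (g y)) \<le> ennreal (X * norm (g y))"
        by (intro ennreal_leI mult_right_mono) auto
      also have "\<dots> = (SUP j. ennreal (a j y * norm (g y)))"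
      proof (rule LIMSEQ_unique)
        have inc: "incseq (\<lambda>j. a j y)" unfolding incseq_def a_def by (auto intro: best_mono)
        then have "(\<lambda>j. a j y) \<longlonglongrightarrow> X" unfolding X_def by (intro LIMSEQ_incseq_SUP bdd)
        then show "(\<lambda>j. ennreal (a j y * norm (g y))) \<longlonglongrightarrow> ennreal (X * norm (g y))"
          by (intro tendsto_ennrealI tendsto_intros)
        show "(\<lambda>j. ennreal (a j y * norm (g y))) \<longlonglongrightarrow> (SUP j. ennreal (a j y * norm (g y)))"
          using inc by (intro LIMSEQ_SUP) (auto simp: incseq_def intro!: ennreal_leI mult_right_mono)
      qed
      finally show ?case .
    qed
    then have "(\<integral>\<^sup>+y. ennreal (maxA f y * norm (g y)) \<partial>lborel) \<le> (\<integral>\<^sup>+y. (SUP j. ennreal (a j y * norm (g y))) \<partial>lborel)"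
      by (rule nn_integral_mono_AE)
    also have "\<dots> = (SUP j. \<integral>\<^sup>+y. ennreal (a j y * norm (g y)) \<partial>lborel)"
    proof (rule nn_integral_monotone_convergence_SUP)
      show "incseq (\<lambda>j y. ennreal (a j y * norm (g y)))"
        unfolding incseq_def le_fun_def a_def by (auto intro!: ennreal_leI mult_right_mono best_mono)
    qed measurable
    also have "\<dots> \<le> ennreal K * sparse_sup b (ennreal p) (ennreal (q / (q - 1))) f g"
    proof (rule SUP_least)
      fix j
      have fin: "finite (s ` {..j})" "s ` {..j} \<noteq> {}" by auto
      have lo: "0 < Min (s ` {..j})" using fin spos by (subst Min_gr_iff) auto
      have "Min (s ` {..j}) \<le> best s f j y \<and> best s f j y \<le> Max (s ` {..j})" for y
        using best_in[of s f j y] fin by simp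
      then show "(\<integral>\<^sup>+y. ennreal (a j y * norm (g y)) \<partial>lborel) \<le> ennreal K * sparse_sup b (ennreal p) (ennreal (q / (q - 1))) f g"
        unfolding a_def K_def I.r_def[symmetric]
        by (intro I.core_bound[OF f g _ lo]) auto
    qed
    finally show "(\<integral>\<^sup>+y. ennreal (maxA f y * norm (g y)) \<partial>lborel) \<le> ennreal K * sparse_sup b (ennreal p) (ennreal (q / (q - 1))) f g" .
  qed
qed

text \<open>Hoermander's argument: a translation invariant local operator cannot improve integrability downwards,
  as one sees by testing it on the sum of two far translates of the same function.\<close>

lemma lds_vanish:
  assumes qp: "q < p" and z: "norm z = 1" and f: "bdd_cpt_fun f"
  shows "(\<integral>\<^sup>+y. ennreal (lds z f y powr q) \<partial>lebesgue) = 0"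
proof -
  \<comment> \<open>Adding a far translate doubles the left-hand side and multiplies the right-hand
    one by \<open>2 powr (q / p) = 2 * \<theta>\<close>; for \<open>q < p\<close> each doubling thus
    gains the factor \<open>\<theta> < 1\<close>.\<close>
  define \<theta> where "\<theta> = 2 powr (q / p - 1)"
  have \<theta>: "0 < \<theta>" "\<theta> < 1" using qp p q by (auto simp: \<theta>_def powr_less_one)
  define c where "c = \<bar>C\<bar> powr q"
  have bound: "(\<integral>\<^sup>+y. ennreal (lds z f y powr q) \<partial>lebesgue) \<le> ennreal (c * \<theta> ^ n * Y powr (q / p))"
    if "bdd_cpt_fun f" "0 \<le> Y" "(\<integral>\<^sup>+y. ennreal (norm (f y) powr p) \<partial>lborel) \<le> ennreal Y" for n f Y
    using that
  proof (induction n arbitrary: f Y)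
    case 0
    then show ?case using lds_nn[OF _ 0, of z] z by (simp add: c_def)
  next
    case (Suc n)
    let ?I = "\<integral>\<^sup>+y. ennreal (lds z f y powr q) \<partial>lebesgue"
    have bf: "bdd_borel f" using Suc by (simp add: bdd_cpt_fun_iff)
    have [measurable]: "f \<in> borel_measurable borel" using Suc by (simp add: bdd_cpt_fun_def)
    obtain \<rho> where \<rho>: "\<And>x. f x \<noteq> 0 \<Longrightarrow> norm x \<le> \<rho>" "0 < \<rho>"
      using Suc.prems(1) unfolding bdd_cpt_fun_iff bounded_pos by auto
    have ext0: "0 \<le> ext" unfolding ext_def by (intro sum_nonneg) auto
    \<comment> \<open>Averages vanish beyond radius \<open>B - 1\<close> and, as \<open>z\<close>
      has length 1, their differences beyond \<open>B\<close>; the translate by \<open>4 * B\<close>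
      therefore does not interfere.\<close>
    define B where "B = \<rho> + ext + 1"
    have B: "1 \<le> B" "\<rho> + ext < B" "\<rho> \<le> B" using \<rho> ext0 by (auto simp: B_def)
    define w where "w = (4 * B) *\<^sub>R z"
    have w: "norm w = 4 * B" using z B by (simp add: w_def)
    define F where "F x = f x + f (x - w)" for x
    have F: "bdd_cpt_fun F"
      unfolding F_def by (intro bdd_cpt_fun_add bdd_cpt_fun_translate Suc)
    have far: "norm (y - w) \<ge> 4 * B - norm y" for y
      using norm_triangle_ineq2[of w y] w by (simp add: norm_minus_commute)
    have A0: "A t f y = 0" if "t \<in> {1..2}" "B - 1 < norm y" for t y
      using that by (intro A_support[OF \<rho>(1)]) (auto simp: B_def)
    have AF: "A t F y = A t f y + A t f (y - w)" for t y
      unfolding F_def using bf bdd_cpt_fun_translate[OF Suc.prems(1), of w]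
      by (subst A_add) (auto simp: A_translate bdd_cpt_fun_iff)
    have l0: "lds z f y = 0" if "B < norm y" for y
    proof -
      have "norm (y - z) > B - 1" using norm_triangle_ineq2[of y z] that z by linarith
      then have "(\<lambda>t. norm (A t f y - A t f (y - z))) ` {1..2} = {0}"
        using A0 that by force
      then show ?thesis by (simp add: lds_def)
    qed
    have lF: "lds z f y powr q + lds z f (y - w) powr q = lds z F y powr q" if "norm y \<le> B \<or> norm (y - w) \<le> B" for y
    proof (cases "norm y \<le> B")
      case True
      have n1: "B - 1 < norm (y - w)" "B < norm (y - w)" using far[of y] True B by auto
      have n2: "B - 1 < norm (y - z - w)"
        using far[of "y - z"] True B norm_triangle_ineq4[of y z] z by linarith
      have "lds z F y = lds z f y"
        unfolding lds_def AF using A0 n1(1) n2 by (intro SUP_cong) auto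
      then show ?thesis using l0[OF n1(2)] by simp
    next
      case False
      then have yw: "norm (y - w) \<le> B" using that by simp
      have n2: "B - 1 < norm (y - z)"
        using norm_triangle_ineq2[of y z] False z by linarith
      have e: "y - z - w = y - w - z" by simp
      have "lds z F y = lds z f (y - w)"
        unfolding lds_def AF e using A0 n2 False by (intro SUP_cong) auto
      then show ?thesis using l0[of y] False by simp
    qed
    have lF': "lds z f y powr q + lds z f (y - w) powr q \<le> lds z F y powr q" for y
      using lF[of y] l0[of y] l0[of "y - w"] by (cases "norm y \<le> B \<or> norm (y - w) \<le> B") auto
    have lm [measurable]: "lds z f \<in> borel_measurable lebesgue" using lds_meas[of z f] z Suc by simp
    have tr: "(\<integral>\<^sup>+y. ennreal (lds z f (y - w) powr q) \<partial>lebesgue) = ?I"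
      "(\<lambda>y. ennreal (lds z f (y - w) powr q)) \<in> borel_measurable lebesgue"
      using nn_integral_translate_lebesgue[of "\<lambda>y. ennreal (lds z f y powr q)" "- w"] by simp_all
    have "2 * ?I = ?I + (\<integral>\<^sup>+y. ennreal (lds z f (y - w) powr q) \<partial>lebesgue)"
      unfolding tr(1) by (simp add: mult_2)
    also have "\<dots> = (\<integral>\<^sup>+y. ennreal (lds z f y powr q) + ennreal (lds z f (y - w) powr q) \<partial>lebesgue)"
      using tr(2) by (subst nn_integral_add) auto
    also have "\<dots> \<le> (\<integral>\<^sup>+y. ennreal (lds z F y powr q) \<partial>lebesgue)"
      using lF' by (intro nn_integral_mono) (simp add: ennreal_plus[symmetric] ennreal_leI del: ennreal_plus)
    also have "\<dots> \<le> ennreal (c * \<theta> ^ n * (2 * Y) powr (q / p))"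
    proof (rule Suc.IH[OF F])
      show "0 \<le> 2 * Y" using Suc by simp
      have "(\<integral>\<^sup>+y. ennreal (norm (F y) powr p) \<partial>lborel) \<le>
          (\<integral>\<^sup>+y. ennreal (norm (f y) powr p) + ennreal (norm (f (y + - w)) powr p) \<partial>lborel)"
      proof (intro nn_integral_mono)
        fix y
        have "f y = 0 \<or> f (y - w) = 0"
          using \<rho>(1)[of y] \<rho>(1)[of "y - w"] far[of y] B by force
        then show "ennreal (norm (F y) powr p) \<le> ennreal (norm (f y) powr p) + ennreal (norm (f (y + - w)) powr p)"
          by (auto simp: F_def)
      qed
      also have "\<dots> = (\<integral>\<^sup>+y. ennreal (norm (f y) powr p) \<partial>lborel) + (\<integral>\<^sup>+y. ennreal (norm (f (y + - w)) powr p) \<partial>lborel)"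
        by (rule nn_integral_add) measurable
      also have "(\<integral>\<^sup>+y. ennreal (norm (f (y + - w)) powr p) \<partial>lborel) = (\<integral>\<^sup>+y. ennreal (norm (f y) powr p) \<partial>lborel)"
        by (rule nn_integral_translate) measurable
      also have "(\<integral>\<^sup>+y. ennreal (norm (f y) powr p) \<partial>lborel) + (\<integral>\<^sup>+y. ennreal (norm (f y) powr p) \<partial>lborel) \<le> ennreal Y + ennreal Y"
        using Suc by (intro add_mono)
      finally show "(\<integral>\<^sup>+y. ennreal (norm (F y) powr p) \<partial>lborel) \<le> ennreal (2 * Y)"
        using Suc by (simp add: ennreal_plus[symmetric] del: ennreal_plus)
    qed
    also have "c * \<theta> ^ n * (2 * Y) powr (q / p) = 2 * (c * \<theta> ^ Suc n * Y powr (q / p))"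
    proof -
      have "2 powr (q / p) = 2 * \<theta>" by (simp add: \<theta>_def powr_diff)
      then show ?thesis using Suc by (simp add: powr_mult)
    qed
    also have "ennreal (2 * (c * \<theta> ^ Suc n * Y powr (q / p))) = 2 * ennreal (c * \<theta> ^ Suc n * Y powr (q / p))"
      by (subst ennreal_mult') auto
    finally show ?case by (subst (asm) ennreal_mult_le_mult_iff) auto
  qed
  obtain Y where Y: "0 \<le> Y" "(\<integral>\<^sup>+y. ennreal (norm (f y) powr p) \<partial>lborel) = ennreal Y"
  proof (rule that)
    show "(\<integral>\<^sup>+y. ennreal (norm (f y) powr p) \<partial>lborel) = ennreal (LINT y|lborel. norm (f y) powr p)"
      using p by (intro nn_integral_eq_integral bdd_cpt_fun_powr_integrable f) auto
  qed (auto intro!: integral_nonneg_AE)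
  let ?I = "\<integral>\<^sup>+y. ennreal (lds z f y powr q) \<partial>lebesgue"
  have le: "?I \<le> ennreal (c * \<theta> ^ n * Y powr (q / p))" for n by (rule bound[OF f Y(1)]) (simp add: Y)
  have "(\<lambda>n. c * \<theta> ^ n * Y powr (q / p)) \<longlonglongrightarrow> c * 0 * Y powr (q / p)"
    using \<theta> by (intro tendsto_intros LIMSEQ_realpow_zero) auto
  then have "(\<lambda>n. ennreal (c * \<theta> ^ n * Y powr (q / p))) \<longlonglongrightarrow> ennreal 0"
    by (intro tendsto_ennrealI) simp
  then have "?I \<le> ennreal 0" using le by (intro LIMSEQ_le_const) auto
  then show ?thesis by simp
qed

end

section \<open>The maximal function\<close>

lemma AE_zero_of_cube_avg:
  fixes f :: "'a::euclidean_space \<Rightarrow> complex"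
  assumes f: "bdd_cpt_fun f" and Q [measurable]: "Q \<in> sets borel" "0 < measure lborel Q"
    and supp: "\<And>x. f x \<noteq> 0 \<Longrightarrow> x \<in> Q" and s: "1 \<le> s" and zero: "cube_avg Q s f = 0"
  shows "AE y in lborel. f y = 0"
proof (cases "s = \<infinity>")
  case True
  have [measurable]: "f \<in> borel_measurable borel" using f by (simp add: bdd_cpt_fun_def)
  let ?h = "\<lambda>y. ennreal (norm (f y))"
  have "AE y in restrict_space lebesgue Q. ?h y \<le> esssup (restrict_space lebesgue Q) ?h"
    by (rule esssup_AE)
  then have "AE y in lebesgue. y \<in> Q \<longrightarrow> ?h y \<le> 0"
    using zero True by (subst (asm) AE_restrict_space_iff) (auto simp: cube_avg_def)
  then have "AE y in lebesgue. f y = 0"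
    by eventually_elim (use supp in \<open>auto simp: ennreal_eq_0_iff\<close>)
  then show ?thesis by (simp add: AE_completion_iff)
next
  case False
  then obtain p where p: "s = ennreal p" "0 \<le> p" by (cases s) auto
  have p1: "1 \<le> p" using s p by simp
  have [measurable]: "f \<in> borel_measurable borel" using f by (simp add: bdd_cpt_fun_def)
  have "lp_avg p f Q = 0"
    using zero cube_avg_eq_lp_avg[of f Q p] p p1 lp_avg_nonneg[of p f Q] by (simp add: ennreal_eq_0_iff)
  then have "(\<integral>\<^sup>+y\<in>Q. ennreal (norm (f y) powr p) \<partial>lborel) = 0"
    using nn_integral_lp_avg[OF f, of p Q] p1 Q by simp
  then have "AE y in lborel. ennreal (norm (f y) powr p) * indicator Q y = 0"
    by (subst (asm) nn_integral_0_iff_AE) auto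
  then show ?thesis
    by eventually_elim (use supp in \<open>auto simp: indicator_def ennreal_eq_0_iff split: if_splits\<close>)
qed

text \<open>One cube centred at 0 and containing both supports already forms a sparse family, so one
  of the two averages over it vanishes.\<close>

lemma sparse_sup_eq_0D:
  fixes f g :: "real^'n::finite \<Rightarrow> complex"
  assumes b: "\<And>j. 1 \<le> b j" and f: "bdd_cpt_fun f" and g: "bdd_cpt_fun g" and pr: "1 \<le> p" "1 \<le> r"
    and zero: "sparse_sup b p r f g = 0"
  shows "(AE y in lborel. f y = 0) \<or> (AE y in lborel. g y = 0)"
proof -
  have "bounded ({x. f x \<noteq> 0} \<union> {x. g x \<noteq> 0})"
    using f g by (simp add: bdd_cpt_fun_iff)
  then obtain \<rho> where \<rho>: "\<And>x. f x \<noteq> 0 \<or> g x \<noteq> 0 \<Longrightarrow> norm x \<le> \<rho>"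
    unfolding bounded_iff by auto
  define m where "m = nat \<lceil>2 * \<bar>\<rho>\<bar>\<rceil>"
  define c where "c = (\<chi> j. 2 powi \<lceil>real_of_int (int m) * b j\<rceil> :: real^'n)"
  define Q where "Q = cbox (- (1/2) *\<^sub>R c) (- (1/2) *\<^sub>R c + c)"
  have c_ge: "2 * \<bar>\<rho>\<bar> \<le> c $ j" "0 < c $ j" for j
  proof -
    have "2 * \<bar>\<rho>\<bar> \<le> real m" unfolding m_def by linarith
    also have "\<dots> < 2 ^ m" by (rule of_nat_less_two_power)
    also have "(2::real) ^ m = 2 powi (int m)" by (simp add: power_int_def)
    also have "\<dots> \<le> 2 powi \<lceil>real_of_int (int m) * b j\<rceil>"
    proof (rule power_int_increasing)
      have "real_of_int (int m) * 1 \<le> real_of_int (int m) * b j" using b[of j] by (intro mult_left_mono) auto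
      then show "int m \<le> \<lceil>real_of_int (int m) * b j\<rceil>" by linarith
    qed simp
    finally show "2 * \<bar>\<rho>\<bar> \<le> c $ j" by (simp add: c_def)
    show "0 < c $ j" by (simp add: c_def)
  qed
  have Q: "delta_cube b Q" unfolding delta_cube_def Q_def c_def by blast
  have Q_borel: "Q \<in> sets borel" by (simp add: Q_def)
  have Q_pos: "0 < measure lborel Q"
  proof -
    have "0 \<in> Q" using c_ge(2) by (simp add: Q_def mem_box_cart less_imp_le)
    then have "measure lborel Q = (\<Prod>j\<in>UNIV. c $ j)"
      unfolding Q_def by (subst content_cbox_cart) auto
    then show ?thesis using c_ge(2) by (simp add: prod_pos)
  qed
  have supp: "x \<in> Q" if "f x \<noteq> 0 \<or> g x \<noteq> 0" for x
  proof -
    have "\<bar>x $ j\<bar> \<le> c $ j / 2" for j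
      using component_le_norm_cart[of x j] \<rho>[OF that] c_ge(1)[of j] by linarith
    then show ?thesis by (auto simp: Q_def mem_box_cart abs_le_iff) (smt (verit) field_sum_of_halves)+
  qed
  have sp: "sparse {Q}"
    unfolding sparse_def using Q_borel Q_pos
    by (intro exI[of _ "\<lambda>S. S"]) (auto simp: disjoint_family_on_def)
  have "sparse_form {Q} p r f g \<le> sparse_sup b p r f g"
    unfolding sparse_sup_def using sp Q by (intro SUP_upper) auto
  then have "ennreal (measure lebesgue Q) * cube_avg Q p f * cube_avg Q r g = 0"
    using zero by (simp add: sparse_form_def)
  then have "cube_avg Q p f = 0 \<or> cube_avg Q r g = 0"
    using Q_pos Q_borel by auto
  then show ?thesis
    using AE_zero_of_cube_avg[OF f Q_borel Q_pos _ pr(1)] AE_zero_of_cube_avg[OF g Q_borel Q_pos _ pr(2)] supp by blast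
qed

lemma pairing_eq_0:
  assumes "AE y in lborel. F y = 0 \<or> g y = 0"
  shows "pairing F g = 0"
proof -
  have "AE y in lebesgue. complex_of_real (F y) * g y = 0"
    using AE_completion[OF assms] by eventually_elim auto
  then show ?thesis unfolding pairing_def by (rule integral_eq_zero_AE)
qed

text \<open>Averages may run over null sets, so a function vanishing almost everywhere is not
  obviously annihilated. Local continuity with norm 0 on the right makes the differences vanish
  almost everywhere, and telescoping does the rest.\<close>

lemma (in loccont) maxA_zero_of_null:
  assumes f: "bdd_cpt_fun f" and zero: "AE y in lborel. f y = 0"
  shows "AE y in lborel. maxA f y = 0"
proof -
  obtain z :: "real^'n" where z: "norm z = 1" using unit_vector .
  have "(\<integral>\<^sup>+y. ennreal (lds z (\<lambda>x. f (dilate b D x)) y powr q) \<partial>lebesgue) = 0" if D: "0 < D" for D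
  proof -
    have "AE y in lborel. ennreal (norm (f (dilate b D y)) powr p) = 0"
      using AE_dilate[OF zero D] by eventually_elim simp
    then have "(\<integral>\<^sup>+y. ennreal (norm (f (dilate b D y)) powr p) \<partial>lborel) = (\<integral>\<^sup>+y. 0 \<partial>(lborel :: (real^'n) measure))"
      by (rule nn_integral_cong_AE)
    then show ?thesis
      using lds_nn[OF _ bdd_cpt_fun_dilate[OF f D], of z 0] z by simp
  qed
  then show ?thesis by (rule maxA_zero[OF z f])
qed

lemma (in loccont) sparse_bound:
  obtains K :: real where "\<And>f g. bdd_cpt_fun f \<Longrightarrow> bdd_cpt_fun g \<Longrightarrow>
    ennreal (norm (pairing (maxA f) g)) \<le> ennreal K * sparse_sup b (ennreal p) (ennreal (q / (q - 1))) f g"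
proof (cases "p \<le> q")
  case True
  obtain K :: real where K: "\<And>f g. bdd_cpt_fun f \<Longrightarrow> bdd_cpt_fun g \<Longrightarrow>
    (\<integral>\<^sup>+y. ennreal (maxA f y * norm (g y)) \<partial>lborel) \<le> ennreal K * sparse_sup b (ennreal p) (ennreal (q / (q - 1))) f g"
    using maximal_sparse_bound[OF True] by blast
  show ?thesis
  proof (rule that[of K])
    fix f g :: "real^'n \<Rightarrow> complex" assume fg: "bdd_cpt_fun f" "bdd_cpt_fun g"
    have "\<bar>maxA f y\<bar> = maxA f y" for y using maxA_nonneg[of f y] fg by (simp add: bdd_cpt_fun_iff)
    then show "ennreal (norm (pairing (maxA f) g)) \<le> ennreal K * sparse_sup b (ennreal p) (ennreal (q / (q - 1))) f g"
      using order_trans[OF pairing_le[of "maxA f" g]] K[OF fg] by simp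
  qed
next
  case False
  obtain z :: "real^'n" where z: "norm z = 1" using unit_vector .
  show ?thesis
  proof (rule that[of 0])
    fix f g :: "real^'n \<Rightarrow> complex" assume fg: "bdd_cpt_fun f" "bdd_cpt_fun g"
    have "AE y in lborel. maxA f y = 0"
      using False by (intro maxA_zero[OF z fg(1)] lds_vanish z bdd_cpt_fun_dilate fg) auto
    then have "AE y in lborel. maxA f y = 0 \<or> g y = 0" by eventually_elim simp
    then show "ennreal (norm (pairing (maxA f) g)) \<le> ennreal 0 * sparse_sup b (ennreal p) (ennreal (q / (q - 1))) f g"
      by (simp add: pairing_eq_0)
  qed
qed

lemma interior_unit_square:
  fixes L :: "(real \<times> real) set"
  assumes "L \<subseteq> {0..1} \<times> {0..1}" "(u, w) \<in> interior L"
  shows "0 < u" "u < 1" "0 < w" "w < 1"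
proof -
  have "(u, w) \<in> interior ({0..1::real} \<times> {0..1::real})" using assms interior_mono by blast
  then show "0 < u" "u < 1" "0 < w" "w < 1" by (simp_all add: interior_Times)
qed

lemma interior_dual_range:
  assumes "(u, w) \<in> interior (dual_range L)"
  shows "(u, 1 - w) \<in> interior L"
proof -
  let ?h = "\<lambda>(x, y). (x :: real, 1 - y :: real)"
  have "open (?h -` interior (dual_range L))"
    by (intro open_vimage continuous_intros) (auto simp: case_prod_beta intro!: continuous_intros)
  moreover have "?h -` interior (dual_range L) \<subseteq> L"
    using interior_subset[of "dual_range L"] by (auto simp: dual_range_def)
  moreover have "(u, 1 - w) \<in> ?h -` interior (dual_range L)" using assms by simp
  ultimately show ?thesis by (meson interiorI)
qed

lemma enn2real_inverse_pos:
  assumes "0 < enn2real (1 / p)" "1 \<le> p"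
  shows "p = ennreal (1 / enn2real (1 / p))"
proof (cases p)
  case (real x)
  then have "1 \<le> x" using assms by simp
  then have "1 / p = ennreal (1 / x)" using real by (simp add: divide_ennreal flip: ennreal_1)
  then show ?thesis using real by simp
next
  case top
  then show ?thesis using assms by simp
qed

text \<open>\<nu> has density |\<eta>|, \<open>sg\<close> is the sign of \<eta>, and \<Psi> agrees
  with the given map on a closed ball and is 0 elsewhere, where \<eta> vanishes. Compactness of the
  ball provides the bound \<open>R\<close> and the finiteness of \<nu>.\<close>

lemma averaging_of_smooth:
  fixes \<Phi> :: "'n::finite \<Rightarrow> real^'k::finite \<Rightarrow> real" and b :: "'n \<Rightarrow> real"
  assumes sub: "cball 0 \<delta> \<subseteq> \<Omega>" and \<Phi>: "\<And>j. smooth_on \<Omega> (\<Phi> j)" and b: "\<And>j. 1 \<le> b j"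
    and \<eta>: "smooth_on UNIV \<eta>" "closure {x. \<eta> x \<noteq> 0} \<subseteq> ball 0 \<delta>"
  obtains \<nu> :: "(real^'k) measure" and \<Psi> sg R where "averaging \<nu> \<Psi> sg b R"
    "\<And>t f y. f \<in> borel_measurable borel \<Longrightarrow> avg_op b \<Phi> \<eta> t f y = averaging.A \<nu> \<Psi> sg b t f y"
proof -
  have \<eta>_cont: "continuous_on UNIV \<eta>" using \<eta>(1) unfolding smooth_on_def by (metis C_diff_on.simps(1))
  then have [measurable]: "\<eta> \<in> borel_measurable borel" by (rule borel_measurable_continuous_onI)
  have \<eta>_supp: "\<eta> x = 0" if "x \<notin> cball 0 \<delta>" for x
    using that \<eta>(2) closure_subset[of "{x. \<eta> x \<noteq> 0}"] ball_subset_cball[of 0 \<delta>] by blast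
  have \<Phi>_cont: "continuous_on (cball 0 \<delta>) (\<Phi> j)" for j
    using \<Phi>[of j] sub unfolding smooth_on_def by (metis C_diff_on.simps(1) continuous_on_subset)
  define F where "F x = (\<chi> j. \<Phi> j x)" for x
  have F_cont: "continuous_on (cball 0 \<delta>) F"
    unfolding F_def by (intro continuous_on_vec_lambda \<Phi>_cont)
  define \<Psi> where "\<Psi> x = (if x \<in> cball 0 \<delta> then F x else 0)" for x
  have \<Psi>_meas [measurable]: "\<Psi> \<in> borel_measurable borel"
    unfolding \<Psi>_def by (intro borel_measurable_continuous_on_if F_cont) auto
  have "bounded (F ` cball 0 \<delta>)" by (intro compact_imp_bounded compact_continuous_image F_cont) auto
  then obtain R where R: "0 < R" "\<And>x. x \<in> cball 0 \<delta> \<Longrightarrow> norm (F x) \<le> R" unfolding bounded_pos by auto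
  have "bounded (\<eta> ` cball 0 \<delta>)"
    by (intro compact_imp_bounded compact_continuous_image continuous_on_subset[OF \<eta>_cont]) auto
  then obtain c where c: "0 < c" "\<And>x. x \<in> cball 0 \<delta> \<Longrightarrow> norm (\<eta> x) \<le> c" unfolding bounded_pos by auto
  define \<nu> where "\<nu> = density lborel (\<lambda>x. ennreal \<bar>\<eta> x\<bar>)"
  have space: "sets \<nu> = sets borel" by (simp add: \<nu>_def)
  have "emeasure \<nu> (space \<nu>) < \<infinity>"
  proof -
    have "emeasure \<nu> (space \<nu>) = (\<integral>\<^sup>+x. ennreal \<bar>\<eta> x\<bar> \<partial>lborel)"
      by (simp add: \<nu>_def emeasure_density)
    also have "\<dots> \<le> (\<integral>\<^sup>+x. ennreal c * indicator (cball (0 :: real^'k) \<delta>) x \<partial>lborel)"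
    proof (intro nn_integral_mono)
      fix x show "ennreal \<bar>\<eta> x\<bar> \<le> ennreal c * indicator (cball 0 \<delta>) x"
        using c(2)[of x] \<eta>_supp[of x] by (cases "x \<in> cball 0 \<delta>") (auto intro: ennreal_leI)
    qed
    also have "\<dots> = ennreal c * emeasure lborel (cball (0 :: real^'k) \<delta>)"
      by (rule nn_integral_cmult_indicator) simp
    also have "\<dots> < \<infinity>"
      using emeasure_compact_finite[OF compact_cball, of "0 :: real^'k" \<delta>] by (simp add: ennreal_mult_less_top)
    finally show ?thesis .
  qed
  then have "finite_measure \<nu>" by (intro finite_measureI) auto
  moreover have "averaging_axioms \<nu> \<Psi> (\<lambda>x. sgn (\<eta> x)) b R"
  proof
    show "\<Psi> \<in> borel_measurable \<nu>" "(\<lambda>x. sgn (\<eta> x)) \<in> borel_measurable \<nu>"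
      unfolding measurable_cong_sets[OF space refl] by measurable
    show "\<bar>\<Psi> x $ j\<bar> \<le> R" for x j
      using R component_le_norm_cart[of "F x" j] by (auto simp: \<Psi>_def intro: order_trans)
  qed (auto simp: b sgn_if)
  ultimately have av: "averaging \<nu> \<Psi> (\<lambda>x. sgn (\<eta> x)) b R" by (simp add: averaging_def)
  show ?thesis
  proof (rule that[OF av])
    fix t y and f :: "real^'n \<Rightarrow> complex" assume [measurable]: "f \<in> borel_measurable borel"
    have "avg_op b \<Phi> \<eta> t f y = (LINT x|lebesgue. f (y - dilate b t (\<Psi> x)) * complex_of_real (\<eta> x))"
      unfolding avg_op_def
    proof (intro Bochner_Integration.integral_cong refl)
      fix x
      show "f (y - dilate b t (\<chi> j. \<Phi> j x)) * complex_of_real (\<eta> x) = f (y - dilate b t (\<Psi> x)) * complex_of_real (\<eta> x)"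
        using \<eta>_supp[of x] by (cases "x \<in> cball 0 \<delta>") (auto simp: \<Psi>_def F_def)
    qed
    also have "\<dots> = (LINT x|lborel. f (y - dilate b t (\<Psi> x)) * complex_of_real (\<eta> x))"
      by (rule integral_completion) measurable
    also have "\<dots> = (LINT x|lborel. \<bar>\<eta> x\<bar> *\<^sub>R (f (y - dilate b t (\<Psi> x)) * complex_of_real (sgn (\<eta> x))))"
    proof (intro Bochner_Integration.integral_cong refl)
      fix x
      have "complex_of_real (\<eta> x) = complex_of_real \<bar>\<eta> x\<bar> * complex_of_real (sgn (\<eta> x))"
        by (simp flip: of_real_mult add: abs_mult_sgn)
      then show "f (y - dilate b t (\<Psi> x)) * complex_of_real (\<eta> x) =
          \<bar>\<eta> x\<bar> *\<^sub>R (f (y - dilate b t (\<Psi> x)) * complex_of_real (sgn (\<eta> x)))"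
        by (simp add: scaleR_conv_of_real mult_ac)
    qed
    also have "\<dots> = (LINT x|\<nu>. f (y - dilate b t (\<Psi> x)) * complex_of_real (sgn (\<eta> x)))"
      unfolding \<nu>_def by (subst integral_density) auto
    finally show "avg_op b \<Phi> \<eta> t f y = averaging.A \<nu> \<Psi> (\<lambda>x. sgn (\<eta> x)) b t f y"
      by (simp add: averaging.A_def[OF av])
  qed
qed

text \<open>Two claims, because the order of quantifiers matters: on the full range the constant may
  follow \<open>f\<close> and \<open>g\<close>, while at interior exponents, where local continuity
  is available, it is uniform in them.\<close>

theorem theorem1p4:
  fixes \<Omega> :: "(real^'k::finite) set"
    and \<Phi> :: "'n::finite \<Rightarrow> real^'k \<Rightarrow> real"
    and b :: "'n \<Rightarrow> real"
  assumes "CARD('k) \<le> CARD('n)"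
    and "open \<Omega>" and "0 \<in> \<Omega>"
    and "\<And>j. smooth_on \<Omega> (\<Phi> j)"
    and "\<And>j. b j \<ge> 1"
  shows "\<exists>U. open U \<and> 0 \<in> U \<and> U \<subseteq> \<Omega> \<and>
    (\<forall>\<eta> L. smooth_on UNIV \<eta> \<and> closure {x. \<eta> x \<noteq> 0} \<subseteq> U \<and> local_continuity L b \<Phi> \<eta> \<longrightarrow>
      (\<forall>f g p r. bdd_cpt_fun f \<and> bdd_cpt_fun g \<and>
          1 \<le> p \<and> 1 \<le> r \<and> (enn2real (1 / p), enn2real (1 / r)) \<in> dual_range L \<longrightarrow>
        (\<exists>C::real. ennreal (norm (pairing (max_op b \<Phi> \<eta> f) g)) \<le> ennreal C * sparse_sup b p r f g)) \<and>
      (\<forall>p r. 1 \<le> p \<and> 1 \<le> r \<and>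
          (enn2real (1 / p), enn2real (1 / r)) \<in> interior (dual_range L) \<longrightarrow>
        (\<exists>C::real. \<forall>f g. bdd_cpt_fun f \<and> bdd_cpt_fun g \<longrightarrow>
          ennreal (norm (pairing (max_op b \<Phi> \<eta> f) g)) \<le> ennreal C * sparse_sup b p r f g)))"
proof -
  \<comment> \<open>A closed ball inside \<Omega> is compact, so the map is bounded on it; its
    interior serves as the neighbourhood.\<close>
  obtain \<delta> where \<delta>: "0 < \<delta>" "cball 0 \<delta> \<subseteq> \<Omega>"
    using assms(2,3) open_contains_cball by blast
  show ?thesis
  proof (intro exI[of _ "ball 0 \<delta>"] conjI allI impI; (elim conjE)?)
    show "ball 0 \<delta> \<subseteq> \<Omega>" using \<delta> ball_subset_cball by blast
    fix \<eta> :: "real^'k \<Rightarrow> real" and L :: "(real \<times> real) set"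
    assume \<eta>: "smooth_on UNIV \<eta>" "closure {x. \<eta> x \<noteq> 0} \<subseteq> ball 0 \<delta>" and L: "local_continuity L b \<Phi> \<eta>"
    obtain \<nu> :: "(real^'k) measure" and \<Psi> sg R where av: "averaging \<nu> \<Psi> sg b R"
      and A: "\<And>t f y. f \<in> borel_measurable borel \<Longrightarrow> avg_op b \<Phi> \<eta> t f y = averaging.A \<nu> \<Psi> sg b t f y"
      by (rule averaging_of_smooth[OF \<delta>(2) assms(4,5) \<eta>]) (rule that)
    interpret averaging \<nu> \<Psi> sg b R by (rule av)
    have maxA: "max_op b \<Phi> \<eta> f = maxA f" if "bdd_cpt_fun f" for f
      using that by (simp add: max_op_def maxA_def A bdd_cpt_fun_def fun_eq_iff)
    have lds: "local_diff_sup b \<Phi> \<eta> z f = lds z f" if "bdd_cpt_fun f" for z f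
      using that by (simp add: local_diff_sup_def lds_def translate_def A bdd_cpt_fun_def fun_eq_iff)
    have Lsub: "L \<subseteq> {0..1} \<times> {0..1}" "interior L \<noteq> {}" using L by (auto simp: local_continuity_def)
    have loc: "\<exists>\<epsilon> C. loccont \<nu> \<Psi> sg b R (1 / u) (1 / w) \<epsilon> C" if uw: "(u, w) \<in> interior L" for u w
    proof -
      note sq = interior_unit_square[OF Lsub(1) uw]
      have "1 < 1 / u" "1 < 1 / w" "(1 / (1 / u), 1 / (1 / w)) \<in> interior L" using sq uw by auto
      then obtain \<epsilon> C where \<epsilon>: "0 < \<epsilon>" and lc: "\<And>z f. norm z \<le> 1 \<Longrightarrow> bdd_cpt_fun f \<Longrightarrow>
          integrable lebesgue (\<lambda>y. local_diff_sup b \<Phi> \<eta> z f y powr (1 / w)) \<and>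
          Lp_norm (1 / w) (local_diff_sup b \<Phi> \<eta> z f) \<le> C * norm z powr \<epsilon> * Lp_norm (1 / u) f"
        using L unfolding local_continuity_def by (meson less_imp_le)
      have "loccont \<nu> \<Psi> sg b R (1 / u) (1 / w) \<epsilon> C"
        by unfold_locales (use \<epsilon> lc lds \<open>1 < 1 / u\<close> \<open>1 < 1 / w\<close> in auto)
      then show ?thesis by blast
    qed
    {
      fix f g :: "real^'n \<Rightarrow> complex" and p r :: ennreal
      assume fg: "bdd_cpt_fun f" "bdd_cpt_fun g" and pr: "1 \<le> p" "1 \<le> r"
      show "\<exists>C::real. ennreal (norm (pairing (max_op b \<Phi> \<eta> f) g)) \<le> ennreal C * sparse_sup b p r f g"
      \<comment> \<open>As \<open>C\<close> may depend on \<open>f\<close> and \<open>g\<close>, a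
        finite positive supremum is handled by a quotient and an infinite one by
        \<open>C = 1\<close>; the substance is that the pairing vanishes when the supremum
        does.\<close>
      proof (cases "sparse_sup b p r f g = 0")
        case True
        \<comment> \<open>Any interior point serves: its local continuity makes the maximal function
          of a null function vanish almost everywhere.\<close>
        obtain u w where uw: "(u, w) \<in> interior L" using Lsub(2) by auto
        obtain \<epsilon> C where "loccont \<nu> \<Psi> sg b R (1 / u) (1 / w) \<epsilon> C" using loc[OF uw] by blast
        then interpret lc: loccont \<nu> \<Psi> sg b R "1 / u" "1 / w" \<epsilon> C .
        have "(AE y in lborel. maxA f y = 0) \<or> (AE y in lborel. g y = 0)"
          using sparse_sup_eq_0D[OF assms(5) fg pr True] lc.maxA_zero_of_null[OF fg(1)] by blast
        then have "AE y in lborel. maxA f y = 0 \<or> g y = 0" by auto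
        then show ?thesis by (simp add: maxA[OF fg(1)] pairing_eq_0)
      next
        case False
        show ?thesis
        proof (cases "sparse_sup b p r f g")
          case (real s)
          then show ?thesis using False
            by (intro exI[of _ "norm (pairing (max_op b \<Phi> \<eta> f) g) / s"]) (simp add: ennreal_mult[symmetric])
        next
          case top
          then show ?thesis by (intro exI[of _ 1]) simp
        qed
      qed
    }
    {
      fix p r :: ennreal
      assume pr: "1 \<le> p" "1 \<le> r" and mem: "(enn2real (1 / p), enn2real (1 / r)) \<in> interior (dual_range L)"
      define u where "u = enn2real (1 / p)"
      define w where "w = enn2real (1 / r)"
      have uw: "(u, 1 - w) \<in> interior L" using interior_dual_range[OF mem] by (simp add: u_def w_def)
      note sq = interior_unit_square[OF Lsub(1) uw]
      have p_eq: "p = ennreal (1 / u)" using enn2real_inverse_pos[of p] pr sq by (simp add: u_def)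
      have r_eq: "r = ennreal (1 / w)" using enn2real_inverse_pos[of r] pr sq by (simp add: w_def)
      obtain \<epsilon> C where "loccont \<nu> \<Psi> sg b R (1 / u) (1 / (1 - w)) \<epsilon> C" using loc[OF uw] by blast
      then interpret lc: loccont \<nu> \<Psi> sg b R "1 / u" "1 / (1 - w)" \<epsilon> C .
      \<comment> \<open>Identifies \<open>r\<close> as the exponent conjugate to
        \<open>1 / (1 - w)\<close>.\<close>
      have "1 / (1 - w) / (1 / (1 - w) - 1) = 1 / w" using sq by (simp add: field_simps)
      then show "\<exists>C::real. \<forall>f g. bdd_cpt_fun f \<and> bdd_cpt_fun g \<longrightarrow>
          ennreal (norm (pairing (max_op b \<Phi> \<eta> f) g)) \<le> ennreal C * sparse_sup b p r f g"
        using lc.sparse_bound unfolding p_eq r_eq by (metis maxA)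
    }
  qed (use \<delta> in auto)
qed

end
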